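(* Let $X$ be a CAT(0) cube complex with a non-transverse action by a group $G$, and let $\gamma$ be a segment in $X$. Fix a vertex $x_0\in X$ and for each $g\in G$ fix a vertex $x_g\in X_g$, and define $\psi_\gamma,\varphi_\gamma\colon G\to\mathbb R$ by $\psi_\gamma(g)=\omega_\gamma(x_0,gx_0)$ and $\varphi_\gamma(g)=\omega_\gamma(x_g,gx_g)$. Then $\psi_\gamma-\varphi_\gamma$ is uniformly bounded. Hence $\varphi_\gamma$ is a quasimorphism, $\widehat\varphi_\gamma=\widehat\psi_\gamma$, and $\widehat\varphi_\gamma$ has defect at most $12$.
   Context: A half-space $H$ of $X$ is the closure of a component of the complement of a hyperplane, $\overline H$ the complementary half-space; $\mathcal H(X)$ is ordered by inclusion and $\subset$ is strict. $H\pitchfork H'$ (transverse) means $H\cap H'$, $H\cap\overline{H'}$, $\overline H\cap H'$, $\overline H\cap\overline{H'}$ are all nonempty. $H, H'$ are tightly nested if one strictly contains the other and no third half-space lies properly between. For vertices $x,y$, $[x,y]=\{H: y\in H,\ x\in\overline H\}$. An action is non-transverse if there are no $g\in G$, $H\in\mathcal H(X)$ with $gH=\overline H$ (no inversion) and none with $H\pitchfork gH$. A segment $\gamma$ is a finite chain $H_1\supset\dots\supset H_n$ with $H_i,H_{i+1}$ tightly nested for all $i$; its inverse $\overline\gamma$ is $\overline H_n\supset\dots\supset\overline H_1$. Two segments $\gamma,\gamma'$ overlap if $\gamma\cap\gamma'\neq\emptyset$ or there are $H\in\gamma$, $H'\in\gamma'$ with $H\pitchfork H'$; otherwise they are non-overlapping.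 Copies of $\gamma$ are the translates $g\gamma$, $g\in G$. $c_\gamma(x,y)$ is the maximal cardinality of a pairwise non-overlapping collection of copies of $\gamma$ contained in $[x,y]$, and $\omega_\gamma(x,y)=c_\gamma(x,y)-c_{\overline\gamma}(x,y)$. For $g\in G$, $M_g$ is the full subcomplex of $X$ spanned by vertices realizing $\min_x d(x,gx)$ ($d$ the combinatorial metric on vertices, $x$ ranging over vertices), and $X_g$ is its convex hull (the smallest subcomplex containing $M_g$ such that every combinatorial geodesic between two of its vertices is contained in it). A quasimorphism is a map $\varphi\colon G\to\mathbb R$ with $|\varphi(gh)-\varphi(g)-\varphi(h)|\le D$ for all $g,h$ and some $D\geq 0$; the least such $D$ is its defect. Its homogenization is $\widehat\varphi(g)=\lim_{n\to\infty}\varphi(g^n)/n$. *)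

theory Defs
  imports "HOL-Analysis.Analysis" "HOL-Algebra.Group_Action"
begin

text \<open>
  A cubical complex (cubes embed, and two cubes meet in a common face or not at all) is encoded
  like an abstract simplicial complex, by the set \<open>K\<close> of the vertex sets of its cubes.  The
  vertices of the standard \<open>n\<close>-cube are the subsets of \<open>{..<n}\<close>, and its faces are the order
  intervals between two of them.  A chart of a cube \<open>Q\<close> labels the vertices of \<open>Q\<close> by those of
  the standard cube in such a way that the cubes of \<open>K\<close> contained in \<open>Q\<close> are exactly the faces.
\<close>

definition cube_chart :: "'v set set \<Rightarrow> 'v set \<Rightarrow> nat \<Rightarrow> (nat set \<Rightarrow> 'v) \<Rightarrow> bool" where
  "cube_chart K Q n \<beta> \<longleftrightarrow>
     bij_betw \<beta> (Pow {..<n}) Q \<and>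
     {Q' \<in> K. Q' \<subseteq> Q} = {\<beta> ` {T. A \<subseteq> T \<and> T \<subseteq> B} |A B. A \<subseteq> B \<and> B \<subseteq> {..<n}}"

definition cubical_complex :: "'v set set \<Rightarrow> bool" where
  "cubical_complex K \<longleftrightarrow>
     (\<forall>Q\<in>K. \<exists>n \<beta>. cube_chart K Q n \<beta>) \<and>
     (\<forall>Q\<in>K. \<forall>Q'\<in>K. Q \<inter> Q' = {} \<or> Q \<inter> Q' \<in> K)"

definition vertices :: "'v set set \<Rightarrow> 'v set" where
  "vertices K = \<Union>K"

definition edges :: "'v set set \<Rightarrow> 'v set set" where
  "edges K = {e \<in> K. card e = 2}"

text \<open>
  Geometric realization.  A vertex \<open>v\<close> is represented by the indicator function of \<open>{v}\<close>, and the
  point with coordinates \<open>t \<in> [0,1]\<^sup>n\<close> of a cube by the corresponding multi-affine combination of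
  the vertices of the cube.  This embeds each cube \<open>[0,1]\<^sup>n\<close>, is compatible with faces and with
  change of chart, and recovers the cubes from their interiors.  The topology is that of
  pointwise convergence; on the realization, whose points are finitely supported probability
  distributions, it agrees with the \<open>\<ell>\<^sup>1\<close> metric topology.
\<close>

definition cube_point :: "nat \<Rightarrow> (nat set \<Rightarrow> 'v) \<Rightarrow> (nat \<Rightarrow> real) \<Rightarrow> 'v \<Rightarrow> real" where
  "cube_point n \<beta> t =
     (\<lambda>v. \<Sum>T\<in>Pow {..<n}. if \<beta> T = v then (\<Prod>i\<in>T. t i) * (\<Prod>i\<in>{..<n} - T. 1 - t i) else 0)"

definition realization :: "'v set set \<Rightarrow> ('v \<Rightarrow> real) set" where
  "realization K =
     {cube_point n \<beta> t |n \<beta> t. (\<exists>Q\<in>K. cube_chart K Q n \<beta>) \<and> (\<forall>i<n. 0 \<le> t i \<and> t i \<le> 1)}"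

text \<open>
  The link of a vertex \<open>v\<close>, with the edges at \<open>v\<close> represented by their other endpoints; the empty
  simplex is included.
\<close>

definition link :: "'v set set \<Rightarrow> 'v \<Rightarrow> 'v set set" where
  "link K v = {{u \<in> Q. {v, u} \<in> edges K} |Q. Q \<in> K \<and> v \<in> Q}"

definition flag_complex :: "'v set set \<Rightarrow> bool" where
  "flag_complex L \<longleftrightarrow> (\<forall>S. finite S \<and> (\<forall>a\<in>S. \<forall>b\<in>S. {a, b} \<in> L) \<longrightarrow> S \<in> L)"

definition CAT0_cube_complex :: "'v set set \<Rightarrow> bool" where
  "CAT0_cube_complex K \<longleftrightarrow>
     cubical_complex K \<and> simply_connected (realization K) \<and>
     (\<forall>v\<in>vertices K. flag_complex (link K v))"

definition opposite_edges :: "'v set set \<Rightarrow> 'v set \<Rightarrow> 'v set \<Rightarrow> bool" where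
  "opposite_edges K e e' \<longleftrightarrow>
     e \<in> edges K \<and> e' \<in> edges K \<and> e \<inter> e' = {} \<and> (\<exists>Q\<in>K. card Q = 4 \<and> e \<subseteq> Q \<and> e' \<subseteq> Q)"

definition parallel_edges :: "'v set set \<Rightarrow> 'v set \<Rightarrow> 'v set \<Rightarrow> bool" where
  "parallel_edges K = (opposite_edges K)\<^sup>*\<^sup>*"

text \<open>The union of the midcubes dual to the edges parallel to \<open>e\<close>.\<close>

definition hyperplane :: "'v set set \<Rightarrow> 'v set \<Rightarrow> ('v \<Rightarrow> real) set" where
  "hyperplane K e =
     {cube_point n \<beta> t |n \<beta> t.
        (\<exists>Q\<in>K. cube_chart K Q n \<beta>) \<and> (\<forall>i<n. 0 \<le> t i \<and> t i \<le> 1) \<and>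
        (\<exists>i<n. t i = 1/2 \<and> parallel_edges K e {\<beta> {}, \<beta> {i}})}"

text \<open>
  A half-space is identified with the set of vertices it contains.  In particular, emptiness of
  the intersections in the definition of transversality is tested on vertices: a closed half-space
  and its complementary one always share the points of the hyperplane, but no vertex.
\<close>

definition half_spaces :: "'v set set \<Rightarrow> 'v set set" where
  "half_spaces K =
     {{v \<in> vertices K. indicat_real {v} \<in> closure C} |e C.
        e \<in> edges K \<and> C \<in> components (realization K - hyperplane K e)}"

definition compl_half_space :: "'v set set \<Rightarrow> 'v set \<Rightarrow> 'v set" where
  "compl_half_space K H = vertices K - H"

definition transverse :: "'v set set \<Rightarrow> 'v set \<Rightarrow> 'v set \<Rightarrow> bool" where
  "transverse K H H' \<longleftrightarrow>
     H \<inter> H' \<noteq> {} \<and> H \<inter> compl_half_space K H' \<noteq> {} \<and>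
     compl_half_space K H \<inter> H' \<noteq> {} \<and> compl_half_space K H \<inter> compl_half_space K H' \<noteq> {}"

definition tightly_nested :: "'v set set \<Rightarrow> 'v set \<Rightarrow> 'v set \<Rightarrow> bool" where
  "tightly_nested K H H' \<longleftrightarrow>
     (H' \<subset> H \<and> \<not> (\<exists>H''\<in>half_spaces K. H' \<subset> H'' \<and> H'' \<subset> H)) \<or>
     (H \<subset> H' \<and> \<not> (\<exists>H''\<in>half_spaces K. H \<subset> H'' \<and> H'' \<subset> H'))"

definition half_space_interval :: "'v set set \<Rightarrow> 'v \<Rightarrow> 'v \<Rightarrow> 'v set set" where
  "half_space_interval K x y = {H \<in> half_spaces K. y \<in> H \<and> x \<in> compl_half_space K H}"

definition cubical_action ::
  "('g, 'b) monoid_scheme \<Rightarrow> 'v set set \<Rightarrow> ('g \<Rightarrow> 'v \<Rightarrow> 'v) \<Rightarrow> bool" where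
  "cubical_action G K \<alpha> \<longleftrightarrow>
     group_action G (vertices K) \<alpha> \<and> (\<forall>g\<in>carrier G. \<forall>Q\<in>K. \<alpha> g ` Q \<in> K)"

definition non_transverse_action ::
  "('g, 'b) monoid_scheme \<Rightarrow> 'v set set \<Rightarrow> ('g \<Rightarrow> 'v \<Rightarrow> 'v) \<Rightarrow> bool" where
  "non_transverse_action G K \<alpha> \<longleftrightarrow>
     cubical_action G K \<alpha> \<and>
     \<not> (\<exists>g\<in>carrier G. \<exists>H\<in>half_spaces K. \<alpha> g ` H = compl_half_space K H) \<and>
     \<not> (\<exists>g\<in>carrier G. \<exists>H\<in>half_spaces K. transverse K H (\<alpha> g ` H))"

text \<open>A chain is represented by its set of members, which determines it.\<close>

definition segment :: "'v set set \<Rightarrow> 'v set set \<Rightarrow> bool" where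
  "segment K \<gamma> \<longleftrightarrow>
     (\<exists>Hs. Hs \<noteq> [] \<and> set Hs = \<gamma> \<and> set Hs \<subseteq> half_spaces K \<and>
        (\<forall>i. Suc i < length Hs \<longrightarrow>
           Hs ! Suc i \<subset> Hs ! i \<and> tightly_nested K (Hs ! i) (Hs ! Suc i)))"

definition inverse_segment :: "'v set set \<Rightarrow> 'v set set \<Rightarrow> 'v set set" where
  "inverse_segment K \<gamma> = compl_half_space K ` \<gamma>"

definition overlap :: "'v set set \<Rightarrow> 'v set set \<Rightarrow> 'v set set \<Rightarrow> bool" where
  "overlap K \<gamma> \<gamma>' \<longleftrightarrow> \<gamma> \<inter> \<gamma>' \<noteq> {} \<or> (\<exists>H\<in>\<gamma>. \<exists>H'\<in>\<gamma>'. transverse K H H')"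

definition copies ::
  "('g, 'b) monoid_scheme \<Rightarrow> ('g \<Rightarrow> 'v \<Rightarrow> 'v) \<Rightarrow> 'v set set \<Rightarrow> 'v set set set" where
  "copies G \<alpha> \<gamma> = {(`) (\<alpha> g) ` \<gamma> |g. g \<in> carrier G}"

definition copy_count ::
  "('g, 'b) monoid_scheme \<Rightarrow> 'v set set \<Rightarrow> ('g \<Rightarrow> 'v \<Rightarrow> 'v) \<Rightarrow> 'v set set \<Rightarrow> 'v \<Rightarrow> 'v \<Rightarrow> nat" where
  "copy_count G K \<alpha> \<gamma> x y =
     Max {card \<C> |\<C>. \<C> \<subseteq> copies G \<alpha> \<gamma> \<and> (\<forall>\<delta>\<in>\<C>. \<delta> \<subseteq> half_space_interval K x y) \<and>
                       pairwise (\<lambda>\<delta> \<delta>'. \<not> overlap K \<delta> \<delta>') \<C>}"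

definition signed_count ::
  "('g, 'b) monoid_scheme \<Rightarrow> 'v set set \<Rightarrow> ('g \<Rightarrow> 'v \<Rightarrow> 'v) \<Rightarrow> 'v set set \<Rightarrow> 'v \<Rightarrow> 'v \<Rightarrow> real" where
  "signed_count G K \<alpha> \<gamma> x y =
     real (copy_count G K \<alpha> \<gamma> x y) - real (copy_count G K \<alpha> (inverse_segment K \<gamma>) x y)"

definition edge_path :: "'v set set \<Rightarrow> 'v list \<Rightarrow> bool" where
  "edge_path K p \<longleftrightarrow>
     p \<noteq> [] \<and> set p \<subseteq> vertices K \<and> (\<forall>i. Suc i < length p \<longrightarrow> {p ! i, p ! Suc i} \<in> edges K)"

definition comb_dist :: "'v set set \<Rightarrow> 'v \<Rightarrow> 'v \<Rightarrow> nat" where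
  "comb_dist K x y = (LEAST n. \<exists>p. edge_path K p \<and> hd p = x \<and> last p = y \<and> length p = Suc n)"

definition comb_geodesic :: "'v set set \<Rightarrow> 'v list \<Rightarrow> bool" where
  "comb_geodesic K p \<longleftrightarrow> edge_path K p \<and> length p = Suc (comb_dist K (hd p) (last p))"

definition subcomplex :: "'v set set \<Rightarrow> 'v set set \<Rightarrow> bool" where
  "subcomplex L K \<longleftrightarrow> L \<subseteq> K \<and> (\<forall>Q\<in>L. \<forall>Q'\<in>K. Q' \<subseteq> Q \<longrightarrow> Q' \<in> L)"

definition full_subcomplex :: "'v set set \<Rightarrow> 'v set \<Rightarrow> 'v set set" where
  "full_subcomplex K S = {Q \<in> K. Q \<subseteq> S}"

definition convex_subcomplex :: "'v set set \<Rightarrow> 'v set set \<Rightarrow> bool" where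
  "convex_subcomplex L K \<longleftrightarrow>
     subcomplex L K \<and>
     (\<forall>p. comb_geodesic K p \<and> hd p \<in> vertices L \<and> last p \<in> vertices L \<longrightarrow>
        set p \<subseteq> vertices L \<and> (\<forall>i. Suc i < length p \<longrightarrow> {p ! i, p ! Suc i} \<in> L))"

definition convex_hull_complex :: "'v set set \<Rightarrow> 'v set set \<Rightarrow> 'v set set" where
  "convex_hull_complex K M = \<Inter>{L. convex_subcomplex L K \<and> M \<subseteq> L}"

definition min_complex :: "'v set set \<Rightarrow> ('v \<Rightarrow> 'v) \<Rightarrow> 'v set set" where
  "min_complex K a =
     full_subcomplex K {x \<in> vertices K. \<forall>y\<in>vertices K. comb_dist K x (a x) \<le> comb_dist K y (a y)}"

definition min_hull :: "'v set set \<Rightarrow> ('v \<Rightarrow> 'v) \<Rightarrow> 'v set set" where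
  "min_hull K a = convex_hull_complex K (min_complex K a)"

definition defect_bound :: "('g, 'b) monoid_scheme \<Rightarrow> ('g \<Rightarrow> real) \<Rightarrow> real \<Rightarrow> bool" where
  "defect_bound G \<phi> D \<longleftrightarrow>
     0 \<le> D \<and> (\<forall>g\<in>carrier G. \<forall>h\<in>carrier G. \<bar>\<phi> (g \<otimes>\<^bsub>G\<^esub> h) - \<phi> g - \<phi> h\<bar> \<le> D)"

definition quasimorphism :: "('g, 'b) monoid_scheme \<Rightarrow> ('g \<Rightarrow> real) \<Rightarrow> bool" where
  "quasimorphism G \<phi> \<longleftrightarrow> (\<exists>D. defect_bound G \<phi> D)"

text \<open>Only meaningful for quasimorphisms: otherwise this is the infimum of the empty set.\<close>

definition defect :: "('g, 'b) monoid_scheme \<Rightarrow> ('g \<Rightarrow> real) \<Rightarrow> real" where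
  "defect G \<phi> = Inf {D. defect_bound G \<phi> D}"

definition homogenization :: "('g, 'b) monoid_scheme \<Rightarrow> ('g \<Rightarrow> real) \<Rightarrow> 'g \<Rightarrow> real" where
  "homogenization G \<phi> g = lim (\<lambda>n. \<phi> (g [^]\<^bsub>G\<^esub> (n::nat)) / real n)"

end

theory Submission
  imports Defs
begin

text \<open>
  Let \<open>z\<close> be a third vertex. The half-spaces in \<open>[x, y]\<close> are divided into those which contain \<open>z\<close> and
  those which do not. Non-overlapping copies of \<open>\<gamma>\<close> in \<open>[x, y]\<close> form a chain by tightness, and the tops of
  any two copies are not transverse; hence the maximal number of copies changes by at most one under
  this division, and \<open>\<omega>\<^sub>\<gamma>\<close> by at most two. Treating the three sides of a triangle in this way yields
  six sets of half-spaces, which cancel in complementary pairs, so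
  \<open>\<bar>\<omega>\<^sub>\<gamma>(x, y) + \<omega>\<^sub>\<gamma>(y, z) + \<omega>\<^sub>\<gamma>(z, x)\<bar> \<le> 6\<close>. Thus \<open>\<psi>\<^sub>\<gamma>\<close> has defect at most \<open>6\<close> and, for any choice of the
  vertices \<open>x\<^sub>g\<close>, differs from \<open>\<phi>\<^sub>\<gamma>\<close> by at most \<open>12\<close>. Homogenization at most doubles the defect \<open>D\<close> of an
  antisymmetric quasimorphism: \<open>m\<close> interchanges of two blocks turn \<open>(ab)\<^bsup>2m+1\<^esup>\<close> into \<open>a\<^bsup>2m+1\<^esup> b\<^bsup>2m+1\<^esup>\<close>, and each of
  them is multiplication by one commutator, at a cost of \<open>4D\<close>.

  The geometry enters only through two facts: half-spaces come in complementary pairs, and finitely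
  many of them separate two given vertices. Edge paths that cannot be shortened, modulo swaps across
  squares, form a local system on the cube complex; flagness makes it well defined, and simple
  connectivity makes it trivial. This gives the quadrangle condition for the combinatorial distance,
  whence the sides \<open>{v. d(v, a) < d(v, b)}\<close> of an edge \<open>ab\<close> depend only on its parallelism class. The
  hyperplane is then the set of points whose barycentric coordinates on a side add up to \<open>1/2\<close>.
\<close>

section \<open>Edge paths modulo swaps across squares\<close>

text \<open>Half-spaces are defined topologically, as closures of components, while
  \<open>CAT0_cube_complex\<close> provides only flag links and simple connectivity. The gap to be
  bridged is that an edge has exactly two sides and that the edges crossing from one side to the
  other are precisely those parallel to it. Distances have no local description, so simple
  connectivity cannot be applied to them directly. Classes of reduced paths from a base point do
  have one: moving along an edge either undoes the last step of a class or adds a step. A global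
  section of this system attaches one class to every vertex, and the length of that class turns out
  to be the distance to the base point. In this way metric facts about the graph are read off from
  the shape of a class near its end, and disc diagrams are avoided. Paths carry their swap relation
  as an inductive predicate with a special form of the swap rule, since each of these readings is an
  inversion at the last edge.\<close>

locale square_graph =
  fixes adj :: "'v \<Rightarrow> 'v \<Rightarrow> bool" and sq :: "'v \<Rightarrow> 'v \<Rightarrow> 'v \<Rightarrow> 'v \<Rightarrow> bool"
  assumes adj_sym: "adj a b \<Longrightarrow> adj b a"
    and sq_rot: "sq a b c d \<Longrightarrow> sq b c d a"
    and sq_flip: "sq a b c d \<Longrightarrow> sq a d c b"
    and sq_adj: "sq a b c d \<Longrightarrow> adj a b"
    and sq_diag: "sq a b c d \<Longrightarrow> a \<noteq> c"
    and sq_unique: "sq a b c d \<Longrightarrow> sq a b c d' \<Longrightarrow> d = d'"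
    and sq_cube: "sq b z y z' \<Longrightarrow> sq b z a v \<Longrightarrow> sq b z' c v \<Longrightarrow> \<exists>x. sq x a v c \<and> sq y z a x \<and> sq y z' c x"
begin

lemma sq_sym:
  assumes "sq a b c d"
  shows "sq b c d a" "sq c d a b" "sq d a b c" "sq a d c b" "sq d c b a" "sq c b a d" "sq b a d c"
proof -
  show 1: "sq b c d a" using assms by (rule sq_rot)
  show 2: "sq c d a b" using 1 by (rule sq_rot)
  show 3: "sq d a b c" using 2 by (rule sq_rot)
  show "sq a d c b" using assms by (rule sq_flip)
  show "sq b a d c" using 1 by (rule sq_flip)
  show "sq c b a d" using 2 by (rule sq_flip)
  show "sq d c b a" using 3 by (rule sq_flip)
qed

lemma sq_adjs:
  assumes "sq a b c d"
  shows "adj a b" "adj b a" "adj b c" "adj c b" "adj c d" "adj d c" "adj d a" "adj a d" "a \<noteq> c" "b \<noteq> d"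
  using sq_adj[OF assms] sq_adj[OF sq_sym(1)[OF assms]] sq_adj[OF sq_sym(2)[OF assms]]
    sq_adj[OF sq_sym(3)[OF assms]] sq_diag[OF assms] sq_diag[OF sq_sym(1)[OF assms]]
  by (auto intro: adj_sym)

text \<open>Paths are lists in reverse order: the head is the endpoint.\<close>

inductive swap_eq :: "'v list \<Rightarrow> 'v list \<Rightarrow> bool" where
  start: "swap_eq [v] [v]"
| same: "swap_eq p q \<Longrightarrow> swap_eq (v # p) (v # q)"
| swap: "sq z a v b \<Longrightarrow> swap_eq p (a # z # r) \<Longrightarrow> swap_eq q (b # z # r) \<Longrightarrow> swap_eq (v # p) (v # q)"

lemma swap_eq_basic: "swap_eq p q \<Longrightarrow> p \<noteq> [] \<and> q \<noteq> [] \<and> hd p = hd q \<and> last p = last q \<and> length p = length q"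
  by (induction rule: swap_eq.induct) auto

lemma swap_eq_refl: "p \<noteq> [] \<Longrightarrow> swap_eq p p"
  by (induction p) (metis list.exhaust start same)+

lemma swap_eq_sym: "swap_eq p q \<Longrightarrow> swap_eq q p"
proof (induction rule: swap_eq.induct)
  case (swap z a v b p r q)
  then show ?case using swap_eq.swap[of z b v a q r p] sq_sym(4) by simp
qed (auto intro: swap_eq.intros)

text \<open>The relation is generated without a transitivity rule, and each rule swaps at most one
  square at the endpoint. Inversion therefore has only two outcomes, and transitivity becomes a
  confluence statement, proved next.\<close>

lemma swap_eq_ConsE [consumes 2, case_names here fork]:
  assumes "swap_eq (v # p) (v # q)" "p \<noteq> []"
  obtains "swap_eq p q"
  | z a b r where "sq z a v b" "swap_eq p (a # z # r)" "swap_eq q (b # z # r)"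
  using assms by (cases rule: swap_eq.cases) auto

text \<open>The flag condition enters here: two different squares below the last edge span a cube.\<close>

lemma swap_eq_trans: "swap_eq p q \<Longrightarrow> swap_eq q s \<Longrightarrow> swap_eq p s"
proof (induction "length p" arbitrary: p q s rule: less_induct)
  case less
  note IH = less.hyps
  obtain v p' where p: "p = v # p'" using swap_eq_basic[OF less.prems(1)] by (cases p) auto
  obtain q' where q: "q = v # q'"
    using swap_eq_basic[OF less.prems(1)] p by (cases q) auto
  obtain s' where s: "s = v # s'"
    using swap_eq_basic[OF less.prems(2)] q by (cases s) auto
  show ?case
  proof (cases "p' = []")
    case True
    then show ?thesis using swap_eq_basic[OF less.prems(1)] swap_eq_basic[OF less.prems(2)] p q s
      by (auto intro: start)
  next
    case False
    have q': "q' \<noteq> []" using False swap_eq_basic[OF less.prems(1)] p q by auto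
    have T: "swap_eq y w" if "swap_eq x y" "swap_eq x w" "length x = length p'" for x y w
      using IH[of y x w] that swap_eq_sym swap_eq_basic[OF that(1)] p by auto
    have len: "length q' = length p'" "length s' = length p'"
      using swap_eq_basic[OF less.prems(1)] swap_eq_basic[OF less.prems(2)] p q s by auto
    have pq: "swap_eq (v # p') (v # q')" and qs: "swap_eq (v # q') (v # s')"
      using less.prems p q s by auto
    from pq False show ?thesis
    proof (cases rule: swap_eq_ConsE)
      case here
      then have pq: "swap_eq p' q'" by simp
      from qs q' show ?thesis
      proof (cases rule: swap_eq_ConsE)
        case here
        then show ?thesis using IH[OF _ pq] p s by (auto intro: same)
      next
        case (fork z a b r)
        then show ?thesis using IH[OF _ pq, of "a # z # r"] p s by (auto intro: swap)
      qed
    next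
      case (fork z a b r)
      then have sq1: "sq z a v b" and pa: "swap_eq p' (a # z # r)" and qb: "swap_eq q' (b # z # r)" by auto
      from qs q' show ?thesis
      proof (cases rule: swap_eq_ConsE)
        case here
        then have "swap_eq s' (b # z # r)" using T[of q' s'] qb len by auto
        then show ?thesis using sq1 pa p s by (auto intro: swap)
      next
        case (fork z' b' c r')
        then have sq2: "sq z' b' v c" and qb': "swap_eq q' (b' # z' # r')" and sc: "swap_eq s' (c # z' # r')"
          by auto
        have bb: "swap_eq (b # z # r) (b' # z' # r')" using T[OF qb qb'] len by simp
        then have b': "b' = b" using swap_eq_basic[OF bb] by simp
        have lr: "Suc (Suc (length r)) = length p'" "Suc (Suc (length r')) = length p'"
          using swap_eq_basic[OF pa] swap_eq_basic[OF sc] len by auto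
        \<comment> \<open>The middle path reaches \<open>b\<close> through \<open>z\<close> and
          through \<open>z'\<close>. If these agree, uniqueness of squares gives
          \<open>a = c\<close>; otherwise the squares at \<open>b\<close> have to be completed to a
          cube.\<close>
        from bb[unfolded b'] list.distinct(2)[of z r] show ?thesis
        proof (cases rule: swap_eq_ConsE)
          case here
          then have zz: "swap_eq (z # r) (z' # r')" by simp
          then have z: "z' = z" using swap_eq_basic[OF zz] by simp
          have "sq z b v a" "sq z b v c" using sq_sym(4)[OF sq1] sq2 z b' by simp_all
          then have ac: "a = c" using sq_unique by blast
          have "swap_eq (a # z # r) (c # z' # r')" using zz ac by (auto intro: same)
          moreover have "swap_eq (c # z' # r') s'" using sc by (rule swap_eq_sym)
          ultimately have "swap_eq (a # z # r) s'" using IH[of "a # z # r"] lr p by auto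
          then have "swap_eq p' s'" using IH[OF _ pa] p by auto
          then show ?thesis using p s by (auto intro: same)
        next
          case (fork y z1 z1' t)
          have z1: "z1 = z" "z1' = z'" using swap_eq_basic[OF fork(2)] swap_eq_basic[OF fork(3)] by auto
          have yq: "sq y z b z'" using fork(1) z1 b' by simp
          have zr: "swap_eq (z # r) (z # y # t)" "swap_eq (z' # r') (z' # y # t)" using fork z1 by auto
          have "sq b z y z'" using sq_sym[OF yq] by simp
          moreover have "sq b z a v" using sq_sym[OF sq1] by simp
          moreover have "sq b z' c v" using sq_sym[OF sq2] b' by simp
          \<comment> \<open>\<open>x\<close> is the corner opposite to \<open>b\<close> in the cube
            spanned at \<open>b\<close> by \<open>z\<close>, \<open>z'\<close> and \<open>v\<close>.
            Both outer paths can be swapped to pass through \<open>x\<close>, so \<open>p'\<close>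
            and \<open>s'\<close> fork over the square \<open>x a v c\<close>.\<close>
          ultimately obtain x where x: "sq x a v c" "sq y z a x" "sq y z' c x" using sq_cube by blast
          have tne: "swap_eq (w # y # t) (w # y # t)" for w by (rule swap_eq_refl) simp
          have "swap_eq (a # z # r) (a # z # y # t)" using zr(1) by (rule same)
          moreover have "swap_eq (a # z # y # t) (a # x # y # t)"
            using x(2) by (rule swap) (auto intro: tne)
          ultimately have "swap_eq p' (a # x # y # t)"
            using IH[OF _ pa] IH[of "a # z # r"] lr p by auto
          moreover have "swap_eq (c # z' # r') (c # z' # y # t)" using zr(2) by (rule same)
          then have "swap_eq s' (c # z' # y # t)"
            using IH[OF _ sc] len p by auto
          moreover have "swap_eq (c # z' # y # t) (c # x # y # t)"
            using x(3) by (rule swap) (auto intro: tne)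
          ultimately have "swap_eq p' (a # x # y # t)" "swap_eq s' (c # x # y # t)"
            using IH[of s'] len p by auto
          then show ?thesis using swap[OF x(1)] p s by blast
        qed
      qed
    qed
  qed
qed

lemma swap_eq_cancel: "swap_eq (v # a # p) (v # a # q) \<Longrightarrow> swap_eq (a # p) (a # q)"
proof (erule swap_eq_ConsE)
  fix z a' b r
  assume *: "sq z a' v b" "swap_eq (a # p) (a' # z # r)" "swap_eq (a # q) (b # z # r)"
  then have "a = a'" "a = b" using swap_eq_basic[OF *(2)] swap_eq_basic[OF *(3)] by auto
  then show "swap_eq (a # p) (a # q)" using sq_adjs[OF *(1)] by simp
qed auto

lemma swap_eq_fork:
  assumes "swap_eq (v # a # p) (v # b # q)" "a \<noteq> b"
  obtains z r where "sq z a v b" "swap_eq (a # p) (a # z # r)" "swap_eq (b # q) (b # z # r)"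
proof -
  have "a # p \<noteq> []" by simp
  with assms(1) show ?thesis
  proof (cases rule: swap_eq_ConsE)
    case here
    then show ?thesis using swap_eq_basic[of "a # p" "b # q"] assms(2) by auto
  next
    case (fork z a' b' r)
    then have "a = a'" "b = b'"
      using swap_eq_basic[OF fork(2)] swap_eq_basic[OF fork(3)] by auto
    then show ?thesis using fork that by auto
  qed
qed

section \<open>Descents and reduced paths\<close>

definition desc :: "'v list \<Rightarrow> 'v \<Rightarrow> bool" where
  "desc p u \<longleftrightarrow> (\<exists>q. swap_eq p (hd p # u # q))"

text \<open>\<open>desc\<close> is the analogue of the right descent set in a Coxeter group, and
  \<open>reduced\<close> that of a reduced word: stepping on to a descent would be a backtrack up to
  swaps.\<close>

fun reduced :: "'v list \<Rightarrow> bool" where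
  "reduced [] \<longleftrightarrow> False"
| "reduced [v] \<longleftrightarrow> True"
| "reduced (u # v # p) \<longleftrightarrow> reduced (v # p) \<and> \<not> desc (v # p) u"

lemma desc_cong: "swap_eq p q \<Longrightarrow> desc p u \<longleftrightarrow> desc q u"
  unfolding desc_def using swap_eq_basic swap_eq_trans swap_eq_sym by metis

text \<open>Only a swap at the end of the path needs an argument. There the two ways from
  \<open>z\<close> to \<open>v\<close> exchange their roles, and a forbidden descent on one of them
  would produce a forbidden descent on the other.\<close>

lemma reduced_cong: "swap_eq p q \<Longrightarrow> reduced p \<Longrightarrow> reduced q"
proof (induction "length p" arbitrary: p q rule: less_induct)
  case less
  note IH = less.hyps
  from less.prems(1) show ?case
  proof (cases rule: swap_eq.cases)
    case (start v)
    then show ?thesis by simp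
  next
    case (same p' q' v)
    obtain a p1 where p1: "p' = a # p1" using swap_eq_basic[OF same(3)] by (cases p') auto
    obtain q1 where q1: "q' = a # q1" using swap_eq_basic[OF same(3)] p1 by (cases q') auto
    have rp: "reduced p'" "\<not> desc p' v" using less.prems(2) same(1) p1 by simp_all
    have "reduced q'" using IH[OF _ same(3) rp(1)] same(1) by simp
    moreover have "\<not> desc q' v" using desc_cong[OF same(3)] rp(2) by simp
    ultimately show ?thesis using same(2) q1 by simp
  next
    case (swap z a v b p' r q')
    obtain p1 where p1: "p' = a # p1" using swap_eq_basic[OF swap(4)] by (cases p') auto
    obtain q1 where q1: "q' = b # q1" using swap_eq_basic[OF swap(5)] by (cases q') auto
    have rp': "reduced p'" "\<not> desc p' v" using less.prems(2) swap(1) p1 by simp_all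
    have rp: "reduced (a # z # r)" using IH[OF _ swap(4) rp'(1)] swap(1) by simp
    have nd: "\<not> desc (a # z # r) v" using desc_cong[OF swap(4)] rp'(2) by simp
    have zr: "reduced (z # r)" "\<not> desc (z # r) a" using rp by auto
    \<comment> \<open>If \<open>b\<close> were a descent at \<open>z\<close>, swapping across the
      square \<open>b z a v\<close> would make \<open>v\<close> a descent at
      \<open>a\<close>.\<close>
    have nb: "\<not> desc (z # r) b"
    proof
      assume "desc (z # r) b"
      then obtain t where t: "swap_eq (z # r) (z # b # t)" by (auto simp: desc_def)
      have "swap_eq (a # z # r) (a # z # b # t)" using t by (rule same)
      moreover have "sq b z a v" using sq_sym[OF swap(3)] by simp
      then have "swap_eq (a # z # b # t) (a # v # b # t)"
        by (rule swap_eq.swap) (auto intro: swap_eq_refl)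
      ultimately have "desc (a # z # r) v" unfolding desc_def using swap_eq_trans by fastforce
      then show False using nd by simp
    qed
    then have rb: "reduced (b # z # r)" using zr by simp
    \<comment> \<open>A descent \<open>v\<close> at \<open>b\<close> forks over a square with the
      corners \<open>z\<close>, \<open>b\<close>, \<open>v\<close>. Its fourth corner has to be
      \<open>a\<close>, which would then be a descent at \<open>z\<close>.\<close>
    have nv: "\<not> desc (b # z # r) v"
    proof
      assume "desc (b # z # r) v"
      then obtain t where t: "swap_eq (b # z # r) (b # v # t)" by (auto simp: desc_def)
      have "z \<noteq> v" using sq_adjs[OF swap(3)] by simp
      then obtain y s where s: "sq y z b v" "swap_eq (z # r) (z # y # s)" using swap_eq_fork[OF t] by blast
      have "sq z b v a" "sq z b v y" using sq_sym[OF s(1)] sq_sym[OF swap(3)] by simp_all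
      then have "y = a" using sq_unique by blast
      then show False using s(2) zr(2) by (auto simp: desc_def)
    qed
    have "length (b # z # r) < length p" using swap_eq_basic[OF swap(4)] swap(1) by simp
    then have "reduced q'" using IH[OF _ swap_eq_sym[OF swap(5)] rb] by simp
    moreover have "\<not> desc q' v" using nv desc_cong[OF swap(5)] by simp
    ultimately show ?thesis using swap(2) q1 by simp
  qed
qed

lemma walk_cong: "swap_eq p q \<Longrightarrow> successively adj p \<longleftrightarrow> successively adj q"
proof (induction rule: swap_eq.induct)
  case (same p q v)
  then show ?case using swap_eq_basic[OF same(1)] by (auto simp: successively_Cons)
next
  case (swap z a v b p r q)
  have p: "hd p = a" "p \<noteq> []" "hd q = b" "q \<noteq> []"
    using swap_eq_basic[OF swap(2)] swap_eq_basic[OF swap(3)] by auto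
  have "adj a z" "adj b z" "adj v a" "adj v b"
    using sq_adjs[OF swap(1)] by simp_all
  then show ?case using p swap by (auto simp: successively_Cons)
qed auto

section \<open>The local system of reduced path classes\<close>

definition cls :: "'v list \<Rightarrow> 'v list set" where "cls p = {q. swap_eq p q}"

definition states :: "'v \<Rightarrow> 'v \<Rightarrow> 'v list set set" where
  "states o' v = {cls p |p. reduced p \<and> successively adj p \<and> last p = o' \<and> hd p = v}"

text \<open>Backtracking where possible and extending otherwise is a rule which the reversed edge
  undoes. The \<open>SOME\<close> choices are harmless: the last step of a path can be cancelled or
  added on both sides of \<open>swap_eq\<close>, so the resulting class does not depend on the
  representative.\<close>

definition transport :: "'v \<Rightarrow> 'v \<Rightarrow> 'v list set \<Rightarrow> 'v list set" where
  "transport v u c =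
     (if \<exists>q. v # u # q \<in> c then cls (SOME p. v # p \<in> c \<and> hd p = u \<and> p \<noteq> []) else cls (u # (SOME p. p \<in> c)))"

lemma reduced_ne: "reduced p \<Longrightarrow> p \<noteq> []" by auto

lemma cls_cong: "swap_eq p q \<Longrightarrow> cls p = cls q"
  unfolding cls_def using swap_eq_trans swap_eq_sym by blast

lemma cls_eqD: "cls p = cls q \<Longrightarrow> p \<noteq> [] \<Longrightarrow> swap_eq q p"
  unfolding cls_def using swap_eq_refl by blast

lemma transport_back:
  "transport v u (cls (v # u # q)) = cls (u # q)"
proof -
  let ?P = "\<lambda>p. v # p \<in> cls (v # u # q) \<and> hd p = u \<and> p \<noteq> []"
  have "?P (u # q)" by (auto simp: cls_def intro: swap_eq_refl)
  then have P: "?P (SOME p. ?P p)" by (rule someI)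
  define S where "S = (SOME p. ?P p)"
  obtain p where S: "S = u # p" using P unfolding S_def[symmetric] by (cases S) auto
  then have p: "(SOME p. ?P p) = u # p" "swap_eq (v # u # q) (v # u # p)"
    using P unfolding S_def[symmetric] by (auto simp: cls_def)
  have "cls (u # p) = cls (u # q)" using swap_eq_cancel[OF p(2)] cls_cong by blast
  moreover have "\<exists>q'. v # u # q' \<in> cls (v # u # q)" by (auto simp: cls_def intro: swap_eq_refl)
  ultimately show ?thesis unfolding transport_def p(1) by simp
qed

lemma transport_forth:
  assumes "\<not> desc (v # p) u"
  shows "transport v u (cls (v # p)) = cls (u # v # p)"
proof -
  define S where "S = (SOME q. q \<in> cls (v # p))"
  have "v # p \<in> cls (v # p)" by (simp add: cls_def swap_eq_refl)
  then have "S \<in> cls (v # p)" unfolding S_def by (rule someI)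
  then have "swap_eq (u # v # p) (u # S)" by (intro same) (simp add: cls_def)
  from cls_cong[OF this] have "cls (u # (SOME q. q \<in> cls (v # p))) = cls (u # v # p)"
    unfolding S_def by simp
  moreover have "\<not> (\<exists>q. v # u # q \<in> cls (v # p))" using assms by (auto simp: cls_def desc_def)
  ultimately show ?thesis unfolding transport_def by simp
qed

lemma statesE:
  assumes "c \<in> states o' v"
  obtains p where "c = cls (v # p)" "reduced (v # p)" "successively adj (v # p)" "last (v # p) = o'"
proof -
  obtain p where p: "c = cls p" "reduced p" "successively adj p" "last p = o'" "hd p = v"
    using assms unfolding states_def by blast
  have "p = v # tl p" using p(5) reduced_ne[OF p(2)] by (cases p) simp_all
  then show ?thesis using that[of "tl p"] p by metis
qed

lemma statesI:
  "reduced (v # p) \<Longrightarrow> successively adj (v # p) \<Longrightarrow> last (v # p) = o' \<Longrightarrow> cls (v # p) \<in> states o' v"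
  unfolding states_def mem_Collect_eq by (intro exI[of _ "v # p"]) simp

lemma states_cases:
  assumes "c \<in> states o' v"
  obtains (down) q where "c = cls (v # u # q)" "reduced (v # u # q)" "successively adj (v # u # q)" "last (u # q) = o'"
  | (up) p where "c = cls (v # p)" "reduced (v # p)" "successively adj (v # p)" "last (v # p) = o'" "\<not> desc (v # p) u"
proof -
  obtain p where p: "c = cls (v # p)" "reduced (v # p)" "successively adj (v # p)" "last (v # p) = o'"
    using assms by (rule statesE)
  show ?thesis
  proof (cases "desc (v # p) u")
    case True
    then obtain q where q: "swap_eq (v # p) (v # u # q)" by (auto simp: desc_def)
    show ?thesis
    proof (rule down)
      show "c = cls (v # u # q)" using p(1) cls_cong[OF q] by simp
      show "reduced (v # u # q)" using reduced_cong[OF q p(2)] .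
      show "successively adj (v # u # q)" using walk_cong[OF q] p(3) by blast
      show "last (u # q) = o'" using p(4) swap_eq_basic[OF q] by simp
    qed
  next
    case False
    with p show ?thesis by (rule up)
  qed
qed

lemma transport_in_states:
  assumes "c \<in> states o' v" "adj v u"
  shows "transport v u c \<in> states o' u"
  using assms(1)
proof (cases rule: states_cases[where u = u])
  case (down q)
  then show ?thesis using transport_back[of v u q] by (auto intro!: statesI simp: successively_Cons)
next
  case (up p)
  then show ?thesis using transport_forth[of v p u] assms adj_sym by (auto intro!: statesI simp: successively_Cons)
qed

lemma transport_inverse:
  assumes "c \<in> states o' v" "adj v u"
  shows "transport u v (transport v u c) = c"
  using assms(1)
proof (cases rule: states_cases[where u = u])
  case (down q)
  then show ?thesis using transport_back[of v u q] transport_forth[of u q v] by simp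
next
  case (up p)
  then show ?thesis using transport_forth[of v p u] transport_back[of u v p] by simp
qed

text \<open>The cases are the possible positions of the square relative to the base point. If
  \<open>u\<close> and \<open>w\<close> are both descents, uniqueness of squares puts
  \<open>s\<close> below both. If only \<open>u\<close> is one, then \<open>u\<close> is the lowest
  corner and \<open>w\<close> the highest. If neither is, then \<open>v\<close> is the lowest
  corner, and the two extensions to \<open>s\<close> differ by one swap.\<close>

lemma transport_square:
  assumes "c \<in> states o' v" "sq v u s w"
  shows "transport u s (transport v u c) = transport w s (transport v w c)"
proof -
  have *: "transport u s (transport v u c) = transport w s (transport v w c)"
    if sq: "sq v u s w" and c: "c = cls (v # u # q)" "reduced (v # u # q)" for u w q
  proof (cases "desc (v # u # q) w")
    case True
    then obtain q' where q': "swap_eq (v # u # q) (v # w # q')" by (auto simp: desc_def)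
    have "u \<noteq> w" using sq_adjs[OF sq] by simp
    then obtain z r where r: "sq z u v w" "swap_eq (u # q) (u # z # r)" "swap_eq (w # q') (w # z # r)"
      using swap_eq_fork[OF q'] by blast
    have "sq u v w z" "sq u v w s" using sq_sym[OF r(1)] sq_sym[OF sq] by simp_all
    then have z: "z = s" using sq_unique by blast
    have "transport u s (transport v u c) = cls (s # r)"
      unfolding c(1) transport_back using cls_cong[OF r(2)] transport_back[of u s r] z by simp
    moreover have "transport w s (transport v w c) = cls (s # r)"
      unfolding c(1) cls_cong[OF q'] transport_back using cls_cong[OF r(3)] transport_back[of w s r] z by simp
    ultimately show ?thesis by simp
  next
    case False
    have "\<not> desc (u # q) s"
    proof
      assume "desc (u # q) s"
      then obtain t where t: "swap_eq (u # q) (u # s # t)" by (auto simp: desc_def)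
      have "sq s u v w" using sq_sym[OF sq] by simp
      then have "swap_eq (v # u # q) (v # w # s # t)" using t by (rule swap) (auto intro: swap_eq_refl)
      then show False using False by (auto simp: desc_def)
    qed
    then have 1: "transport u s (transport v u c) = cls (s # u # q)"
      unfolding c(1) transport_back by (rule transport_forth)
    have "swap_eq (w # v # u # q) (w # s # u # q)"
      using sq_sym(7)[OF sq] by (rule swap) (auto intro: swap_eq_refl)
    then have "transport w s (transport v w c) = cls (s # u # q)"
      unfolding c(1) transport_forth[OF False] using cls_cong transport_back by metis
    then show ?thesis using 1 by simp
  qed
  have flip: "sq v w s u" using assms(2) by (rule sq_flip)
  show ?thesis using assms(1)
  proof (cases rule: states_cases[where u = u])
    case (down q)
    then show ?thesis using *[OF assms(2)] by blast
  next
    case (up p)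
    show ?thesis using assms(1)
    proof (cases rule: states_cases[where u = w])
      case (down q)
      then show ?thesis using *[OF flip] by metis
    next
      case f: (up p')
      have "swap_eq (v # p) (v # p')" using f(1) up(1) cls_eqD by (metis list.distinct(1))
      then have nw: "\<not> desc (v # p) w" using f desc_cong by blast
      have 1: "\<not> desc (x # v # p) s" if sq: "sq v x s y" and ny: "\<not> desc (v # p) y" for x y
      proof
        assume "desc (x # v # p) s"
        then obtain t where t: "swap_eq (x # v # p) (x # s # t)" by (auto simp: desc_def)
        have "v \<noteq> s" using sq_adjs[OF sq] by simp
        then obtain z r where r: "sq z v x s" "swap_eq (v # p) (v # z # r)" using swap_eq_fork[OF t] by blast
        have "sq v x s z" using sq_sym[OF r(1)] by simp
        then have "z = y" using sq sq_unique by blast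
        then show False using r(2) ny by (auto simp: desc_def)
      qed
      have "transport u s (transport v u c) = cls (s # u # v # p)"
        using transport_forth[OF up(5)] transport_forth[OF 1[OF assms(2) nw]] up(1) by simp
      moreover have "transport w s (transport v w c) = cls (s # w # v # p)"
        using transport_forth[OF nw] transport_forth[OF 1[OF flip up(5)]] up(1) by simp
      moreover have "sq v u s w" by fact
      then have "swap_eq (s # u # v # p) (s # w # v # p)" by (rule swap) (auto intro: swap_eq_refl)
      ultimately show ?thesis using cls_cong by simp
    qed
  qed
qed

lemma state_origin: "cls [v] \<in> states v v"
  by (rule statesI) auto

end

section \<open>Distance and sides in a flag square graph\<close>

text \<open>Simple connectivity appears in this locale as \<open>section_ex\<close>, the existence
  of a section of the local system through the class of the constant path. The arguments below it
  are pure graph theory.\<close>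

locale flag_square_graph = square_graph adj sq
  for adj :: "'v \<Rightarrow> 'v \<Rightarrow> bool" and sq :: "'v \<Rightarrow> 'v \<Rightarrow> 'v \<Rightarrow> 'v \<Rightarrow> bool" +
  fixes V :: "'v set"
  assumes adj_V: "adj a b \<Longrightarrow> a \<in> V"
    and section_ex: "r \<in> V \<Longrightarrow> \<exists>s. s r = cls [r] \<and> (\<forall>v\<in>V. s v \<in> states r v) \<and>
           (\<forall>u v. adj u v \<longrightarrow> transport u v (s u) = s v)"
begin

definition gdist :: "'v \<Rightarrow> 'v \<Rightarrow> nat" where
  "gdist u v = (LEAST n. (adj ^^ n) u v)"

text \<open>The last clause is the quadrangle condition. The others characterize the distance to
  \<open>r\<close>, as \<open>gdist_height\<close> shows.\<close>

definition height_function :: "'v \<Rightarrow> ('v \<Rightarrow> nat) \<Rightarrow> bool" where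
  "height_function r n \<longleftrightarrow> n r = 0 \<and>
     (\<forall>u v. adj u v \<longrightarrow> n u = Suc (n v) \<or> n v = Suc (n u)) \<and>
     (\<forall>v\<in>V. v \<noteq> r \<longrightarrow> (\<exists>u. adj v u \<and> n v = Suc (n u))) \<and>
     (\<forall>u v w. adj v u \<longrightarrow> adj v w \<longrightarrow> u \<noteq> w \<longrightarrow> n v = Suc (n u) \<longrightarrow> n v = Suc (n w)
       \<longrightarrow> (\<exists>z. sq z u v w \<and> n u = Suc (n z)))"

text \<open>The height of \<open>v\<close> is the number of steps in the class \<open>s v\<close>.
  Transport along an edge removes or adds one step, so heights of neighbours differ by one; and two
  descents from one class fork over a square, which is the quadrangle condition.\<close>

lemma height_function_ex:
  assumes r: "r \<in> V"
  shows "\<exists>n. height_function r n"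
proof -
  obtain s where s: "s r = cls [r]" "\<And>v. v \<in> V \<Longrightarrow> s v \<in> states r v"
      "\<And>u v. adj u v \<Longrightarrow> transport u v (s u) = s v"
    using section_ex[OF r] by blast
  define n where "n v = length (SOME p. p \<in> s v) - 1" for v
  have n: "n v = length p - 1" if "s v = cls p" "p \<noteq> []" for v p
  proof -
    have "p \<in> s v" using that by (simp add: cls_def swap_eq_refl)
    then have "(SOME p. p \<in> s v) \<in> s v" by (rule someI)
    then have "swap_eq p (SOME p. p \<in> s v)" using that by (simp add: cls_def)
    then show ?thesis using swap_eq_basic unfolding n_def by metis
  qed
  have edge: "(\<exists>q. s v = cls (v # u # q) \<and> s u = cls (u # q) \<and> n v = Suc (n u)) \<or> n u = Suc (n v)"
    if a: "adj v u" for u v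
  proof -
    have "s v \<in> states r v" using s(2) adj_V[OF a] .
    then show ?thesis
    proof (cases rule: states_cases[where u = u])
      case (down q)
      then have u: "s u = cls (u # q)" using s(3)[OF a] transport_back[of v u q] by simp
      have "n v = Suc (n u)" using n[OF u] n[OF down(1)] by simp
      then show ?thesis using u down(1) by blast
    next
      case (up p)
      then have u: "s u = cls (u # v # p)" using s(3)[OF a] transport_forth[of v p u] by simp
      have "n u = Suc (n v)" using n[OF u] n[OF up(1)] by simp
      then show ?thesis by blast
    qed
  qed
  have "height_function r n"
    unfolding height_function_def
  proof (intro conjI allI ballI impI)
    show "n r = 0" using n[OF s(1)] by simp
    show "n u = Suc (n v) \<or> n v = Suc (n u)" if "adj u v" for u v using edge[OF that] by blast
    show "\<exists>u. adj v u \<and> n v = Suc (n u)" if v: "v \<in> V" "v \<noteq> r" for v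
    proof -
      obtain p where p: "s v = cls (v # p)" "reduced (v # p)" "successively adj (v # p)" "last (v # p) = r"
        using s(2)[OF v(1)] by (rule statesE)
      obtain u q where u: "p = u # q" using p(4) v(2) by (cases p) auto
      have a: "adj v u" using p(3) u by simp
      have "s u = cls (u # q)" using s(3)[OF a] p(1) u transport_back[of v u q] by simp
      then have "n v = Suc (n u)" using n[of u "u # q"] n[OF p(1)] u by simp
      then show ?thesis using a by blast
    qed
    show "\<exists>z. sq z u v w \<and> n u = Suc (n z)"
      if a: "adj v u" "adj v w" and "u \<noteq> w" and h: "n v = Suc (n u)" "n v = Suc (n w)" for u v w
    proof -
      obtain q where q: "s v = cls (v # u # q)" "s u = cls (u # q)" using edge[OF a(1)] h by auto
      obtain q' where q': "s v = cls (v # w # q')" using edge[OF a(2)] h by auto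
      have "swap_eq (v # u # q) (v # w # q')" using cls_eqD[of "v # w # q'" "v # u # q"] q q' by simp
      then obtain z t where z: "sq z u v w" "swap_eq (u # q) (u # z # t)"
        using swap_eq_fork \<open>u \<noteq> w\<close> by blast
      have uz: "s u = cls (u # z # t)" using q(2) cls_cong[OF z(2)] by simp
      then have zt: "s z = cls (z # t)"
        using s(3)[of u z] sq_adjs[OF z(1)] transport_back[of u z t] by simp
      show ?thesis using n[OF uz] n[OF zt] z(1) by auto
    qed
  qed
  then show ?thesis by blast
qed

text \<open>Such a function grows by at most one per edge, hence is a lower bound for the length of
  any walk from \<open>r\<close>; following descending neighbours down to \<open>r\<close> yields a
  walk that attains it.\<close>

lemma gdist_height:
  assumes "r \<in> V" "n r = (0 :: nat)"
    "\<And>u v. adj u v \<Longrightarrow> n u = Suc (n v) \<or> n v = Suc (n u)"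
    "\<And>v. v \<in> V \<Longrightarrow> v \<noteq> r \<Longrightarrow> \<exists>u. adj v u \<and> n v = Suc (n u)"
    "v \<in> V"
  shows "gdist r v = n v" "(adj ^^ (n v)) r v"
proof -
  show walk: "(adj ^^ (n v)) r v" using \<open>v \<in> V\<close>
  proof (induction "n v" arbitrary: v)
    case 0
    then show ?case using assms(4)[of v] by (cases "v = r") auto
  next
    case (Suc k)
    then have "v \<noteq> r" using assms(2) by auto
    then obtain u where u: "adj v u" "n v = Suc (n u)" using assms(4) Suc by blast
    then have "u \<in> V" using adj_V adj_sym by blast
    then have "(adj ^^ n u) r u" using Suc(1)[of u] Suc(2) u by simp
    then have "(adj ^^ Suc (n u)) r v" using adj_sym[OF u(1)] by (rule relpowp_Suc_I)
    then show ?case using u by simp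
  qed
  have "n w \<le> k" if "(adj ^^ k) r w" for k w
    using that
  proof (induction k arbitrary: w)
    case (Suc k)
    then obtain y where y: "(adj ^^ k) r y" "adj y w" by auto
    then show ?case using Suc.IH[OF y(1)] assms(3)[OF y(2)] by auto
  qed (use assms(2) in auto)
  then show "gdist r v = n v" unfolding gdist_def using walk by (intro Least_equality) auto
qed

lemma
  assumes r: "r \<in> V"
  shows gdist_self [simp]: "gdist r r = 0"
    and gdist_edge: "adj u v \<Longrightarrow> gdist r u = Suc (gdist r v) \<or> gdist r v = Suc (gdist r u)"
    and gdist_step: "v \<in> V \<Longrightarrow> v \<noteq> r \<Longrightarrow> \<exists>u. adj v u \<and> gdist r v = Suc (gdist r u)"
    and gdist_quadrangle: "adj v u \<Longrightarrow> adj v w \<Longrightarrow> u \<noteq> w \<Longrightarrow> gdist r v = Suc (gdist r u) \<Longrightarrow>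
        gdist r v = Suc (gdist r w) \<Longrightarrow> \<exists>z. sq z u v w \<and> gdist r u = Suc (gdist r z)"
    and gdist_walk: "v \<in> V \<Longrightarrow> (adj ^^ gdist r v) r v"
proof -
  obtain n where "height_function r n" using height_function_ex[OF r] by blast
  note h = this[unfolded height_function_def]
  note n = h[THEN conjunct1] h[THEN conjunct2, THEN conjunct1, rule_format]
    h[THEN conjunct2, THEN conjunct2, THEN conjunct1, rule_format]
    h[THEN conjunct2, THEN conjunct2, THEN conjunct2, rule_format]
  have d: "gdist r v = n v" "(adj ^^ (gdist r v)) r v" if "v \<in> V" for v
    using gdist_height[OF r n(1) n(2) n(3) that] by simp_all
  have V: "a \<in> V" "b \<in> V" if "adj a b" for a b using that adj_V adj_sym by blast+
  show "gdist r r = 0" using d(1)[OF r] n(1) by simp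
  show "gdist r u = Suc (gdist r v) \<or> gdist r v = Suc (gdist r u)" if "adj u v"
    using n(2)[OF that] d(1)[OF V(1)[OF that]] d(1)[OF V(2)[OF that]] by simp
  show "\<exists>u. adj v u \<and> gdist r v = Suc (gdist r u)" if v: "v \<in> V" "v \<noteq> r"
  proof -
    obtain u where u: "adj v u" "n v = Suc (n u)" using n(3)[OF v] by blast
    then show ?thesis using d(1)[OF v(1)] d(1)[OF V(2)[OF u(1)]] by auto
  qed
  show "\<exists>z. sq z u v w \<and> gdist r u = Suc (gdist r z)"
    if a: "adj v u" "adj v w" "u \<noteq> w" "gdist r v = Suc (gdist r u)" "gdist r v = Suc (gdist r w)"
  proof -
    have "n v = Suc (n u)" "n v = Suc (n w)"
      using a(4,5) d(1)[OF V(1)[OF a(1)]] d(1)[OF V(2)[OF a(1)]] d(1)[OF V(2)[OF a(2)]] by simp_all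
    then obtain z where z: "sq z u v w" "n u = Suc (n z)" using n(4)[OF a(1-3)] by blast
    have "z \<in> V" using sq_adj[OF z(1)] V by blast
    then show ?thesis using z d(1)[OF V(2)[OF a(1)]] d(1)[of z] by auto
  qed
  show "(adj ^^ gdist r v) r v" if "v \<in> V" using d(2)[OF that] .
qed

lemma gdist_sym: "gdist u v = gdist v u"
proof -
  have "(adj ^^ n) v u" if "(adj ^^ n) u v" for n u v
    using that
  proof (induction n arbitrary: v)
    case (Suc n)
    then obtain y where y: "(adj ^^ n) u y" "adj y v" by auto
    show ?case by (rule relpowp_Suc_I2[OF adj_sym[OF y(2)] Suc.IH[OF y(1)]])
  qed auto
  then have "(adj ^^ n) u v = (adj ^^ n) v u" for n by blast
  then show ?thesis by (simp add: gdist_def)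
qed

lemma gdist_adj:
  assumes "adj u v" shows "gdist u v = 1"
proof -
  have "u \<in> V" using adj_V assms by blast
  then show ?thesis using gdist_edge[OF _ assms, of u] by simp
qed

lemma gdist_edge2:
  assumes "adj u v" "r \<in> V" shows "gdist u r = Suc (gdist v r) \<or> gdist v r = Suc (gdist u r)"
  using gdist_edge[OF assms(2,1)] gdist_sym by metis

lemma gdist_eq_0:
  assumes "r \<in> V" "v \<in> V" "gdist r v = 0" shows "v = r"
  using gdist_step[OF assms(1,2)] assms(3) by auto

text \<open>Edges are ordered pairs here, so that parallelism remembers which endpoints correspond
  to each other; otherwise a parallel edge could not be said to have the same side.\<close>

abbreviation opp :: "'v \<times> 'v \<Rightarrow> 'v \<times> 'v \<Rightarrow> bool" where
  "opp e e' \<equiv> sq (fst e) (snd e) (snd e') (fst e')"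

definition side :: "'v \<Rightarrow> 'v \<Rightarrow> 'v set" where
  "side a b = {v \<in> V. gdist v a < gdist v b}"

text \<open>The distances from any vertex to \<open>a\<close> and to \<open>b\<close> differ by
  exactly one, so there are no ties.\<close>

lemma compl_side: "adj a b \<Longrightarrow> V - side a b = side b a"
  unfolding side_def using gdist_edge[of _ a b] by force

lemma side_ends: "adj a b \<Longrightarrow> a \<in> side a b \<and> b \<notin> side a b"
  using adj_V[of a b] adj_V[of b a] adj_sym[of a b] gdist_adj[of a b] unfolding side_def by auto

text \<open>If \<open>r\<close> were nearer to \<open>a\<close> than to \<open>b\<close> but not
  nearer to \<open>a'\<close> than to \<open>b'\<close>, then both \<open>a\<close> and
  \<open>b'\<close> would lie one step closer to \<open>r\<close> than \<open>b\<close>. The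
  quadrangle condition completes \<open>a b b'\<close> to a square whose fourth corner is closer
  still. By uniqueness this corner is \<open>a'\<close>, which is however farther from
  \<open>r\<close> than \<open>a\<close>.\<close>

lemma side_opp:
  assumes "sq a b b' a'"
  shows "side a b = side a' b'"
proof -
  have *: "gdist r a' < gdist r b'" if sq: "sq a b b' a'" and r: "r \<in> V" "gdist r a < gdist r b" for a b a' b' r
  proof (rule ccontr)
    assume not: "\<not> gdist r a' < gdist r b'"
    have adj: "adj a b" "adj b b'" "adj a a'" "adj a' b'" "a \<noteq> b'" using sq_adjs[OF sq] by simp_all
    note E = gdist_edge[OF r(1)]
    have d: "gdist r b = Suc (gdist r a)" "gdist r b' = gdist r a" "gdist r a' = Suc (gdist r a)"
      using E[OF adj(1)] E[OF adj(2)] E[OF adj(3)] E[OF adj(4)] r(2) not by linarith+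
    obtain z where z: "sq z a b b'" "gdist r a = Suc (gdist r z)"
      using gdist_quadrangle[OF r(1) adj_sym[OF adj(1)] adj(2) adj(5)] d by auto
    have "z = a'" using sq_unique[OF sq_sym(1)[OF z(1)] sq] .
    then show False using z(2) d by simp
  qed
  have "sq a' b' b a" using sq_sym[OF assms] by simp
  then show ?thesis unfolding side_def using *[OF assms] *[of a' b' b a] by blast
qed

lemma side_parallel: "opp\<^sup>*\<^sup>* e e' \<Longrightarrow> side (fst e) (snd e) = side (fst e') (snd e')"
  by (induction rule: rtranclp_induct) (use side_opp in auto)

text \<open>Move \<open>a\<close> one step towards \<open>x\<close>, to \<open>a1\<close>. Seen from
  \<open>y\<close>, both \<open>a1\<close> and \<open>b\<close> lie below \<open>a\<close>, so the
  quadrangle condition gives a square across which the edge from \<open>a\<close> to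
  \<open>b\<close> is pushed to one at \<open>a1\<close>. The side stays the same and the distance
  to \<open>x\<close> drops.\<close>

lemma crossing_parallel:
  assumes "adj a b" "adj x y" "x \<in> side a b" "y \<notin> side a b"
  shows "opp\<^sup>*\<^sup>* (a, b) (x, y)"
  using assms
proof (induction "gdist x a" arbitrary: a b)
  case 0
  have V: "x \<in> V" "y \<in> V" "a \<in> V" "b \<in> V" using 0 adj_V adj_sym by blast+
  have xa: "a = x" using gdist_eq_0[OF V(1,3)] 0 by simp
  then have "gdist y a = 1" using gdist_adj[OF 0(3)] gdist_sym by metis
  then have "gdist y b = 0" using 0(5) V gdist_edge[OF V(2) 0(2)] unfolding side_def by auto
  then have "b = y" using gdist_eq_0[OF V(2,4)] by simp
  then show ?case using xa by simp
next
  case (Suc k)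
  have V: "x \<in> V" "y \<in> V" "a \<in> V" "b \<in> V" using Suc.prems adj_V adj_sym by blast+
  have 1: "gdist x a < gdist x b" "\<not> gdist y a < gdist y b" using Suc.prems V unfolding side_def by auto
  have d: "gdist x b = Suc (Suc k)" "gdist y b = Suc k" "gdist y a = Suc (Suc k)"
    using gdist_edge[OF V(1) Suc.prems(1)] gdist_edge[OF V(2) Suc.prems(1)]
      gdist_edge2[OF Suc.prems(2) V(3)] gdist_edge2[OF Suc.prems(2) V(4)] 1 Suc(2) by linarith+
  have "a \<noteq> x" using Suc(2) gdist_self[OF V(1)] by auto
  then obtain a1 where a1: "adj a a1" "gdist x a1 = k" using gdist_step[OF V(1,3)] Suc(2) by auto
  have a1V: "a1 \<in> V" using a1 adj_V adj_sym by blast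
  have "gdist y a1 = Suc k"
    using gdist_edge2[OF Suc.prems(2) a1V] gdist_edge[OF V(2) a1(1)] a1(2) d by linarith
  moreover have "a1 \<noteq> b" using a1(2) d by auto
  ultimately obtain z where z: "sq z a1 a b" "gdist y a1 = Suc (gdist y z)"
    using gdist_quadrangle[OF V(2) a1(1) Suc.prems(1)] d by auto
  have sq: "sq a b z a1" using sq_sym[OF z(1)] by simp
  have e: "adj a1 z" using sq_adjs[OF z(1)] by simp
  have eq: "side a1 z = side a b" using side_opp[OF sq] by simp
  have "opp\<^sup>*\<^sup>* (a1, z) (x, y)"
    using Suc.hyps(1)[OF _ e Suc.prems(2)] a1(2) eq Suc.prems(3,4) by simp
  moreover have "opp (a, b) (a1, z)" using sq by simp
  ultimately show ?case by (rule converse_rtranclp_into_rtranclp[rotated])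
qed

lemma side_eq_of_crossing:
  assumes "adj a b" "adj x y" "x \<in> side a b" "y \<notin> side a b"
  shows "side a b = side x y"
  using side_parallel[OF crossing_parallel[OF assms]] by simp

text \<open>Two crossing edges at \<open>p\<close> would define the same side; but \<open>q\<close>
  is at distance one from \<open>p\<close> and two from \<open>r\<close>, so it is on the side of
  \<open>p\<close> for one of these edges and off it for the other.\<close>

lemma no_corner:
  assumes "sq p q s r" "adj a b" "p \<in> side a b" "q \<notin> side a b" "r \<notin> side a b"
  shows False
proof -
  have adj: "adj p q" "adj p r" "q \<noteq> r" using sq_adjs[OF assms(1)] by simp_all
  have eq: "side p q = side p r"
    using side_eq_of_crossing[OF assms(2) adj(1) assms(3,4)] side_eq_of_crossing[OF assms(2) adj(2) assms(3,5)] by simp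
  have V: "q \<in> V" "r \<in> V" "p \<in> V" using adj adj_V adj_sym by blast+
  have 1: "gdist q p = 1" using gdist_adj[OF adj_sym[OF adj(1)]] .
  moreover have "gdist q r \<noteq> 0" using gdist_eq_0[OF V(1,2)] adj(3) by auto
  ultimately have "gdist q r = 2" using gdist_edge[OF V(1) adj(2)] by auto
  then have "q \<in> side p r" using 1 V unfolding side_def by simp
  then show False using eq side_ends[OF adj(1)] by simp
qed

text \<open>A geodesic to \<open>a\<close> stays on the side: a step towards \<open>a\<close> lowers
  the distance to \<open>a\<close> by one and the distance to \<open>b\<close> by at most
  one.\<close>

lemma side_connected:
  assumes "adj a b" "v \<in> side a b"
  shows "(\<lambda>x y. adj x y \<and> x \<in> side a b \<and> y \<in> side a b)\<^sup>*\<^sup>* v a"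
  using assms(2)
proof (induction "gdist a v" arbitrary: v)
  case 0
  have "a \<in> V" "v \<in> V" using assms(1) adj_V 0 unfolding side_def by auto
  then show ?case using gdist_eq_0[of a v] 0 by auto
next
  case (Suc k)
  have V: "a \<in> V" "v \<in> V" "b \<in> V" using assms(1) adj_V adj_sym Suc.prems unfolding side_def by blast+
  have "v \<noteq> a" using Suc(2) gdist_self[OF V(1)] by auto
  then obtain u where u: "adj v u" "gdist a u = k" using gdist_step[OF V(1,2)] Suc(2) by auto
  have "u \<in> V" using u adj_V adj_sym by blast
  moreover have "gdist u a < gdist u b"
    using gdist_edge2[OF u(1) V(3)] gdist_edge[OF V(2) assms(1)] Suc.prems Suc(2) u(2) gdist_sym[of a]
    unfolding side_def by auto
  ultimately have us: "u \<in> side a b" unfolding side_def by simp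
  then show ?case using Suc(1)[OF _ us] u Suc.prems
    by (intro converse_rtranclp_into_rtranclp[of _ v u]) auto
qed

end

section \<open>Charts of cubes and local systems\<close>

lemma cubical_Int:
  assumes "cubical_complex K" "Q \<in> K" "Q' \<in> K" "x \<in> Q" "x \<in> Q'"
  shows "Q \<inter> Q' \<in> K"
proof -
  have "Q \<inter> Q' = {} \<or> Q \<inter> Q' \<in> K" using assms(1-3) unfolding cubical_complex_def by simp
  then show ?thesis using assms(4,5) by auto
qed

lemma cubical_chart:
  assumes "cubical_complex K" "Q \<in> K"
  obtains n \<beta> where "cube_chart K Q n \<beta>"
proof -
  have "\<exists>n \<beta>. cube_chart K Q n \<beta>" using assms unfolding cubical_complex_def by simp
  then show ?thesis using that by (elim exE)
qed

lemma cube_chart_bij: "cube_chart K Q n \<beta> \<Longrightarrow> bij_betw \<beta> (Pow {..<n}) Q"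
  by (simp add: cube_chart_def)

lemma cube_chart_in: "cube_chart K Q n \<beta> \<Longrightarrow> T \<subseteq> {..<n} \<Longrightarrow> \<beta> T \<in> Q"
  using bij_betwE[OF cube_chart_bij] by blast

lemma cube_chart_inj:
  assumes "cube_chart K Q n \<beta>" "S \<subseteq> {..<n}" "T \<subseteq> {..<n}"
  shows "\<beta> S = \<beta> T \<longleftrightarrow> S = T"
  using inj_on_eq_iff[OF bij_betw_imp_inj_on[OF cube_chart_bij[OF assms(1)]]] assms(2,3) by simp

lemma cube_chart_surj:
  assumes "cube_chart K Q n \<beta>" "u \<in> Q"
  obtains T where "T \<subseteq> {..<n}" "u = \<beta> T"
  using bij_betw_imp_surj_on[OF cube_chart_bij[OF assms(1)]] assms(2) by blast

lemma cube_chart_card: "cube_chart K Q n \<beta> \<Longrightarrow> card Q = 2 ^ n"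
  using bij_betw_same_card[OF cube_chart_bij] by (metis card_Pow card_lessThan finite_lessThan)

lemma cube_chart_finite: "cube_chart K Q n \<beta> \<Longrightarrow> finite Q"
  using bij_betw_finite[OF cube_chart_bij] by simp

lemma cube_chart_face:
  assumes "cube_chart K Q n \<beta>" "A \<subseteq> B" "B \<subseteq> {..<n}"
  shows "\<beta> ` {T. A \<subseteq> T \<and> T \<subseteq> B} \<in> K"
proof -
  have "\<beta> ` {T. A \<subseteq> T \<and> T \<subseteq> B} \<in> {\<beta> ` {T. A \<subseteq> T \<and> T \<subseteq> B} |A B. A \<subseteq> B \<and> B \<subseteq> {..<n}}"
    by (rule CollectI, rule exI[of _ A], rule exI[of _ B]) (simp add: assms(2,3))
  then have "\<beta> ` {T. A \<subseteq> T \<and> T \<subseteq> B} \<in> {Q' \<in> K. Q' \<subseteq> Q}"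
    using assms(1) unfolding cube_chart_def by simp
  then show ?thesis by simp
qed

lemma cube_chart_subcube:
  assumes "cube_chart K Q n \<beta>" "Q' \<in> K" "Q' \<subseteq> Q"
  obtains A B where "A \<subseteq> B" "B \<subseteq> {..<n}" "Q' = \<beta> ` {T. A \<subseteq> T \<and> T \<subseteq> B}"
proof -
  have "Q' \<in> {Q' \<in> K. Q' \<subseteq> Q}" using assms(2,3) by simp
  then have "Q' \<in> {\<beta> ` {T. A \<subseteq> T \<and> T \<subseteq> B} |A B. A \<subseteq> B \<and> B \<subseteq> {..<n}}"
    using assms(1) unfolding cube_chart_def by simp
  then show ?thesis using that by (elim CollectE exE conjE)
qed

text \<open>Flipping the coordinates in \<open>D\<close> sends the endpoints of an interval to two
  opposite corners of the image face, whose least and greatest elements are the intersection and the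
  union of these corners.\<close>

lemma sym_diff_interval:
  assumes "A \<subseteq> B"
  shows "(\<lambda>T. sym_diff T D) ` {T. A \<subseteq> T \<and> T \<subseteq> B} = {T. sym_diff A D \<inter> sym_diff B D \<subseteq> T \<and> T \<subseteq> sym_diff A D \<union> sym_diff B D}"
proof (intro Set.set_eqI iffI)
  fix T assume "T \<in> {T. sym_diff A D \<inter> sym_diff B D \<subseteq> T \<and> T \<subseteq> sym_diff A D \<union> sym_diff B D}"
  then have "sym_diff T D \<in> {T. A \<subseteq> T \<and> T \<subseteq> B}" using assms by blast
  moreover have "T = sym_diff (sym_diff T D) D" by blast
  ultimately show "T \<in> (\<lambda>T. sym_diff T D) ` {T. A \<subseteq> T \<and> T \<subseteq> B}" by (rule rev_image_eqI)
qed (use assms in auto)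

text \<open>Symmetric difference with \<open>D\<close> is the automorphism of the standard cube that
  exchanges \<open>{}\<close> and \<open>D\<close>. It allows any vertex of a cube to be the origin
  of a chart.\<close>

lemma cube_chart_rebase:
  assumes c: "cube_chart K Q n \<beta>" and D: "D \<subseteq> {..<n}"
  shows "cube_chart K Q n (\<lambda>T. \<beta> (sym_diff T D))"
proof -
  let ?s = "\<lambda>T. sym_diff T D"
  have ss: "?s (?s T) = T" for T by blast
  have "bij_betw ?s (Pow {..<n}) (Pow {..<n})"
    by (rule bij_betw_byWitness[where f' = ?s]) (use ss D in auto)
  then have "bij_betw (\<beta> \<circ> ?s) (Pow {..<n}) Q" using cube_chart_bij[OF c] bij_betw_trans by blast
  moreover have "{(\<lambda>T. \<beta> (?s T)) ` {T. A \<subseteq> T \<and> T \<subseteq> B} |A B. A \<subseteq> B \<and> B \<subseteq> {..<n}}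
      = {\<beta> ` {T. A \<subseteq> T \<and> T \<subseteq> B} |A B. A \<subseteq> B \<and> B \<subseteq> {..<n}}" (is "?L = ?R")
  proof -
    have img: "(\<lambda>T. \<beta> (?s T)) ` {T. A \<subseteq> T \<and> T \<subseteq> B} = \<beta> ` {T. ?s A \<inter> ?s B \<subseteq> T \<and> T \<subseteq> ?s A \<union> ?s B}"
      if "A \<subseteq> B" for A B
      using sym_diff_interval[OF that, of D] by (metis image_image)
    have "?L \<subseteq> ?R"
    proof
      fix Z assume "Z \<in> ?L"
      then obtain A B where AB: "A \<subseteq> B" "B \<subseteq> {..<n}" "Z = (\<lambda>T. \<beta> (?s T)) ` {T. A \<subseteq> T \<and> T \<subseteq> B}" by blast
      have "?s A \<inter> ?s B \<subseteq> ?s A \<union> ?s B" "?s A \<union> ?s B \<subseteq> {..<n}" using AB(1,2) D by blast+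
      then show "Z \<in> ?R" using img[OF AB(1)] AB(3) by blast
    qed
    moreover have "?R \<subseteq> ?L"
    proof
      fix Z assume "Z \<in> ?R"
      then obtain A B where AB: "A \<subseteq> B" "B \<subseteq> {..<n}" "Z = \<beta> ` {T. A \<subseteq> T \<and> T \<subseteq> B}" by blast
      define A' B' where "A' = ?s A \<inter> ?s B" and "B' = ?s A \<union> ?s B"
      have 1: "A' \<subseteq> B'" "B' \<subseteq> {..<n}" using AB(1,2) D unfolding A'_def B'_def by blast+
      have "?s A' \<inter> ?s B' = A" "?s A' \<union> ?s B' = B" using AB(1) unfolding A'_def B'_def by blast+
      then have "(\<lambda>T. \<beta> (?s T)) ` {T. A' \<subseteq> T \<and> T \<subseteq> B'} = Z" using img[OF 1(1)] AB(3) by simp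
      then show "Z \<in> ?L" using 1 by blast
    qed
    ultimately show ?thesis by (rule subset_antisym)
  qed
  ultimately show ?thesis using c unfolding cube_chart_def by (simp add: comp_def)
qed

lemma cube_chart_at:
  assumes "cubical_complex K" "Q \<in> K" "u \<in> Q"
  obtains n \<beta> where "cube_chart K Q n \<beta>" "\<beta> {} = u"
proof -
  obtain n \<beta> where c: "cube_chart K Q n \<beta>" using cubical_chart[OF assms(1,2)] .
  obtain D where D: "D \<subseteq> {..<n}" "u = \<beta> D" using cube_chart_surj[OF c assms(3)] .
  have "\<beta> (sym_diff {} D) = u" using D by simp
  then show ?thesis using that[OF cube_chart_rebase[OF c D(1)]] by simp
qed

section \<open>Edges, squares and links in terms of charts\<close>

definition adjacent :: "'v set set \<Rightarrow> 'v \<Rightarrow> 'v \<Rightarrow> bool" where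
  "adjacent K u v \<longleftrightarrow> {u, v} \<in> edges K"

definition square :: "'v set set \<Rightarrow> 'v \<Rightarrow> 'v \<Rightarrow> 'v \<Rightarrow> 'v \<Rightarrow> bool" where
  "square K a b c d \<longleftrightarrow> {a, b, c, d} \<in> K \<and> a \<noteq> c \<and> b \<noteq> d \<and>
     adjacent K a b \<and> adjacent K b c \<and> adjacent K c d \<and> adjacent K d a"

lemma adjacent_sym: "adjacent K u v \<Longrightarrow> adjacent K v u"
  by (simp add: adjacent_def insert_commute)

lemma adjacent_neq: "adjacent K u v \<Longrightarrow> u \<noteq> v"
  by (auto simp: adjacent_def edges_def)

lemma adjacent_vertices: "adjacent K u v \<Longrightarrow> u \<in> vertices K \<and> v \<in> vertices K"
  by (auto simp: adjacent_def edges_def vertices_def)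

lemma square_rot: "square K a b c d \<Longrightarrow> square K b c d a"
  unfolding square_def by (auto simp: insert_commute)

lemma square_flip: "square K a b c d \<Longrightarrow> square K a d c b"
  unfolding square_def by (auto simp: insert_commute intro: adjacent_sym)

lemma squareD:
  assumes "square K a b c d"
  shows "{a, b, c, d} \<in> K" "a \<noteq> c" "b \<noteq> d" "adjacent K a b" "adjacent K b c" "adjacent K c d"
    "adjacent K d a" "adjacent K a d"
  using assms adjacent_sym[of K d a] unfolding square_def by simp_all

lemma square_card: "square K a b c d \<Longrightarrow> card {a, b, c, d} = 4"
  unfolding square_def using adjacent_neq[of K a b] adjacent_neq[of K b c] adjacent_neq[of K c d]
    adjacent_neq[of K d a] by auto

lemma interval_insert: "i \<notin> T \<Longrightarrow> {U. T \<subseteq> U \<and> U \<subseteq> insert i T} = {T, insert i T}"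
  by (auto simp: subset_insert_iff)

lemma cube_chart_edge:
  assumes "cube_chart K Q n \<beta>" "T \<subseteq> {..<n}" "i < n" "i \<notin> T"
  shows "adjacent K (\<beta> T) (\<beta> (insert i T))"
proof -
  have "\<beta> ` {U. T \<subseteq> U \<and> U \<subseteq> insert i T} \<in> K" using assms by (intro cube_chart_face) auto
  then have "{\<beta> T, \<beta> (insert i T)} \<in> K" using interval_insert[OF assms(4)] by simp
  moreover have "\<beta> T \<noteq> \<beta> (insert i T)" using cube_chart_inj[OF assms(1,2), of "insert i T"] assms by auto
  ultimately show ?thesis by (simp add: adjacent_def edges_def)
qed

lemma cube_chart_edge':
  assumes "cube_chart K Q n \<beta>" "T \<subseteq> {..<n}" "i \<in> T"
  shows "adjacent K (\<beta> (T - {i})) (\<beta> T)"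
  using cube_chart_edge[OF assms(1), of "T - {i}" i] assms(2,3) by (auto simp: insert_absorb)

lemma cube_chart_edgeE:
  assumes c: "cube_chart K Q n \<beta>" and uv: "adjacent K u v" "u \<in> Q" "v \<in> Q"
  obtains T i where "T \<subseteq> {..<n}" "i < n" "i \<notin> T" "{u, v} = {\<beta> T, \<beta> (insert i T)}"
proof -
  have "{u, v} \<in> K" "card {u, v} = 2" using uv(1) by (auto simp: adjacent_def edges_def)
  then obtain A B where AB: "A \<subseteq> B" "B \<subseteq> {..<n}" "{u, v} = \<beta> ` {T. A \<subseteq> T \<and> T \<subseteq> B}"
    using cube_chart_subcube[OF c, of "{u, v}"] uv by blast
  have fin: "finite B" using AB(2) finite_subset by blast
  have "A \<noteq> B"
  proof
    assume "A = B"
    then have "{T. A \<subseteq> T \<and> T \<subseteq> B} = {A}" by auto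
    then have "{u, v} = {\<beta> A}" using AB(3) by simp
    then show False using \<open>card {u, v} = 2\<close> by simp
  qed
  then obtain i where i: "i \<in> B" "i \<notin> A" using AB(1) by blast
  have sub: "{\<beta> A, \<beta> (insert i A)} \<subseteq> {u, v}" using AB(1,3) i by blast
  have A: "A \<subseteq> {..<n}" "i < n" using AB i by auto
  have "\<beta> A \<noteq> \<beta> (insert i A)" using cube_chart_inj[OF c A(1), of "insert i A"] A i by auto
  then have "card {\<beta> A, \<beta> (insert i A)} = 2" by simp
  then have "{\<beta> A, \<beta> (insert i A)} = {u, v}"
    using sub \<open>card {u, v} = 2\<close> by (intro card_subset_eq) auto
  then show ?thesis using that[OF A i(2)] by simp
qed

lemma cube_chart_square:
  assumes c: "cube_chart K Q n \<beta>" and T: "T \<subseteq> {..<n}" and ij: "i < n" "j < n" "i \<noteq> j" "i \<notin> T" "j \<notin> T"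
  shows "square K (\<beta> T) (\<beta> (insert i T)) (\<beta> (insert i (insert j T))) (\<beta> (insert j T))"
proof -
  have sub: "U = T \<or> U = insert i T \<or> U = insert i (insert j T) \<or> U = insert j T"
    if U: "T \<subseteq> U" "U \<subseteq> insert i (insert j T)" for U
  proof (cases "i \<in> U"; cases "j \<in> U")
    assume "i \<in> U" "j \<in> U"
    then have "U = insert i (insert j T)" using U by blast
    then show ?thesis by simp
  next
    assume "i \<in> U" "j \<notin> U"
    then have "U = insert i T" using U by blast
    then show ?thesis by simp
  next
    assume "i \<notin> U" "j \<in> U"
    then have "U = insert j T" using U by blast
    then show ?thesis by simp
  next
    assume "i \<notin> U" "j \<notin> U"
    then have "U = T" using U by blast
    then show ?thesis by simp
  qed
  have "{U. T \<subseteq> U \<and> U \<subseteq> insert i (insert j T)} = {T, insert i T, insert i (insert j T), insert j T}"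
    using sub by (intro equalityI subsetI) (simp, elim insertE, auto)
  moreover have "\<beta> ` {U. T \<subseteq> U \<and> U \<subseteq> insert i (insert j T)} \<in> K"
    using T ij by (intro cube_chart_face[OF c]) auto
  ultimately have "{\<beta> T, \<beta> (insert i T), \<beta> (insert i (insert j T)), \<beta> (insert j T)} \<in> K" by simp
  moreover have "adjacent K (\<beta> T) (\<beta> (insert i T))" "adjacent K (\<beta> T) (\<beta> (insert j T))"
      "adjacent K (\<beta> (insert i T)) (\<beta> (insert j (insert i T)))"
      "adjacent K (\<beta> (insert j T)) (\<beta> (insert i (insert j T)))"
    using T ij by (auto intro!: cube_chart_edge[OF c])
  moreover have "\<beta> T \<noteq> \<beta> (insert i (insert j T))" "\<beta> (insert i T) \<noteq> \<beta> (insert j T)"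
    using T ij by (auto simp: cube_chart_inj[OF c])
  ultimately show ?thesis unfolding square_def by (simp add: insert_commute adjacent_sym)
qed

lemma cube_chart_neighbours:
  assumes "cube_chart K Q n \<beta>"
  shows "{u \<in> Q. adjacent K (\<beta> {}) u} = (\<lambda>i. \<beta> {i}) ` {..<n}"
proof (intro Set.set_eqI iffI)
  fix u assume "u \<in> {u \<in> Q. adjacent K (\<beta> {}) u}"
  then have u: "u \<in> Q" "adjacent K (\<beta> {}) u" by auto
  obtain T i where T: "T \<subseteq> {..<n}" "i < n" "i \<notin> T" "{\<beta> {}, u} = {\<beta> T, \<beta> (insert i T)}"
    using cube_chart_edgeE[OF assms u(2) cube_chart_in[OF assms] u(1)] by auto
  have "\<beta> {} \<noteq> \<beta> (insert i T)" using cube_chart_inj[OF assms, of "{}" "insert i T"] T by auto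
  then have "\<beta> {} = \<beta> T" "u = \<beta> (insert i T)" using T(4) by (auto simp: doubleton_eq_iff)
  then show "u \<in> (\<lambda>i. \<beta> {i}) ` {..<n}" using cube_chart_inj[OF assms, of "{}" T] T by auto
next
  fix u assume "u \<in> (\<lambda>i. \<beta> {i}) ` {..<n}"
  then show "u \<in> {u \<in> Q. adjacent K (\<beta> {}) u}"
    using cube_chart_edge[OF assms, of "{}"] cube_chart_in[OF assms] by auto
qed

lemma cube_chart_neighbours_card:
  assumes "cube_chart K Q n \<beta>"
  shows "card {u \<in> Q. adjacent K (\<beta> {}) u} = n"
proof -
  have "inj_on (\<lambda>i. \<beta> {i}) {..<n}" by (rule inj_onI) (auto simp: cube_chart_inj[OF assms])
  then show ?thesis unfolding cube_chart_neighbours[OF assms] by (simp add: card_image)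
qed

text \<open>Two different squares with three common corners would meet in a cube with three
  vertices, but the number of vertices of a cube is a power of two.\<close>

lemma square_unique:
  assumes K: "cubical_complex K" and sq: "square K a b c d" "square K a b c d'"
  shows "d = d'"
proof -
  let ?Q = "{a, b, c, d}" and ?Q' = "{a, b, c, d'}"
  have "?Q \<in> K" "?Q' \<in> K" using sq by (simp_all add: square_def)
  then have "?Q \<inter> ?Q' \<in> K" by (rule cubical_Int[OF K, where x = a]) simp_all
  then obtain n \<beta> where "cube_chart K (?Q \<inter> ?Q') n \<beta>" by (rule cubical_chart[OF K])
  then have card: "card (?Q \<inter> ?Q') = 2 ^ n" by (rule cube_chart_card)
  have ne: "a \<noteq> b" "b \<noteq> c" "a \<noteq> c" "b \<noteq> d" "d \<noteq> a" "c \<noteq> d" "b \<noteq> d'" "d' \<noteq> a" "c \<noteq> d'"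
    using sq by (auto simp: square_def dest: adjacent_neq)
  have "card {a, b, c} \<le> card (?Q \<inter> ?Q')" by (intro card_mono) auto
  then have "3 \<le> (2::nat) ^ n" using card ne by simp
  show ?thesis
  proof (rule ccontr)
    assume "d \<noteq> d'"
    then have "?Q \<inter> ?Q' = {a, b, c}" using ne by auto
    then have 3: "(2::nat) ^ n = 3" using card ne by simp
    then show False by (cases n) (simp, simp, presburger)
  qed
qed

lemma link_alt: "link K v = {{u \<in> Q. adjacent K v u} |Q. Q \<in> K \<and> v \<in> Q}"
  unfolding link_def adjacent_def ..

lemma link_singleton:
  assumes "adjacent K b z" shows "{z} \<in> link K b"
proof -
  have "{b, z} \<in> K" using assms by (simp add: adjacent_def edges_def)
  moreover have "{u \<in> {b, z}. adjacent K b u} = {z}" using assms adjacent_neq by fastforce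
  ultimately show ?thesis unfolding link_alt by (intro CollectI exI[of _ "{b, z}"]) auto
qed

lemma link_square:
  assumes K: "cubical_complex K" and sq: "square K b z y z'"
  shows "{z, z'} \<in> link K b"
proof -
  let ?Q = "{b, z, y, z'}"
  have Q: "?Q \<in> K" using sq by (simp add: square_def)
  obtain n \<beta> where c: "cube_chart K ?Q n \<beta>" "\<beta> {} = b" using cube_chart_at[OF K Q, of b] by auto
  have "(2::nat) ^ n = 2 ^ 2" using cube_chart_card[OF c(1)] square_card[OF sq] by simp
  then have n: "n = 2" by (simp only: power_inject_exp)
  have "{z, z'} \<subseteq> {u \<in> ?Q. adjacent K b u}" using sq adjacent_sym unfolding square_def by auto
  moreover have "card {u \<in> ?Q. adjacent K b u} = 2" using cube_chart_neighbours_card[OF c(1)] c(2) n by simp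
  moreover have "card {z, z'} = 2" using sq unfolding square_def by simp
  ultimately have "{z, z'} = {u \<in> ?Q. adjacent K b u}" by (intro card_subset_eq) auto
  then have "\<exists>Q. {z, z'} = {u \<in> Q. adjacent K b u} \<and> Q \<in> K \<and> b \<in> Q"
    using Q by (intro exI[of _ ?Q]) simp
  then show ?thesis unfolding link_alt by simp
qed

text \<open>The three squares make \<open>z\<close>, \<open>z'\<close>, \<open>v\<close> pairwise
  joined in the link of \<open>b\<close>, so by flagness they are the neighbours of \<open>b\<close>
  in one cube. Uniqueness of squares identifies \<open>y\<close>, \<open>a\<close>, \<open>c\<close>
  with the corners of that cube at two coordinates from \<open>b\<close>, and \<open>x\<close> is
  the corner \<open>{i, j, k}\<close>.\<close>

lemma flag_cube:
  assumes K: "cubical_complex K" and flag: "flag_complex (link K b)"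
    and sq: "square K b z y z'" "square K b z a v" "square K b z' c v"
  shows "\<exists>x. square K x a v c \<and> square K y z a x \<and> square K y z' c x"
proof -
  have adj: "adjacent K b z" "adjacent K b z'" "adjacent K b v"
    using squareD[OF sq(1)] squareD[OF sq(2)] by simp_all
  have ne: "z \<noteq> z'" "z \<noteq> v" "z' \<noteq> v" using squareD(3)[OF sq(1)] squareD(3)[OF sq(2)] squareD(3)[OF sq(3)] by auto
  have "{z, z'} \<in> link K b" "{z, v} \<in> link K b" "{z', v} \<in> link K b"
    using link_square[OF K sq(1)] link_square[OF K sq(2)] link_square[OF K sq(3)] by simp_all
  then have "\<forall>p\<in>{z, z', v}. \<forall>q\<in>{z, z', v}. {p, q} \<in> link K b"
    using link_singleton[OF adj(1)] link_singleton[OF adj(2)] link_singleton[OF adj(3)]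
    by (simp add: insert_commute)
  then have "{z, z', v} \<in> link K b" using flag[unfolded flag_complex_def, rule_format, of "{z, z', v}"] by simp
  then have "\<exists>Q. {z, z', v} = {u \<in> Q. adjacent K b u} \<and> Q \<in> K \<and> b \<in> Q"
    unfolding link_alt mem_Collect_eq .
  then obtain Q where Q: "Q \<in> K" "b \<in> Q" "{z, z', v} = {u \<in> Q. adjacent K b u}" by (elim exE conjE)
  obtain n \<beta> where c: "cube_chart K Q n \<beta>" "\<beta> {} = b" using cube_chart_at[OF K Q(1,2)] .
  have "{z, z', v} = (\<lambda>i. \<beta> {i}) ` {..<n}" using cube_chart_neighbours[OF c(1)] c(2) Q(3) by simp
  then have "z \<in> (\<lambda>i. \<beta> {i}) ` {..<n}" "z' \<in> (\<lambda>i. \<beta> {i}) ` {..<n}" "v \<in> (\<lambda>i. \<beta> {i}) ` {..<n}"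
    by auto
  then obtain i j k where ijk: "i < n" "j < n" "k < n" "z = \<beta> {i}" "z' = \<beta> {j}" "v = \<beta> {k}"
    by (elim imageE) simp
  have d: "i \<noteq> j" "i \<noteq> k" "j \<noteq> k" using ne ijk by auto
  have un: "y = y'" if "square K b p y q" "square K b p y' q" for p q y y'
    by (rule square_unique[OF K square_rot[OF square_rot[OF square_rot[OF square_flip[OF that(1)]]]]
          square_rot[OF square_rot[OF square_rot[OF square_flip[OF that(2)]]]]])
  have "square K b z (\<beta> {i, j}) z'" "square K b z (\<beta> {i, k}) v" "square K b z' (\<beta> {j, k}) v"
    using cube_chart_square[OF c(1), of "{}"] ijk d c(2) by simp_all
  then have y: "y = \<beta> {i, j}" "a = \<beta> {i, k}" "c = \<beta> {j, k}" using un[OF sq(1)] un[OF sq(2)] un[OF sq(3)] by simp_all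
  have "square K (\<beta> {k}) (\<beta> {i, k}) (\<beta> {i, j, k}) (\<beta> {j, k})"
    "square K (\<beta> {i}) (\<beta> {j, i}) (\<beta> {j, k, i}) (\<beta> {k, i})"
    "square K (\<beta> {j}) (\<beta> {i, j}) (\<beta> {i, k, j}) (\<beta> {k, j})"
    using cube_chart_square[OF c(1), of "{k}" i j] cube_chart_square[OF c(1), of "{i}" j k]
      cube_chart_square[OF c(1), of "{j}" i k] ijk d by simp_all
  then have 1: "square K v a (\<beta> {i, j, k}) c" "square K z y (\<beta> {i, j, k}) a" "square K z' y (\<beta> {i, j, k}) c"
    using y ijk by (simp_all add: insert_commute)
  have "square K (\<beta> {i, j, k}) a v c" using square_flip[OF square_rot[OF square_rot[OF 1(1)]]] .
  moreover have "square K y z a (\<beta> {i, j, k})" using square_flip[OF square_rot[OF 1(2)]] .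
  moreover have "square K y z' c (\<beta> {i, j, k})" using square_flip[OF square_rot[OF 1(3)]] .
  ultimately show ?thesis by blast
qed

lemma cube_connected:
  assumes K: "cubical_complex K" and Q: "Q \<in> K" "u \<in> Q" "v \<in> Q"
  shows "(\<lambda>x y. adjacent K x y \<and> x \<in> Q \<and> y \<in> Q)\<^sup>*\<^sup>* u v"
proof -
  obtain n \<beta> where c: "cube_chart K Q n \<beta>" "\<beta> {} = u" using cube_chart_at[OF K Q(1,2)] .
  obtain T where T: "T \<subseteq> {..<n}" "v = \<beta> T" using cube_chart_surj[OF c(1) Q(3)] .
  have "finite T" using T(1) finite_subset by blast
  then have "(\<lambda>x y. adjacent K x y \<and> x \<in> Q \<and> y \<in> Q)\<^sup>*\<^sup>* (\<beta> {}) (\<beta> T)" using T(1)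
  proof (induction T rule: finite_induct)
    case (insert i T)
    have T: "T \<subseteq> {..<n}" "i < n" using insert.prems by auto
    have "adjacent K (\<beta> T) (\<beta> (insert i T)) \<and> \<beta> T \<in> Q \<and> \<beta> (insert i T) \<in> Q"
      using cube_chart_edge[OF c(1) T insert.hyps(2)] cube_chart_in[OF c(1) T(1)]
        cube_chart_in[OF c(1) insert.prems] by simp
    with insert.IH[OF T(1)] show ?case by (rule rtranclp.rtrancl_into_rtrancl)
  qed simp
  then show ?thesis using T c by simp
qed

text \<open>A covering of the \<open>1\<close>-skeleton to which squares lift.\<close>

locale local_system =
  fixes K :: "'v set set" and fib :: "'v \<Rightarrow> 's set" and tr :: "'v \<Rightarrow> 'v \<Rightarrow> 's \<Rightarrow> 's"
  assumes cubical: "cubical_complex K"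
    and tr_fib: "adjacent K u v \<Longrightarrow> x \<in> fib u \<Longrightarrow> tr u v x \<in> fib v"
    and tr_inv: "adjacent K u v \<Longrightarrow> x \<in> fib u \<Longrightarrow> tr v u (tr u v x) = x"
    and tr_square: "square K a b c d \<Longrightarrow> x \<in> fib a \<Longrightarrow> tr b c (tr a b x) = tr d c (tr a d x)"
begin

definition cube_section :: "'v set \<Rightarrow> ('v \<Rightarrow> 's) \<Rightarrow> bool" where
  "cube_section Q s \<longleftrightarrow> (\<forall>v\<in>Q. s v \<in> fib v) \<and> (\<forall>u\<in>Q. \<forall>v\<in>Q. adjacent K u v \<longrightarrow> tr u v (s u) = s v)"

text \<open>Induction over the coordinates of a chart based at \<open>u\<close>. A section over the
  face spanned by the first \<open>m\<close> directions is transported in direction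
  \<open>m\<close>; the square in the directions \<open>i\<close> and \<open>m\<close> makes the
  extension compatible with the edges in each old direction \<open>i\<close>. Edges traversed
  downwards follow from \<open>tr_inv\<close>.\<close>

lemma cube_section_ex:
  assumes Q: "Q \<in> K" "u \<in> Q" and x: "x \<in> fib u"
  shows "\<exists>s. cube_section Q s \<and> s u = x"
proof -
  obtain n \<beta> where c: "cube_chart K Q n \<beta>" "\<beta> {} = u" using cube_chart_at[OF cubical Q] .
  have "\<exists>f. f {} = x \<and> (\<forall>T\<subseteq>{..<m}. f T \<in> fib (\<beta> T)) \<and>
      (\<forall>T\<subseteq>{..<m}. \<forall>i<m. i \<notin> T \<longrightarrow> tr (\<beta> T) (\<beta> (insert i T)) (f T) = f (insert i T))" if "m \<le> n" for m
    using that
  proof (induction m)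
    case 0
    then show ?case using x c by (intro exI[of _ "\<lambda>_. x"]) auto
  next
    case (Suc m)
    then obtain f where f: "f {} = x" "\<And>T. T \<subseteq> {..<m} \<Longrightarrow> f T \<in> fib (\<beta> T)"
      "\<And>T i. T \<subseteq> {..<m} \<Longrightarrow> i < m \<Longrightarrow> i \<notin> T \<Longrightarrow> tr (\<beta> T) (\<beta> (insert i T)) (f T) = f (insert i T)"
      by auto
    define g where "g T = (if m \<in> T then tr (\<beta> (T - {m})) (\<beta> T) (f (T - {m})) else f T)" for T
    have sub: "T - {m} \<subseteq> {..<m}" if "T \<subseteq> {..<Suc m}" for T using that by auto
    have sub': "T \<subseteq> {..<m}" if "T \<subseteq> {..<Suc m}" "m \<notin> T" for T using sub[OF that(1)] that(2) by auto
    have subn: "T \<subseteq> {..<n}" if "T \<subseteq> {..<Suc m}" for T using that Suc.prems by auto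
    have gf: "g T \<in> fib (\<beta> T)" if T: "T \<subseteq> {..<Suc m}" for T
    proof (cases "m \<in> T")
      case True
      then show ?thesis unfolding g_def
        using tr_fib[OF cube_chart_edge'[OF c(1) subn[OF T] True] f(2)[OF sub[OF T]]] by simp
    qed (use f(2)[OF sub'[OF T]] in \<open>simp add: g_def\<close>)
    have gt: "tr (\<beta> T) (\<beta> (insert i T)) (g T) = g (insert i T)"
      if T: "T \<subseteq> {..<Suc m}" "i < Suc m" "i \<notin> T" for T i
    proof (cases "m \<in> T")
      case True
      define T' where "T' = T - {m}"
      have im: "i \<noteq> m" using True T(3) by blast
      have T': "T = insert m T'" "m \<notin> T'" "T' \<subseteq> {..<m}" "i \<notin> T'" "i < m" "i \<noteq> m"
        using True T sub[OF T(1)] im unfolding T'_def by auto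
      have im: "insert i T - {m} = insert i T'" using T' by auto
      have "square K (\<beta> T') (\<beta> (insert i T')) (\<beta> (insert i (insert m T'))) (\<beta> (insert m T'))"
        using T' Suc.prems by (intro cube_chart_square[OF c(1)]) auto
      from tr_square[OF this f(2)[OF T'(3)]]
      have "tr (\<beta> (insert i T')) (\<beta> (insert i T)) (f (insert i T')) = tr (\<beta> T) (\<beta> (insert i T)) (tr (\<beta> T') (\<beta> T) (f T'))"
        using f(3)[OF T'(3,5,4)] T'(1) by simp
      then show ?thesis unfolding g_def using True im T'_def by simp
    next
      case False
      note T0 = sub'[OF T(1) False]
      show ?thesis
      proof (cases "i = m")
        case True
        then have "insert i T - {m} = T" using False by auto
        then show ?thesis unfolding g_def using True False by simp
      next
        case i: False
        then show ?thesis unfolding g_def using False T f(3)[OF T0] by simp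
      qed
    qed
    have "g {} = x" using f(1) by (simp add: g_def)
    then show ?case using gf gt by blast
  qed
  from this[of n] obtain f where f: "f {} = x" "\<And>T. T \<subseteq> {..<n} \<Longrightarrow> f T \<in> fib (\<beta> T)"
      "\<And>T i. T \<subseteq> {..<n} \<Longrightarrow> i < n \<Longrightarrow> i \<notin> T \<Longrightarrow> tr (\<beta> T) (\<beta> (insert i T)) (f T) = f (insert i T)"
    by auto
  define s where "s v = f (the_inv_into (Pow {..<n}) \<beta> v)" for v
  have s: "s (\<beta> T) = f T" if "T \<subseteq> {..<n}" for T
    unfolding s_def using that bij_betw_imp_inj_on[OF cube_chart_bij[OF c(1)]] by (simp add: the_inv_into_f_f)
  have sf: "s v \<in> fib v" if v: "v \<in> Q" for v
  proof -
    obtain T where T: "T \<subseteq> {..<n}" "v = \<beta> T" using cube_chart_surj[OF c(1) v] .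
    then show ?thesis using s[OF T(1)] f(2)[OF T(1)] by simp
  qed
  have "tr v w (s v) = s w" if vw: "v \<in> Q" "w \<in> Q" "adjacent K v w" for v w
  proof -
    obtain T i where T: "T \<subseteq> {..<n}" "i < n" "i \<notin> T" "{v, w} = {\<beta> T, \<beta> (insert i T)}"
      using cube_chart_edgeE[OF c(1) vw(3,1,2)] .
    have iT: "insert i T \<subseteq> {..<n}" using T by simp
    have 1: "tr (\<beta> T) (\<beta> (insert i T)) (s (\<beta> T)) = s (\<beta> (insert i T))"
      using f(3)[OF T(1-3)] s[OF T(1)] s[OF iT] by simp
    have 2: "tr (\<beta> (insert i T)) (\<beta> T) (s (\<beta> (insert i T))) = s (\<beta> T)"
      unfolding 1[symmetric]
      using tr_inv[OF cube_chart_edge[OF c(1) T(1-3)]] sf[OF cube_chart_in[OF c(1) T(1)]] by simp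
    from T(4) consider "v = \<beta> T" "w = \<beta> (insert i T)" | "w = \<beta> T" "v = \<beta> (insert i T)"
      by (auto simp: doubleton_eq_iff)
    then show ?thesis using 1 2 by cases simp_all
  qed
  then have "cube_section Q s" using sf unfolding cube_section_def by blast
  then show ?thesis using s[of "{}"] f(1) c(2) by auto
qed

text \<open>The intersection of two cubes is again a cube, hence connected through edges, and a
  section is determined along edges.\<close>

lemma cube_section_agree:
  assumes "cube_section Q s" "cube_section Q' s'" "Q \<in> K" "Q' \<in> K"
    "u \<in> Q \<inter> Q'" "v \<in> Q \<inter> Q'" "s u = s' u"
  shows "s v = s' v"
proof -
  have QQ: "Q \<inter> Q' \<in> K" using cubical_Int[OF cubical assms(3,4), of u] assms(5) by simp
  have "(\<lambda>x y. adjacent K x y \<and> x \<in> Q \<inter> Q' \<and> y \<in> Q \<inter> Q')\<^sup>*\<^sup>* u v"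
    using cube_connected[OF cubical QQ] assms by blast
  then show ?thesis
  proof (induction rule: rtranclp_induct)
    case (step y z)
    have "s z = tr y z (s y)" "s' z = tr y z (s' y)" using step(2) assms(1,2) unfolding cube_section_def by auto
    then show ?case using step(3) by simp
  qed fact
qed

text \<open>Transport along any path inside a cube that contains \<open>u\<close> and \<open>v\<close>; junk if there is no such cube.\<close>

definition ext :: "'v \<Rightarrow> 'v \<Rightarrow> 's \<Rightarrow> 's" where
  "ext u v x = (THE y. \<exists>Q s. Q \<in> K \<and> u \<in> Q \<and> v \<in> Q \<and> cube_section Q s \<and> s u = x \<and> s v = y)"

lemma ext_eq:
  assumes "Q \<in> K" "u \<in> Q" "v \<in> Q" "cube_section Q s"
  shows "ext u v (s u) = s v"
  unfolding ext_def
proof (rule the_equality)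
  fix y assume "\<exists>Q' s'. Q' \<in> K \<and> u \<in> Q' \<and> v \<in> Q' \<and> cube_section Q' s' \<and> s' u = s u \<and> s' v = y"
  then obtain Q' s' where *: "Q' \<in> K" "u \<in> Q'" "v \<in> Q'" "cube_section Q' s'" "s' u = s u" "s' v = y" by blast
  show "y = s v" using cube_section_agree[OF *(4) assms(4) *(1) assms(1) _ _ *(5), of v] * assms by blast
qed (use assms in blast)

lemma ext_cocycle:
  assumes "Q \<in> K" "u \<in> Q" "v \<in> Q" "w \<in> Q" "x \<in> fib u"
  shows "ext v w (ext u v x) = ext u w x"
proof -
  obtain s where s: "cube_section Q s" "s u = x" using cube_section_ex[OF assms(1,2,5)] by blast
  then show ?thesis using ext_eq[OF assms(1) _ _ s(1)] assms by metis
qed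

lemma ext_fib:
  assumes "Q \<in> K" "u \<in> Q" "v \<in> Q" "x \<in> fib u"
  shows "ext u v x \<in> fib v"
proof -
  obtain s where s: "cube_section Q s" "s u = x" using cube_section_ex[OF assms(1,2,4)] by blast
  then show ?thesis using ext_eq[OF assms(1-3) s(1)] assms(3) unfolding cube_section_def by metis
qed

lemma ext_refl:
  assumes "u \<in> vertices K" "x \<in> fib u"
  shows "ext u u x = x"
proof -
  obtain Q where Q: "Q \<in> K" "u \<in> Q" using assms unfolding vertices_def by blast
  obtain s where s: "cube_section Q s" "s u = x" using cube_section_ex[OF Q assms(2)] by blast
  then show ?thesis using ext_eq[OF Q Q(2) s(1)] by simp
qed

lemma ext_adjacent:
  assumes "adjacent K u v" "x \<in> fib u"
  shows "ext u v x = tr u v x"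
proof -
  have Q: "{u, v} \<in> K" using assms(1) by (simp add: adjacent_def edges_def)
  obtain s where s: "cube_section {u, v} s" "s u = x" using cube_section_ex[OF Q _ assms(2)] by blast
  then have "s v = tr u v x" using assms(1) unfolding cube_section_def by auto
  then show ?thesis using ext_eq[OF Q _ _ s(1), of u v] s(2) by simp
qed

end

section \<open>Monodromy over a simply connected realization\<close>

text \<open>For coordinates in \<open>[0,1]\<close> this is the probability of drawing the subset
  \<open>T\<close> when each \<open>i\<close> is drawn independently with probability
  \<open>t i\<close>. It explains why the weights sum to one and what their partial sums
  are.\<close>

definition weight :: "nat \<Rightarrow> (nat \<Rightarrow> real) \<Rightarrow> nat set \<Rightarrow> real" where
  "weight n t T = (\<Prod>i\<in>T. t i) * (\<Prod>i\<in>{..<n} - T. 1 - t i)"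

lemma weight_nonneg:
  assumes "T \<subseteq> {..<n}" "\<forall>i<n. 0 \<le> t i \<and> t i \<le> 1"
  shows "0 \<le> weight n t T"
proof -
  have "0 \<le> (\<Prod>i\<in>T. t i)" using assms by (intro prod_nonneg) auto
  moreover have "0 \<le> (\<Prod>i\<in>{..<n} - T. 1 - t i)" using assms by (intro prod_nonneg) auto
  ultimately show ?thesis unfolding weight_def by (rule mult_nonneg_nonneg)
qed

lemma sum_weight: "(\<Sum>T\<in>Pow {..<n}. weight n t T) = 1"
proof -
  have "(\<Prod>i\<in>{..<n}. t i + (1 - t i)) = (\<Sum>T\<in>Pow {..<n}. weight n t T)"
    unfolding weight_def by (rule prod_add) simp
  then show ?thesis by simp
qed

lemma cube_point_at:
  assumes c: "cube_chart K Q n \<beta>" and T: "T \<subseteq> {..<n}"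
  shows "cube_point n \<beta> t (\<beta> T) = weight n t T"
proof -
  have "cube_point n \<beta> t (\<beta> T) = (\<Sum>S\<in>Pow {..<n}. if S = T then weight n t S else 0)"
    unfolding cube_point_def
  proof (rule sum.cong)
    fix S assume "S \<in> Pow {..<n}"
    then have "\<beta> S = \<beta> T \<longleftrightarrow> S = T" using cube_chart_inj[OF c _ T] by simp
    then show "(if \<beta> S = \<beta> T then (\<Prod>i\<in>S. t i) * (\<Prod>i\<in>{..<n} - S. 1 - t i) else 0) =
        (if S = T then weight n t S else 0)" by (simp add: weight_def)
  qed simp
  also have "\<dots> = weight n t T" using T by simp
  finally show ?thesis .
qed

lemma cube_point_outside:
  assumes c: "cube_chart K Q n \<beta>" and v: "v \<notin> Q"
  shows "cube_point n \<beta> t v = 0"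
  unfolding cube_point_def
proof (rule sum.neutral, rule ballI)
  fix S assume "S \<in> Pow {..<n}"
  then have "\<beta> S \<in> Q" using cube_chart_in[OF c] by simp
  then show "(if \<beta> S = v then (\<Prod>i\<in>S. t i) * (\<Prod>i\<in>{..<n} - S. 1 - t i) else 0) = 0" using v by auto
qed

lemma sum_cube_point:
  assumes c: "cube_chart K Q n \<beta>" and W: "W \<subseteq> Q"
  shows "sum (cube_point n \<beta> t) W = (\<Sum>T\<in>{T \<in> Pow {..<n}. \<beta> T \<in> W}. weight n t T)"
proof -
  have "bij_betw \<beta> {T \<in> Pow {..<n}. \<beta> T \<in> W} W"
    unfolding bij_betw_def
  proof
    show "inj_on \<beta> {T \<in> Pow {..<n}. \<beta> T \<in> W}"
      by (rule inj_on_subset[OF bij_betw_imp_inj_on[OF cube_chart_bij[OF c]]]) auto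
    show "\<beta> ` {T \<in> Pow {..<n}. \<beta> T \<in> W} = W"
    proof (intro equalityI subsetI)
      fix w assume w: "w \<in> W"
      then have "w \<in> Q" using W by blast
      then obtain T where "T \<subseteq> {..<n}" "w = \<beta> T" by (rule cube_chart_surj[OF c])
      then show "w \<in> \<beta> ` {T \<in> Pow {..<n}. \<beta> T \<in> W}" using w by (intro image_eqI[of _ _ T]) simp_all
    qed auto
  qed
  then have "sum (cube_point n \<beta> t) W = (\<Sum>T\<in>{T \<in> Pow {..<n}. \<beta> T \<in> W}. cube_point n \<beta> t (\<beta> T))"
    by (rule sum.reindex_bij_betw[symmetric])
  also have "\<dots> = (\<Sum>T\<in>{T \<in> Pow {..<n}. \<beta> T \<in> W}. weight n t T)"
    by (intro sum.cong refl cube_point_at[OF c]) simp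
  finally show ?thesis .
qed

lemma cube_point_total:
  assumes c: "cube_chart K Q n \<beta>"
  shows "sum (cube_point n \<beta> t) Q = 1"
proof -
  have "{T \<in> Pow {..<n}. \<beta> T \<in> Q} = Pow {..<n}" using cube_chart_in[OF c] by blast
  then show ?thesis using sum_cube_point[OF c subset_refl, of t] sum_weight[of n t] by simp
qed

lemma realizationE:
  assumes "f \<in> realization K"
  obtains Q n \<beta> t where "Q \<in> K" "cube_chart K Q n \<beta>" "\<forall>i<n. 0 \<le> t i \<and> t i \<le> 1" "f = cube_point n \<beta> t"
proof -
  have "\<exists>n \<beta> t. f = cube_point n \<beta> t \<and> (\<exists>Q\<in>K. cube_chart K Q n \<beta>) \<and> (\<forall>i<n. 0 \<le> t i \<and> t i \<le> 1)"
    using assms unfolding realization_def mem_Collect_eq .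
  then show ?thesis using that by (elim exE conjE bexE)
qed

lemma realizationI:
  assumes "Q \<in> K" "cube_chart K Q n \<beta>" "\<forall>i<n. 0 \<le> t i \<and> t i \<le> 1"
  shows "cube_point n \<beta> t \<in> realization K"
  unfolding realization_def mem_Collect_eq
  by (rule exI[of _ n], rule exI[of _ \<beta>], rule exI[of _ t]) (use assms in auto)

lemma realization_support:
  assumes "f \<in> realization K"
  obtains Q where "Q \<in> K" "finite Q" "\<forall>v. v \<notin> Q \<longrightarrow> f v = 0" "\<forall>v. 0 \<le> f v" "sum f Q = 1"
proof -
  obtain Q n \<beta> t where *: "Q \<in> K" "cube_chart K Q n \<beta>" "\<forall>i<n. 0 \<le> t i \<and> t i \<le> 1" "f = cube_point n \<beta> t"
    using assms by (rule realizationE)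
  show ?thesis
  proof (rule that[OF *(1) cube_chart_finite[OF *(2)]])
    show out: "\<forall>v. v \<notin> Q \<longrightarrow> f v = 0" using cube_point_outside[OF *(2)] *(4) by simp
    show "\<forall>v. 0 \<le> f v"
    proof
      fix v
      show "0 \<le> f v"
      proof (cases "v \<in> Q")
        case True
        then obtain T where T: "T \<subseteq> {..<n}" "v = \<beta> T" by (rule cube_chart_surj[OF *(2)])
        then show ?thesis using cube_point_at[OF *(2) T(1)] weight_nonneg[OF T(1) *(3)] *(4) by simp
      qed (simp add: out)
    qed
    show "sum f Q = 1" using cube_point_total[OF *(2)] *(4) by simp
  qed
qed

lemma realization_pos_ex:
  assumes "f \<in> realization K"
  shows "\<exists>v\<in>vertices K. 0 < f v"
proof (rule ccontr)
  assume no: "\<not> ?thesis"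
  obtain Q where Q: "Q \<in> K" "finite Q" "\<forall>v. v \<notin> Q \<longrightarrow> f v = 0" "\<forall>v. 0 \<le> f v" "sum f Q = 1"
    using assms by (rule realization_support)
  have "f v = 0" if "v \<in> Q" for v
  proof -
    have "v \<in> vertices K" using Q(1) that by (auto simp: vertices_def)
    then have "\<not> 0 < f v" using no by blast
    then show ?thesis using Q(4) by (simp add: order_less_le)
  qed
  then have "sum f Q = 0" by (intro sum.neutral) blast
  then show False using Q(5) by simp
qed

lemma realization_common_cube:
  assumes "f \<in> realization K"
  obtains Q where "Q \<in> K" "\<forall>v. 0 < f v \<longrightarrow> v \<in> Q"
proof -
  obtain Q where Q: "Q \<in> K" "finite Q" "\<forall>v. v \<notin> Q \<longrightarrow> f v = 0" "\<forall>v. 0 \<le> f v" "sum f Q = 1"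
    using assms by (rule realization_support)
  have "\<forall>v. 0 < f v \<longrightarrow> v \<in> Q" using Q(3) by (metis less_irrefl)
  then show ?thesis using that[OF Q(1)] by blast
qed

section \<open>Edge walks as paths in the realization\<close>

definition edge_point :: "'v \<Rightarrow> 'v \<Rightarrow> real \<Rightarrow> 'v \<Rightarrow> real" where
  "edge_point u v t = (\<lambda>x. (1 - t) * indicat_real {u} x + t * indicat_real {v} x)"

lemma edge_point_in_realization:
  assumes K: "cubical_complex K" and a: "adjacent K u v" and t: "0 \<le> t" "t \<le> 1"
  shows "edge_point u v t \<in> realization K"
proof -
  have Q: "{u, v} \<in> K" "card {u, v} = 2" using a by (auto simp: adjacent_def edges_def)
  obtain n \<beta> where c: "cube_chart K {u, v} n \<beta>" "\<beta> {} = u" using cube_chart_at[OF K Q(1), of u] by auto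
  have "(2::nat) ^ n = 2 ^ 1" using cube_chart_card[OF c(1)] Q(2) by simp
  then have n: "n = 1" by (simp only: power_inject_exp)
  have "v \<in> {u, v}" by simp
  then obtain T where T: "T \<subseteq> {..<n}" "v = \<beta> T" by (rule cube_chart_surj[OF c(1)])
  have "u \<noteq> v" using Q(2) by auto
  then have "T \<noteq> {}" using T c by auto
  then have "T = {0}" using T(1) n by auto
  then have b0: "\<beta> {0} = v" using T by simp
  have P: "Pow {..<n} = {{}, {0}}" using n by (auto simp: subset_insert_iff lessThan_Suc)
  have "cube_point n \<beta> (\<lambda>_. t) = edge_point u v t"
  proof
    fix x
    show "cube_point n \<beta> (\<lambda>_. t) x = edge_point u v t x"
      unfolding cube_point_def P edge_point_def using n b0 c(2) by (simp add: indicator_def)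
  qed
  then show ?thesis using realizationI[OF Q(1) c(1), of "\<lambda>_. t"] t by simp
qed

lemma vertex_in_realization:
  assumes K: "cubical_complex K" and v: "v \<in> vertices K"
  shows "indicat_real {v} \<in> realization K"
proof -
  obtain Q where Q: "Q \<in> K" "v \<in> Q" using v by (auto simp: vertices_def)
  obtain n \<beta> where c: "cube_chart K Q n \<beta>" "\<beta> {} = v" using cube_chart_at[OF K Q] .
  have f: "{U. {} \<subseteq> U \<and> U \<subseteq> {}} = ({{}} :: nat set set)" by auto
  have "{v} \<in> K" using cube_chart_face[OF c(1), of "{}" "{}"] c(2) f by simp
  then obtain m \<beta>' where c': "cube_chart K {v} m \<beta>'" "\<beta>' {} = v" using cube_chart_at[OF K, of "{v}" v] by auto
  have "(2::nat) ^ m = 2 ^ 0" using cube_chart_card[OF c'(1)] by simp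
  then have m: "m = 0" by (simp only: power_inject_exp)
  have "cube_point m \<beta>' (\<lambda>_. 0) = indicat_real {v}"
    unfolding cube_point_def using m c'(2) by (auto simp: fun_eq_iff indicator_def)
  then show ?thesis using realizationI[OF \<open>{v} \<in> K\<close> c'(1), of "\<lambda>_. 0"] by simp
qed

lemma open_star: "open {f :: 'v \<Rightarrow> real. 0 < f v}"
  by (rule open_Collect_less) (auto intro: continuous_on_product_then_coordinatewise)

text \<open>The tent function with peak at \<open>k / m\<close>. Written with tents, a piecewise
  linear path along a walk is continuous by its formula, without gluing of pieces.\<close>

definition hat :: "nat \<Rightarrow> nat \<Rightarrow> real \<Rightarrow> real" where
  "hat m k s = max 0 (1 - \<bar>real m * s - real k\<bar>)"

definition walk_path :: "nat \<Rightarrow> (nat \<Rightarrow> 'v) \<Rightarrow> real \<Rightarrow> 'v \<Rightarrow> real" where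
  "walk_path m p s = (\<lambda>x. \<Sum>k\<le>m. hat m k s * indicat_real {p k} x)"

lemma continuous_walk_path: "continuous_on S (walk_path m p)"
  unfolding walk_path_def hat_def by (intro continuous_intros)

lemma walk_path_edge:
  assumes k: "k < m" and s: "real k \<le> real m * s" "real m * s \<le> real (Suc k)"
  shows "walk_path m p s = edge_point (p k) (p (Suc k)) (real m * s - real k)"
proof
  fix x
  let ?\<theta> = "real m * s - real k"
  have "(\<Sum>j\<le>m. hat m j s * indicat_real {p j} x) = (\<Sum>j\<in>{k, Suc k}. hat m j s * indicat_real {p j} x)"
  proof (rule sum.mono_neutral_right)
    show "\<forall>j\<in>{..m} - {k, Suc k}. hat m j s * indicat_real {p j} x = 0"
    proof
      fix j assume "j \<in> {..m} - {k, Suc k}"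
      then have "j < k \<or> Suc k < j" by auto
      then have "real j + 1 \<le> real k \<or> real (Suc k) + 1 \<le> real j" by linarith
      then have "hat m j s = 0" unfolding hat_def using s by auto
      then show "hat m j s * indicat_real {p j} x = 0" by simp
    qed
  qed (use k in auto)
  moreover have "hat m k s = 1 - ?\<theta>" "hat m (Suc k) s = ?\<theta>" unfolding hat_def using s by auto
  moreover have "(\<Sum>j\<in>{k, Suc k}. hat m j s * indicat_real {p j} x)
      = hat m k s * indicat_real {p k} x + hat m (Suc k) s * indicat_real {p (Suc k)} x"
  proof -
    have "(\<Sum>j\<in>{k, Suc k}. g j) = g k + g (Suc k)" for g :: "nat \<Rightarrow> real" by simp
    then show ?thesis .
  qed
  ultimately show "walk_path m p s x = edge_point (p k) (p (Suc k)) ?\<theta> x"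
    unfolding walk_path_def edge_point_def by (simp only:)
qed

lemma edge_point_0: "edge_point u v 0 = indicat_real {u}" and edge_point_1: "edge_point u v 1 = indicat_real {v}"
  by (simp_all add: edge_point_def fun_eq_iff)

lemma walk_path_node:
  assumes k: "k \<le> m" "0 < m"
  shows "walk_path m p (real k / real m) = indicat_real {p k}"
proof (cases "k = m")
  case False
  then show ?thesis using walk_path_edge[of k m "real k / real m" p] k edge_point_0 by simp
next
  case True
  obtain j where j: "m = Suc j" using k by (cases m) auto
  then show ?thesis using walk_path_edge[of j m "real k / real m" p] True edge_point_1 by simp
qed

lemma edge_point_pos: "0 \<le> t \<Longrightarrow> t < 1 \<Longrightarrow> 0 < edge_point u v t u"
  by (simp add: edge_point_def indicator_def)

lemma walk_path_in_realization:
  assumes K: "cubical_complex K" and p: "\<And>k. k < m \<Longrightarrow> adjacent K (p k) (p (Suc k))"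
    and m: "0 < m" and s: "0 \<le> s" "s \<le> 1"
  shows "walk_path m p s \<in> realization K"
proof -
  \<comment> \<open>\<open>k\<close> is the edge on which time \<open>s\<close> falls. At
    \<open>s = 1\<close> the floor would give \<open>m\<close>, one past the last edge.\<close>
  define k where "k = (if s = 1 then m - 1 else nat \<lfloor>real m * s\<rfloor>)"
  have ms: "0 \<le> real m * s" using s by simp
  have *: "k < m \<and> real k \<le> real m * s \<and> real m * s \<le> real (Suc k)"
  proof (cases "s = 1")
    case True
    then show ?thesis using m by (auto simp: k_def)
  next
    case False
    then have "real m * s < real m" using m s by simp
    moreover have fl: "real k \<le> real m * s" "real m * s < real k + 1" using ms False unfolding k_def by auto
    ultimately show ?thesis by auto
  qed
  then show ?thesis
    using walk_path_edge[of k m s p] edge_point_in_realization[OF K p, of k "real m * s - real k"] by auto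
qed

section \<open>Monodromy of a local system around closed walks\<close>

context local_system
begin

text \<open>Vertices in whose open stars one point lies share a cube, where \<open>ext\<close> is
  path independent. This permits passing between overlapping open stars.\<close>

lemma ext_point:
  assumes f: "f \<in> realization K" "0 < f u" "0 < f v" "0 < f w" and x: "x \<in> fib u"
  shows "ext v w (ext u v x) = ext u w x"
proof -
  obtain Q where Q: "Q \<in> K" "\<forall>v. 0 < f v \<longrightarrow> v \<in> Q" using f(1) by (rule realization_common_cube)
  show ?thesis using ext_cocycle[OF Q(1) Q(2)[rule_format, OF f(2)] Q(2)[rule_format, OF f(3)] Q(2)[rule_format, OF f(4)] x] .
qed

lemma ext_point_fib:
  assumes f: "f \<in> realization K" "0 < f u" "0 < f v" and x: "x \<in> fib u"
  shows "ext u v x \<in> fib v"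
proof -
  obtain Q where Q: "Q \<in> K" "\<forall>v. 0 < f v \<longrightarrow> v \<in> Q" using f(1) by (rule realization_common_cube)
  show ?thesis using ext_fib[OF Q(1) Q(2)[rule_format, OF f(2)] Q(2)[rule_format, OF f(3)] x] .
qed

lemma ext_point_back:
  assumes f: "f \<in> realization K" "0 < f u" "0 < f v" and x: "x \<in> fib u" and u: "u \<in> vertices K"
  shows "ext v u (ext u v x) = x"
  using ext_point[OF f(1,2,3,2) x] ext_refl[OF u x] by simp

text \<open>Discrete monodromy: \<open>q i j\<close> are the corners of a subdivision of a homotopy from a loop (\<open>i = 0\<close>)
  to a constant loop (\<open>i = Suc L\<close>), and the open star of \<open>w i j\<close> contains the image of the cell \<open>(i, j)\<close>.\<close>

lemma grid_monodromy:
  assumes q: "\<And>i j. i \<le> Suc L \<Longrightarrow> j \<le> Suc L \<Longrightarrow> q i j \<in> realization K"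
    and wV: "\<And>i j. i \<le> L \<Longrightarrow> j \<le> L \<Longrightarrow> w i j \<in> vertices K"
    and w: "\<And>i j. i \<le> L \<Longrightarrow> j \<le> L \<Longrightarrow> 0 < q i j (w i j) \<and> 0 < q (Suc i) j (w i j) \<and>
              0 < q i (Suc j) (w i j) \<and> 0 < q (Suc i) (Suc j) (w i j)"
    and loop: "\<And>i. i \<le> Suc L \<Longrightarrow> q i (Suc L) = q i 0"
    and const: "\<And>j. j \<le> Suc L \<Longrightarrow> q (Suc L) j = q (Suc L) 0"
    and Y0: "\<And>j. j \<le> L \<Longrightarrow> Y j \<in> fib (w 0 j)"
    and Y: "\<And>j. j < L \<Longrightarrow> Y (Suc j) = ext (w 0 j) (w 0 (Suc j)) (Y j)"
  shows "ext (w 0 L) (w 0 0) (Y L) = Y 0"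
proof -
  \<comment> \<open>\<open>X i j\<close> is \<open>Y j\<close> carried along column \<open>j\<close>
    from row \<open>0\<close> to row \<open>i\<close>.\<close>
  define X where "X i j = rec_nat (Y j) (\<lambda>i y. ext (w i j) (w (Suc i) j) y) i" for i j
  have X0: "X 0 j = Y j" and XS: "X (Suc i) j = ext (w i j) (w (Suc i) j) (X i j)" for i j
    by (simp_all add: X_def)
  have Xf: "X i j \<in> fib (w i j)" if "i \<le> L" "j \<le> L" for i j
    using that
  proof (induction i)
    case (Suc i)
    then have "X i j \<in> fib (w i j)" by simp
    then show ?case unfolding XS
      using ext_point_fib[OF q[of "Suc i" j]] w[of i j] w[of "Suc i" j] Suc.prems by simp
  qed (use Y0 X0 in simp)
  \<comment> \<open>Rows stay compatible because the cells \<open>(i, j)\<close>,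
    \<open>(i + 1, j)\<close>, \<open>(i, j + 1)\<close> and \<open>(i + 1, j + 1)\<close> share the
    corner \<open>q (Suc i) (Suc j)\<close>.\<close>
  have Xh: "X i (Suc j) = ext (w i j) (w i (Suc j)) (X i j)" if "i \<le> L" "j < L" for i j
    using that
  proof (induction i)
    case (Suc i)
    let ?f = "q (Suc i) (Suc j)"
    have f: "?f \<in> realization K" "0 < ?f (w i j)" "0 < ?f (w (Suc i) j)" "0 < ?f (w i (Suc j))" "0 < ?f (w (Suc i) (Suc j))"
      using q[of "Suc i" "Suc j"] w[of i j] w[of "Suc i" j] w[of i "Suc j"] w[of "Suc i" "Suc j"] Suc.prems by simp_all
    have x: "X i j \<in> fib (w i j)" using Xf Suc.prems by simp
    have "X (Suc i) (Suc j) = ext (w i (Suc j)) (w (Suc i) (Suc j)) (ext (w i j) (w i (Suc j)) (X i j))"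
      unfolding XS using Suc by simp
    also have "\<dots> = ext (w i j) (w (Suc i) (Suc j)) (X i j)" using ext_point[OF f(1,2,4,5) x] .
    also have "\<dots> = ext (w (Suc i) j) (w (Suc i) (Suc j)) (X (Suc i) j)"
      unfolding XS using ext_point[OF f(1,2,3,5) x] by simp
    finally show ?case .
  qed (use Y X0 in simp)
  have top: "X L j = ext (w L 0) (w L j) (X L 0)" if "j \<le> L" for j
    using that
  proof (induction j)
    case 0
    show ?case using ext_refl[OF wV[of L 0] Xf[of L 0]] by simp
  next
    case (Suc j)
    let ?f = "q (Suc L) 0"
    have f: "?f \<in> realization K" "0 < ?f (w L 0)" "0 < ?f (w L j)" "0 < ?f (w L (Suc j))"
      using q[of "Suc L" 0] w[of L 0] w[of L j] w[of L "Suc j"] const[of j] const[of "Suc j"] Suc.prems by auto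
    have "X L (Suc j) = ext (w L j) (w L (Suc j)) (ext (w L 0) (w L j) (X L 0))" using Xh[of L j] Suc by simp
    then show ?case using ext_point[OF f Xf[of L 0]] by simp
  qed
  \<comment> \<open>Row \<open>L\<close> borders the constant loop, so all its open stars share a
    point and \<open>top\<close> gives the claim there. It then descends row by row: since the loops
    close up, the first and last cells of the rows \<open>i\<close> and \<open>i + 1\<close> all
    have the point \<open>q (Suc i) 0\<close> in common.\<close>
  have "ext (w (L - k) L) (w (L - k) 0) (X (L - k) L) = X (L - k) 0" if "k \<le> L" for k
    using that
  proof (induction k)
    case 0
    let ?f = "q (Suc L) 0"
    have f: "?f \<in> realization K" "0 < ?f (w L 0)" "0 < ?f (w L L)"
      using q[of "Suc L" 0] w[of L 0] w[of L L] const[of L] by auto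
    show ?case using ext_point_back[OF f Xf[of L 0] wV[of L 0]] top[of L] by simp
  next
    case (Suc k)
    define i where "i = L - Suc k"
    have i: "L - k = Suc i" "Suc i \<le> L" using Suc.prems unfolding i_def by auto
    let ?f = "q (Suc i) 0"
    have f: "?f \<in> realization K" "0 < ?f (w i 0)" "0 < ?f (w i L)" "0 < ?f (w (Suc i) 0)" "0 < ?f (w (Suc i) L)"
      using q[of "Suc i" 0] w[of i 0] w[of i L] w[of "Suc i" 0] w[of "Suc i" L] loop[of "Suc i"] i(2) by auto
    have x: "X i 0 \<in> fib (w i 0)" "X i L \<in> fib (w i L)" using Xf i(2) by simp_all
    have "ext (w (Suc i) L) (w (Suc i) 0) (X (Suc i) L) = X (Suc i) 0" using Suc i by simp
    then have 1: "ext (w i L) (w (Suc i) 0) (X i L) = ext (w i 0) (w (Suc i) 0) (X i 0)"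
      unfolding XS using ext_point[OF f(1,3,5,4) x(2)] by simp
    have "ext (w i L) (w i 0) (X i L) = ext (w (Suc i) 0) (w i 0) (ext (w i L) (w (Suc i) 0) (X i L))"
      using ext_point[OF f(1,3,4,2) x(2)] by simp
    also have "\<dots> = X i 0"
      unfolding 1 using ext_point_back[OF f(1,2,4) x(1) wV[of i 0]] i(2) by simp
    finally show ?case unfolding i_def .
  qed
  from this[of L] show ?thesis by (simp add: X0)
qed

text \<open>Lebesgue number lemma for the preimages of the open stars. The mesh is
  \<open>1 / (m * M)\<close> and not just \<open>1 / M\<close>, so that the nodes
  \<open>k / m\<close> of a walk with \<open>m\<close> edges become grid points.\<close>

lemma subdivision:
  fixes h :: "real \<times> real \<Rightarrow> 'v \<Rightarrow> real"
  assumes h: "continuous_on ({0..1} \<times> {0..1}) h" "h ` ({0..1} \<times> {0..1}) \<subseteq> realization K" and m: "0 < m"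
  obtains M where "0 < M" "\<And>i j. i < m * M \<Longrightarrow> j < m * M \<Longrightarrow> \<exists>v\<in>vertices K.
    \<forall>x\<in>{real i / real (m * M)..real (Suc i) / real (m * M)}. \<forall>y\<in>{real j / real (m * M)..real (Suc j) / real (m * M)}.
      0 < h (x, y) v"
proof -
  let ?S = "{0..1} \<times> {0..1} :: (real \<times> real) set"
  have "\<exists>A. open A \<and> A \<inter> ?S = h -` {f. 0 < f v} \<inter> ?S" for v
    using h(1) open_star[of v] unfolding continuous_on_open_invariant by blast
  then obtain A where A: "\<And>v. open (A v)" "\<And>v. A v \<inter> ?S = h -` {f. 0 < f v} \<inter> ?S" by metis
  have cov: "?S \<subseteq> \<Union>(A ` vertices K)"
  proof
    fix z assume z: "z \<in> ?S"
    then have "h z \<in> realization K" using h(2) by blast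
    then obtain v where v: "v \<in> vertices K" "0 < h z v" using realization_pos_ex by blast
    then have "z \<in> A v \<inter> ?S" using z A(2)[of v] by simp
    then show "z \<in> \<Union>(A ` vertices K)" using v(1) by blast
  qed
  moreover have "(0, 0) \<in> ?S" by simp
  ultimately have "A ` vertices K \<noteq> {}" by blast
  moreover have "compact ?S" by (intro compact_Times compact_Icc)
  ultimately obtain \<delta> where \<delta>: "0 < \<delta>" "\<And>T. T \<subseteq> ?S \<Longrightarrow> diameter T < \<delta> \<Longrightarrow> \<exists>B\<in>A ` vertices K. T \<subseteq> B"
    using Lebesgue_number_lemma[OF _ _ cov] A(1) by (metis (no_types, lifting) imageE)
  obtain M :: nat where M: "2 / \<delta> < real M" using reals_Archimedean2 by blast
  have M0: "0 < M" using M \<delta>(1) by (metis divide_pos_pos less_trans of_nat_0_less_iff zero_less_numeral)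
  let ?N = "real (m * M)"
  have N: "0 < ?N" using M0 m by simp
  have "real M \<le> ?N" using m by (cases m) auto
  then have "2 / \<delta> < ?N" using M by linarith
  then have N\<delta>: "2 / ?N < \<delta>" using \<delta>(1) N by (simp add: field_simps)
  show ?thesis
  proof (rule that[OF M0])
    fix i j assume ij: "i < m * M" "j < m * M"
    let ?I = "{real i / ?N..real (Suc i) / ?N}" and ?J = "{real j / ?N..real (Suc j) / ?N}"
    have len: "\<bar>x - x'\<bar> \<le> 1 / ?N" if "x \<in> {real k / ?N..real (Suc k) / ?N}" "x' \<in> {real k / ?N..real (Suc k) / ?N}" for x x' k
    proof -
      have "real (Suc k) / ?N = real k / ?N + 1 / ?N" by (simp add: add_divide_distrib)
      then show ?thesis using that by auto
    qed
    have sub01: "{real k / ?N..real (Suc k) / ?N} \<subseteq> {0..1}" if "k < m * M" for k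
    proof -
      have "real (Suc k) \<le> ?N" using that by linarith
      then have "real (Suc k) / ?N \<le> 1" using N by simp
      then show ?thesis using N by auto
    qed
    have sub: "?I \<times> ?J \<subseteq> ?S" using sub01[OF ij(1)] sub01[OF ij(2)] by blast
    have "diameter (?I \<times> ?J) \<le> 2 / ?N"
    proof (rule diameter_le)
      fix z z' assume z: "z \<in> ?I \<times> ?J" "z' \<in> ?I \<times> ?J"
      have "norm (z - z') \<le> norm (fst z - fst z') + norm (snd z - snd z')"
        using norm_Pair_le[of "fst z - fst z'" "snd z - snd z'"] by (simp add: minus_prod_def)
      also have "\<dots> \<le> 1 / ?N + 1 / ?N"
        using len[of "fst z" i "fst z'"] len[of "snd z" j "snd z'"] z
        unfolding mem_Times_iff real_norm_def by (intro add_mono) blast+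
      finally show "norm (z - z') \<le> 2 / ?N" by (simp add: mult.commute)
    qed (use N in simp)
    then have "diameter (?I \<times> ?J) < \<delta>" using N\<delta> by linarith
    then obtain v where v: "v \<in> vertices K" "?I \<times> ?J \<subseteq> A v" using \<delta>(2)[OF sub] by blast
    have "0 < h (x, y) v" if "x \<in> ?I" "y \<in> ?J" for x y
    proof -
      have "(x, y) \<in> A v \<inter> ?S" using v(2) sub that by blast
      then show ?thesis using A(2)[of v] by simp
    qed
    then show "\<exists>v\<in>vertices K. \<forall>x\<in>?I. \<forall>y\<in>?J. 0 < h (x, y) v" using v(1) by blast
  qed
qed

text \<open>Contract the walk in the realization and apply \<open>grid_monodromy\<close> to a fine
  subdivision of the homotopy. Row \<open>0\<close> runs along the walk itself, with
  \<open>M\<close> cells for each edge, so the values \<open>Z k\<close> can be handed over to the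
  cells of that row.\<close>

lemma closed_walk_monodromy:
  assumes sc: "simply_connected (realization K)"
    and p: "\<And>k. k < m \<Longrightarrow> adjacent K (p k) (p (Suc k))" and pm: "p m = p 0"
    and Z0: "Z 0 \<in> fib (p 0)" and Z: "\<And>k. k < m \<Longrightarrow> Z (Suc k) = tr (p k) (p (Suc k)) (Z k)"
  shows "Z m = Z 0"
proof (cases "m = 0")
  case False
  then have m: "0 < m" by simp
  have pV: "p k \<in> vertices K" if "k \<le> m" for k
  proof (cases "k = m")
    case True
    then show ?thesis using adjacent_vertices[OF p[OF m]] pm by simp
  next
    case False
    then show ?thesis using adjacent_vertices[OF p[of k]] that by simp
  qed
  have Zf: "Z k \<in> fib (p k)" if "k \<le> m" for k
    using that
  proof (induction k)
    case (Suc k)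
    then show ?case using tr_fib[OF p[of k]] Z[of k] by simp
  qed (use Z0 in simp)
  let ?P = "walk_path m p" and ?c = "indicat_real {p 0}"
  have P0: "?P 0 = ?c" using walk_path_node[of 0 m p] m by simp
  have P1: "?P 1 = ?c" using walk_path_node[of m m p] m pm by simp
  have cK: "?c \<in> realization K" using vertex_in_realization[OF cubical pV[of 0]] by simp
  have "path ?P" unfolding path_def by (rule continuous_walk_path)
  moreover have "path_image ?P \<subseteq> realization K"
    unfolding path_image_def by (auto intro!: walk_path_in_realization[OF cubical _ m] p)
  moreover have "pathfinish ?P = pathstart ?P" unfolding pathfinish_def pathstart_def P0 P1 ..
  moreover have "path (\<lambda>_::real. ?c)" "path_image (\<lambda>_::real. ?c) \<subseteq> realization K"
    "pathfinish (\<lambda>_::real. ?c) = pathstart (\<lambda>_. ?c)"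
    using cK by (auto simp: path_def path_image_def pathfinish_def pathstart_def)
  \<comment> \<open>This homotopy is free: its base point may move, and only the closing up of each
    intermediate loop is available.\<close>
  ultimately have "homotopic_loops (realization K) ?P (\<lambda>_. ?c)"
    using sc unfolding simply_connected_def by simp
  then obtain h where h: "continuous_on ({0..1::real} \<times> {0..1::real}) h"
      "h \<in> ({0..1} \<times> {0..1}) \<rightarrow> realization K" "\<forall>x\<in>{0..1}. h (0, x) = ?P x" "\<forall>x\<in>{0..1}. h (1, x) = ?c"
      "\<forall>t\<in>{0..1}. pathfinish (h \<circ> Pair t) = pathstart (h \<circ> Pair t)"
    unfolding homotopic_loops by (elim exE conjE)
  have hK: "h ` ({0..1} \<times> {0..1}) \<subseteq> realization K" using h(2) by blast
  obtain M where M: "0 < M" "\<And>i j. i < m * M \<Longrightarrow> j < m * M \<Longrightarrow> \<exists>v\<in>vertices K.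
    \<forall>x\<in>{real i / real (m * M)..real (Suc i) / real (m * M)}. \<forall>y\<in>{real j / real (m * M)..real (Suc j) / real (m * M)}.
      0 < h (x, y) v"
    using subdivision[OF h(1) hK m] by blast
  define N where "N = m * M"
  define L where "L = N - 1"
  have N: "0 < N" "N = Suc L" using M(1) m unfolding N_def L_def by auto
  define C where "C i j v \<longleftrightarrow> v \<in> vertices K \<and> (\<forall>x\<in>{real i / real N..real (Suc i) / real N}.
      \<forall>y\<in>{real j / real N..real (Suc j) / real N}. 0 < h (x, y) v)" for i j v
  have exC: "\<exists>v. C i j v" if "i \<le> L" "j \<le> L" for i j
    using M(2)[of i j] that N unfolding N_def[symmetric] C_def by auto
  define w where "w i j = (SOME v. C i j v)" for i j
  have C: "C i j (w i j)" if "i \<le> L" "j \<le> L" for i j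
    unfolding w_def by (rule someI_ex) (rule exC[OF that])
  define q where "q i j = h (real i / real N, real j / real N)" for i j
  have unit: "real i / real N \<in> {0..1}" if "i \<le> Suc L" for i using that N by simp
  have NN: "real (Suc L) / real N = 1" using N by simp
  have step: "real i / real N \<le> real (Suc i) / real N" for i using N(1) by (simp add: divide_right_mono)
  have w: "0 < q i j (w i j) \<and> 0 < q (Suc i) j (w i j) \<and> 0 < q i (Suc j) (w i j) \<and> 0 < q (Suc i) (Suc j) (w i j)"
    and wV: "w i j \<in> vertices K" if "i \<le> L" "j \<le> L" for i j
    using C[OF that] step[of i] step[of j] unfolding C_def q_def by auto
  have qK: "q i j \<in> realization K" if "i \<le> Suc L" "j \<le> Suc L" for i j
    unfolding q_def using hK unit that by blast
  have loop: "q i (Suc L) = q i 0" if "i \<le> Suc L" for i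
    using h(5)[rule_format, OF unit[OF that]] NN unfolding q_def pathfinish_def pathstart_def by simp
  have const: "q (Suc L) j = q (Suc L) 0" if "j \<le> Suc L" for j
    unfolding q_def NN using h(4) unit[OF that] by simp
  have q0: "q 0 j = ?P (real j / real N)" if "j \<le> Suc L" for j
    unfolding q_def using h(3) unit[OF that] by simp
  have mN: "real m * (real j / real N) = real j / real M" for j
    using m M(1) unfolding N_def by simp
  have qpos: "0 < q 0 j (p (j div M))" if "j \<le> L" for j
  proof -
    let ?k = "j div M" and ?s = "real j / real N"
    have "j < m * M" using that N unfolding N_def by simp
    then have k: "?k < m" by (simp add: less_mult_imp_div_less)
    have "?k * M \<le> j" "j < Suc ?k * M" using M(1) by (simp_all add: dividend_less_div_times)
    then have "real ?k * real M \<le> real j" "real j < real (Suc ?k) * real M"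
      by (metis of_nat_le_iff of_nat_mult) (metis \<open>j < Suc ?k * M\<close> of_nat_less_iff of_nat_mult)
    then have b: "real ?k \<le> real m * ?s" "real m * ?s < real (Suc ?k)"
      unfolding mN using M(1) by (simp_all add: field_simps)
    then have "?P ?s = edge_point (p ?k) (p (Suc ?k)) (real m * ?s - real ?k)"
      by (intro walk_path_edge[OF k] less_imp_le[OF b(2)] b(1))
    then show ?thesis using q0[of j] that b edge_point_pos[of "real m * ?s - real ?k"] by simp
  qed
  have qnode: "q 0 (k * M) = indicat_real {p k}" if "k \<le> m" for k
  proof -
    have "k * M \<le> Suc L" using that N unfolding N_def by (metis mult_le_mono1)
    moreover have "real (k * M) / real N = real k / real m" using M(1) unfolding N_def by simp
    ultimately show ?thesis using q0[of "k * M"] walk_path_node[OF that m] by simp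
  qed
  \<comment> \<open>At a vertex of the complex no other coordinate is positive. Hence the two cells
    that meet at the node \<open>p k\<close> are both forced to use \<open>p k\<close>, and there
    \<open>Z k\<close> can be exchanged for \<open>Z (Suc k)\<close>.\<close>
  have node: "v = p k" if "k \<le> m" "0 < q 0 (k * M) v" for k v
    using that(2) unfolding qnode[OF that(1)] by (auto simp: indicator_def split: if_splits)
  define Y where "Y j = ext (p (j div M)) (w 0 j) (Z (j div M))" for j
  have divm: "j div M < m" if "j \<le> L" for j
    using that N unfolding N_def by (intro less_mult_imp_div_less) simp
  have extZ: "ext (p k) (p (Suc k)) (Z k) = Z (Suc k)" if "k < m" for k
    using ext_adjacent[OF p[OF that] Zf] Z[OF that] that by simp
  have "ext (w 0 L) (w 0 0) (Y L) = Y 0"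
  proof (rule grid_monodromy[OF qK wV w loop const])
    show "Y j \<in> fib (w 0 j)" if j: "j \<le> L" for j
      unfolding Y_def using ext_point_fib[OF qK[of 0 j] qpos[OF j] _ Zf] w[of 0 j] divm[OF j] j by simp
    show "Y (Suc j) = ext (w 0 j) (w 0 (Suc j)) (Y j)" if j: "j < L" for j
    proof (cases "Suc j div M = j div M")
      case True
      have "0 < q 0 (Suc j) (p (j div M))" using qpos[of "Suc j"] j True by simp
      then show ?thesis unfolding Y_def True
        using ext_point[OF qK[of 0 "Suc j"] _ _ _ Zf[of "j div M"], of "w 0 j" "w 0 (Suc j)"]
          w[of 0 j] w[of 0 "Suc j"] divm[of j] j by simp
    next
      case False
      let ?k = "j div M"
      have "Suc j mod M = 0" "Suc j div M = Suc ?k" using False by (auto simp: div_Suc split: if_splits)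
      then have Sj: "Suc j = Suc ?k * M" by (metis add.right_neutral div_mult_mod_eq)
      have k: "Suc ?k \<le> m" using divm[of j] j by simp
      have "w 0 j = p (Suc ?k)" "w 0 (Suc j) = p (Suc ?k)"
        using node[OF k, folded Sj] w[of 0 j] w[of 0 "Suc j"] j by simp_all
      then show ?thesis unfolding Y_def using extZ[of ?k] k \<open>Suc j div M = Suc ?k\<close> by simp
    qed
  qed
  moreover have w00: "w 0 0 = p 0" using node[of 0 "w 0 0"] w[of 0 0] by simp
  moreover have "w 0 L = p m" using node[of m "w 0 L"] w[of 0 L] N unfolding N_def by simp
  \<comment> \<open>The last cell lies on the edge number \<open>m - 1\<close> and uses its endpoint
    \<open>p m\<close>, so \<open>Y L\<close> is \<open>Z (m - 1)\<close> carried over that last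
    edge.\<close>
  moreover have "Y L = Z m"
  proof -
    have "L div M < m" using divm[of L] by simp
    moreover have "m - 1 \<le> L div M"
    proof -
      have "(m - 1) * M \<le> L"
        using N M(1) m unfolding N_def by (cases m) auto
      then show ?thesis using M(1) by (metis div_le_mono nonzero_mult_div_cancel_right less_numeral_extra(3))
    qed
    ultimately have "Suc (L div M) = m" by linarith
    then show ?thesis unfolding Y_def \<open>w 0 L = p m\<close> using extZ[of "L div M"] by simp
  qed
  moreover have "Y 0 = Z 0" unfolding Y_def using w00 ext_refl[OF pV[of 0] Z0] by simp
  ultimately show ?thesis using ext_refl[OF pV[of m] Zf[of m]] pm by simp
qed simp

section \<open>Lifting walks to the total space, and global sections\<close>

definition lift_step :: "'v \<times> 's \<Rightarrow> 'v \<times> 's \<Rightarrow> bool" where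
  "lift_step a b \<longleftrightarrow> adjacent K (fst a) (fst b) \<and> snd a \<in> fib (fst a) \<and> snd b = tr (fst a) (fst b) (snd a)"

lemma lift_step_sym: "lift_step a b \<Longrightarrow> lift_step b a"
  unfolding lift_step_def using adjacent_sym tr_fib tr_inv by metis

lemma lift_steps_sym: "lift_step\<^sup>*\<^sup>* a b \<Longrightarrow> lift_step\<^sup>*\<^sup>* b a"
  by (induction rule: rtranclp_induct) (auto intro: converse_rtranclp_into_rtranclp lift_step_sym)

lemma lift_steps_fib: "lift_step\<^sup>*\<^sup>* a b \<Longrightarrow> snd a \<in> fib (fst a) \<Longrightarrow> snd b \<in> fib (fst b)"
  by (induction rule: rtranclp_induct) (auto simp: lift_step_def intro: tr_fib)

lemma lift_steps_closed:
  assumes sc: "simply_connected (realization K)" and "lift_step\<^sup>*\<^sup>* (v, x) (v, y)"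
  shows "x = y"
proof -
  obtain m where "(lift_step ^^ m) (v, x) (v, y)" using assms(2) rtranclp_imp_relpowp by metis
  then obtain f where f: "f 0 = (v, x)" "f m = (v, y)" "\<And>i. i < m \<Longrightarrow> lift_step (f i) (f (Suc i))"
    unfolding relpowp_fun_conv by auto
  show ?thesis
  proof (cases "m = 0")
    case False
    then have "lift_step (f 0) (f (Suc 0))" using f(3) by simp
    then have "snd (f 0) \<in> fib (fst (f 0))" unfolding lift_step_def by simp
    then have "snd (f m) = snd (f 0)"
      using closed_walk_monodromy[OF sc, of m "\<lambda>i. fst (f i)" "\<lambda>i. snd (f i)"] f
      unfolding lift_step_def by simp
    then show ?thesis using f(1,2) by simp
  qed (use f in simp)
qed

text \<open>\<open>simply_connected\<close> makes any two loops freely homotopic, in particular two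
  constant ones, and the track of the base point is a connected set containing both vertices. The
  open stars of the vertices reachable from \<open>a\<close> and those of the others are disjoint on
  the realization, since two vertices of one cube are joined by edges.\<close>

lemma skeleton_connected:
  assumes sc: "simply_connected (realization K)" and ab: "a \<in> vertices K" "b \<in> vertices K"
  shows "(adjacent K)\<^sup>*\<^sup>* a b"
proof -
  let ?a = "indicat_real {a}" and ?b = "indicat_real {b}"
  have K: "?a \<in> realization K" "?b \<in> realization K"
    using vertex_in_realization[OF cubical ab(1)] vertex_in_realization[OF cubical ab(2)] .
  have "homotopic_loops (realization K) (\<lambda>_. ?a) (\<lambda>_. ?b)"
    using sc[unfolded simply_connected_def, rule_format, of "\<lambda>_. ?a" "\<lambda>_. ?b"] K
    by (simp add: path_def path_image_def pathfinish_def pathstart_def image_subset_iff)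
  then obtain h where h: "continuous_on ({0..1::real} \<times> {0..1::real}) h"
      "h \<in> ({0..1} \<times> {0..1}) \<rightarrow> realization K" "\<forall>x\<in>{0..1}. h (0, x) = ?a" "\<forall>x\<in>{0..1}. h (1, x) = ?b"
    unfolding homotopic_loops by (elim exE conjE)
  define S where "S = (\<lambda>t. h (t, 0)) ` {0..1}"
  have "continuous_on {0..1} (\<lambda>t. h (t, 0))"
    by (rule continuous_on_compose2[OF h(1)]) (auto intro!: continuous_intros)
  then have "connected S" unfolding S_def by (rule connected_continuous_image) (rule connected_Icc)
  have SK: "S \<subseteq> realization K" using h(2) unfolding S_def by auto
  define R where "R = {v. (adjacent K)\<^sup>*\<^sup>* a v}"
  define A where "A = (\<Union>v\<in>R. {f :: 'v \<Rightarrow> real. 0 < f v})"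
  define B where "B = (\<Union>v\<in>- R. {f :: 'v \<Rightarrow> real. 0 < f v})"
  have "open A" "open B" unfolding A_def B_def by (intro open_UN ballI open_star)+
  moreover have "S \<subseteq> A \<union> B"
  proof
    fix f assume "f \<in> S"
    then obtain v where "0 < f v" using SK realization_pos_ex by blast
    then show "f \<in> A \<union> B" unfolding A_def B_def by blast
  qed
  moreover have "A \<inter> B \<inter> S = {}"
  proof (rule ccontr)
    assume "A \<inter> B \<inter> S \<noteq> {}"
    then obtain f u v where f: "f \<in> realization K" "u \<in> R" "v \<notin> R" "0 < f u" "0 < f v"
      using SK unfolding A_def B_def by blast
    obtain Q where Q: "Q \<in> K" "\<forall>v. 0 < f v \<longrightarrow> v \<in> Q" using f(1) by (rule realization_common_cube)
    have "(\<lambda>x y. adjacent K x y \<and> x \<in> Q \<and> y \<in> Q)\<^sup>*\<^sup>* u v"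
      using cube_connected[OF cubical Q(1)] Q(2) f(4,5) by blast
    then have "(adjacent K)\<^sup>*\<^sup>* u v" by (rule rtranclp_mono[THEN predicate2D, rotated]) blast
    then show False using f(2,3) unfolding R_def by (auto intro: rtranclp_trans)
  qed
  ultimately have "A \<inter> S = {} \<or> B \<inter> S = {}" using connectedD[OF \<open>connected S\<close>] by blast
  moreover have "?a \<in> A \<inter> S"
    unfolding A_def S_def R_def using h(3) by (auto intro!: image_eqI[of _ _ 0] bexI[of _ a])
  moreover have "?b \<in> S" unfolding S_def using h(4) by (auto intro!: image_eqI[of _ _ 1])
  ultimately have "?b \<notin> B" by blast
  then have "b \<in> R" unfolding B_def by (auto simp: indicator_def)
  then show ?thesis unfolding R_def by simp
qed

text \<open>The component of \<open>(r, x)\<close> in the total space meets each fibre exactly once: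
  at least once because the skeleton is connected, at most once because the monodromy is
  trivial.\<close>

theorem global_section:
  assumes sc: "simply_connected (realization K)" and r: "r \<in> vertices K" "x \<in> fib r"
  shows "\<exists>s. s r = x \<and> (\<forall>v\<in>vertices K. s v \<in> fib v) \<and> (\<forall>u v. adjacent K u v \<longrightarrow> tr u v (s u) = s v)"
proof -
  have fibs: "y \<in> fib v" if "lift_step\<^sup>*\<^sup>* (r, x) (v, y)" for v y
    using lift_steps_fib[OF that] r(2) by simp
  have ex: "\<exists>y. lift_step\<^sup>*\<^sup>* (r, x) (v, y)" if v: "v \<in> vertices K" for v
    using skeleton_connected[OF sc r(1) v]
  proof (induction rule: rtranclp_induct)
    case (step u v)
    then obtain y where y: "lift_step\<^sup>*\<^sup>* (r, x) (u, y)" by blast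
    have "lift_step (u, y) (v, tr u v y)" unfolding lift_step_def using step(2) fibs[OF y] by simp
    with y show ?case by (blast intro: rtranclp.rtrancl_into_rtrancl)
  qed blast
  have un: "y = z" if "lift_step\<^sup>*\<^sup>* (r, x) (v, y)" "lift_step\<^sup>*\<^sup>* (r, x) (v, z)" for v y z
    using lift_steps_closed[OF sc rtranclp_trans[OF lift_steps_sym[OF that(1)] that(2)]] .
  define s where "s v = (SOME y. lift_step\<^sup>*\<^sup>* (r, x) (v, y))" for v
  have s: "lift_step\<^sup>*\<^sup>* (r, x) (v, s v)" if "v \<in> vertices K" for v
    unfolding s_def using ex[OF that] by (rule someI_ex)
  have "s r = x" using un[OF s[OF r(1)]] by blast
  moreover have "tr u v (s u) = s v" if a: "adjacent K u v" for u v
  proof -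
    have V: "u \<in> vertices K" "v \<in> vertices K" using adjacent_vertices[OF a] by simp_all
    have "lift_step (u, s u) (v, tr u v (s u))" unfolding lift_step_def using a fibs[OF s[OF V(1)]] by simp
    with s[OF V(1)] have "lift_step\<^sup>*\<^sup>* (r, x) (v, tr u v (s u))" by (rule rtranclp.rtrancl_into_rtrancl)
    then show ?thesis using un s[OF V(2)] by blast
  qed
  ultimately show ?thesis using fibs s by blast
qed

end

section \<open>Hyperplanes and half-spaces\<close>

lemma CAT0_flag_square_graph:
  assumes "CAT0_cube_complex K"
  shows "flag_square_graph (adjacent K) (square K) (vertices K)"
proof -
  have K: "cubical_complex K" and sc: "simply_connected (realization K)"
    and flag: "\<And>v. v \<in> vertices K \<Longrightarrow> flag_complex (link K v)"
    using assms unfolding CAT0_cube_complex_def by blast+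
  interpret square_graph "adjacent K" "square K"
  proof
    show "\<exists>x. square K x a v c \<and> square K y z a x \<and> square K y z' c x"
      if "square K b z y z'" "square K b z a v" "square K b z' c v" for b z y z' a v c
    proof -
      have "b \<in> vertices K" using adjacent_vertices[OF squareD(4)[OF that(1)]] by simp
      from flag_cube[OF K flag[OF this] that] show ?thesis .
    qed
    show "adjacent K b a" if "adjacent K a b" for a b using that by (rule adjacent_sym)
    show "square K b c d a" if "square K a b c d" for a b c d using that by (rule square_rot)
    show "square K a d c b" if "square K a b c d" for a b c d using that by (rule square_flip)
    show "adjacent K a b" if "square K a b c d" for a b c d using squareD(4)[OF that] .
    show "a \<noteq> c" if "square K a b c d" for a b c d using squareD(2)[OF that] .
    show "d = d'" if "square K a b c d" "square K a b c d'" for a b c d d' using square_unique[OF K that] .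
  qed
  show ?thesis
  proof
    show "a \<in> vertices K" if "adjacent K a b" for a b using adjacent_vertices[OF that] by simp
    fix r assume r: "r \<in> vertices K"
    interpret local_system K "states r" transport
    proof
      show "cubical_complex K" by (rule K)
      show "transport u v x \<in> states r v" if "adjacent K u v" "x \<in> states r u" for u v x
        using transport_in_states[OF that(2,1)] .
      show "transport v u (transport u v x) = x" if "adjacent K u v" "x \<in> states r u" for u v x
        using transport_inverse[OF that(2,1)] .
      show "transport b c (transport a b x) = transport d c (transport a d x)"
        if "square K a b c d" "x \<in> states r a" for a b c d x
        using transport_square[OF that(2,1)] .
    qed
    show "\<exists>s. s r = cls [r] \<and> (\<forall>v\<in>vertices K. s v \<in> states r v) \<and>
           (\<forall>u v. adjacent K u v \<longrightarrow> transport u v (s u) = s v)"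
      by (rule global_section[OF sc r state_origin])
  qed
qed

section \<open>Parallel edges, and how a side meets a cube\<close>

locale CAT0_complex =
  fixes K :: "'v set set"
  assumes CAT0: "CAT0_cube_complex K"
begin

sublocale flag_square_graph "adjacent K" "square K" "vertices K"
  using CAT0 by (rule CAT0_flag_square_graph)

lemma cubical: "cubical_complex K"
  using CAT0 unfolding CAT0_cube_complex_def by blast

text \<open>Two disjoint edges exhaust the four vertices of the square. This identifies
  \<open>e'\<close> in a chart and gives it the orientation induced by
  \<open>(a, b)\<close>.\<close>

lemma opposite_edgesE:
  assumes "opposite_edges K {a, b} e'"
  obtains a' b' where "e' = {a', b'}" "square K a b b' a'"
proof -
  have e: "{a, b} \<in> edges K" "e' \<in> edges K" "{a, b} \<inter> e' = {}"
    and "\<exists>Q\<in>K. card Q = 4 \<and> {a, b} \<subseteq> Q \<and> e' \<subseteq> Q"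
    using assms unfolding opposite_edges_def by simp_all
  then obtain Q where Q: "Q \<in> K" "card Q = 4" "{a, b} \<subseteq> Q" "e' \<subseteq> Q" by blast
  have ab: "adjacent K a b" using e(1) by (simp add: adjacent_def)
  have fin: "finite Q" using Q(2) by (metis card.infinite zero_neq_numeral)
  have c2: "card {a, b} = 2" "card e' = 2" using e(1,2) by (simp_all add: edges_def)
  have "card ({a, b} \<union> e') = 4"
    using card_Un_disjoint[OF _ _ e(3)] c2 finite_subset[OF Q(4) fin] by simp
  then have QU: "Q = {a, b} \<union> e'" using card_subset_eq[OF fin, of "{a, b} \<union> e'"] Q by auto
  have aQ: "a \<in> Q" using Q(3) by simp
  obtain n \<beta> where c: "cube_chart K Q n \<beta>" "\<beta> {} = a" using cube_chart_at[OF cubical Q(1) aQ] .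
  have "(2::nat) ^ n = 2 ^ 2" using cube_chart_card[OF c(1)] Q(2) by simp
  then have n: "n = 2" by (simp only: power_inject_exp)
  have "b \<in> {u \<in> Q. adjacent K (\<beta> {}) u}" using ab Q(3) c(2) by simp
  then obtain i where i: "i < n" "b = \<beta> {i}" unfolding cube_chart_neighbours[OF c(1)] by auto
  define j where "j = 1 - i"
  have j: "j < n" "i \<noteq> j" using i n unfolding j_def by (simp, presburger)
  have sq: "square K a b (\<beta> {i, j}) (\<beta> {j})"
    using cube_chart_square[OF c(1), of "{}" i j] i j c(2) by simp
  have ne: "\<beta> {i, j} \<notin> {a, b}" "\<beta> {j} \<notin> {a, b}"
    using squareD(1-3)[OF sq] adjacent_neq[OF squareD(5)[OF sq]] adjacent_neq[OF squareD(8)[OF sq]] by auto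
  have "\<beta> {i, j} \<in> Q" "\<beta> {j} \<in> Q" using cube_chart_in[OF c(1)] i j by simp_all
  then have sub: "{\<beta> {j}, \<beta> {i, j}} \<subseteq> e'" using QU ne by blast
  have "card {\<beta> {j}, \<beta> {i, j}} = 2" using adjacent_neq[OF squareD(6)[OF sq]] by simp
  then have "{\<beta> {j}, \<beta> {i, j}} = e'"
    using card_subset_eq[OF finite_subset[OF Q(4) fin] sub] c2(2) by simp
  then show ?thesis using that sq by blast
qed

lemma opposite_edgesI:
  assumes "square K a b b' a'" shows "opposite_edges K {a, b} {a', b'}"
proof -
  note s = squareD[OF assms]
  have "{a, b} \<in> edges K" "{a', b'} \<in> edges K"
    using s(4) adjacent_sym[OF s(6)] by (simp_all add: adjacent_def)
  moreover have "{a, b} \<inter> {a', b'} = {}" using s adjacent_neq[OF s(5)] adjacent_neq[OF s(8)] by auto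
  moreover have "card {a, b, b', a'} = 4" using square_card[OF assms] .
  ultimately show ?thesis unfolding opposite_edges_def using s(1) by blast
qed

lemma parallel_edgesE:
  assumes "parallel_edges K {a, b} e'"
  shows "\<exists>c d. e' = {c, d} \<and> opp\<^sup>*\<^sup>* (a, b) (c, d)"
  using assms unfolding parallel_edges_def
proof (induction rule: rtranclp_induct)
  case (step e e')
  then obtain c d where cd: "e = {c, d}" "opp\<^sup>*\<^sup>* (a, b) (c, d)" by blast
  have "opposite_edges K {c, d} e'" using step(2) cd(1) by simp
  then obtain a' b' where *: "e' = {a', b'}" "square K c d b' a'" by (rule opposite_edgesE)
  then have "opp\<^sup>*\<^sup>* (a, b) (a', b')" using cd(2) by (intro rtranclp.rtrancl_into_rtrancl[OF cd(2)]) simp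
  then show ?case using *(1) by blast
qed blast

lemma opp_parallel_edges: "opp\<^sup>*\<^sup>* e e' \<Longrightarrow> parallel_edges K {fst e, snd e} {fst e', snd e'}"
proof (induction rule: rtranclp_induct)
  case (step y z)
  have "opposite_edges K {fst y, snd y} {fst z, snd z}" using opposite_edgesI[OF step(2)] .
  then show ?case using step(3) unfolding parallel_edges_def by (rule rtranclp.rtrancl_into_rtrancl[rotated])
qed (simp add: parallel_edges_def)

text \<open>This turns the chain of squares in the definition of a hyperplane into a test on two
  vertices.\<close>

lemma parallel_edges_iff:
  assumes "adjacent K a b" "adjacent K c d"
  shows "parallel_edges K {a, b} {c, d} \<longleftrightarrow> (c \<in> side a b) \<noteq> (d \<in> side a b)"
proof
  assume "parallel_edges K {a, b} {c, d}"
  then obtain c' d' where *: "{c, d} = {c', d'}" "opp\<^sup>*\<^sup>* (a, b) (c', d')" using parallel_edgesE by blast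
  have "side a b = side c' d'" using side_parallel[OF *(2)] by simp
  moreover have "adjacent K c' d'" using *(1) assms(2) by (simp add: adjacent_def)
  ultimately have "c' \<in> side a b" "d' \<notin> side a b" using side_ends[of c' d'] by auto
  then show "(c \<in> side a b) \<noteq> (d \<in> side a b)" using *(1) by (auto simp: doubleton_eq_iff)
next
  assume "(c \<in> side a b) \<noteq> (d \<in> side a b)"
  then consider "c \<in> side a b" "d \<notin> side a b" | "d \<in> side a b" "c \<notin> side a b" by blast
  then show "parallel_edges K {a, b} {c, d}"
  proof cases
    case 1
    then show ?thesis using opp_parallel_edges[OF crossing_parallel[OF assms]] by simp
  next
    case 2
    then show ?thesis
      using opp_parallel_edges[OF crossing_parallel[OF assms(1) adjacent_sym[OF assms(2)]]]
      by (simp add: insert_commute)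
  qed
qed

lemma crossing_opposite:
  assumes ab: "adjacent K a b" and sq: "square K p q s r" and c: "(p \<in> side a b) \<noteq> (q \<in> side a b)"
  shows "(r \<in> side a b) = (p \<in> side a b) \<and> (s \<in> side a b) = (q \<in> side a b)"
proof -
  have adj: "adjacent K p q" "adjacent K r s" using squareD(4)[OF sq] adjacent_sym[OF squareD(6)[OF sq]] by simp_all
  show ?thesis
  proof (cases "p \<in> side a b")
    case True
    then have "side a b = side p q" using side_eq_of_crossing[OF ab adj(1)] c by simp
    also have "\<dots> = side r s" by (rule side_opp[OF sq])
    finally show ?thesis using True c side_ends[OF adj(2)] by simp
  next
    case False
    then have "side a b = side q p" using side_eq_of_crossing[OF ab adjacent_sym[OF adj(1)]] c by simp
    also have "\<dots> = side s r" using sq_sym(7)[OF sq] by (rule side_opp)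
    finally show ?thesis using False c side_ends[OF adjacent_sym[OF adj(2)]] by simp
  qed
qed

lemma no_corner':
  assumes ab: "adjacent K a b" and sq: "square K p q s r"
    and c: "(p \<in> side a b) \<noteq> (q \<in> side a b)" "(p \<in> side a b) \<noteq> (r \<in> side a b)"
  shows False
proof (cases "p \<in> side a b")
  case True
  then show ?thesis using no_corner[OF sq ab] c by simp
next
  case False
  have V: "p \<in> vertices K" using adjacent_vertices[OF squareD(4)[OF sq]] by simp
  have "side b a = vertices K - side a b" using compl_side[OF ab] by simp
  then show ?thesis using no_corner[OF sq adjacent_sym[OF ab]] False V c by simp
qed

text \<open>\<open>I\<close> collects the directions that change the side at the corner
  \<open>{}\<close>. By \<open>no_corner'\<close> there is at most one, and by
  \<open>crossing_opposite\<close> a direction changes the side at every corner if it does so at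
  one. Hence a side contains the cube, misses it, or is one of its halves; the last two alternatives
  differ in the half that contains \<open>{}\<close>.\<close>

lemma chart_side:
  assumes ab: "adjacent K a b" and c: "cube_chart K Q n \<beta>"
  shows "(\<forall>T. T \<subseteq> {..<n} \<longrightarrow> \<beta> T \<in> side a b) \<or> (\<forall>T. T \<subseteq> {..<n} \<longrightarrow> \<beta> T \<notin> side a b) \<or>
    (\<exists>i<n. (\<forall>T. T \<subseteq> {..<n} \<longrightarrow> (\<beta> T \<in> side a b \<longleftrightarrow> i \<in> T))) \<or>
    (\<exists>i<n. (\<forall>T. T \<subseteq> {..<n} \<longrightarrow> (\<beta> T \<in> side a b \<longleftrightarrow> i \<notin> T)))"
proof -
  define X where "X T \<longleftrightarrow> \<beta> T \<in> side a b" for T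
  define I where "I = {i. i < n \<and> X {} \<noteq> X {i}}"
  have one: "i = j" if "i \<in> I" "j \<in> I" for i j
  proof (rule ccontr)
    assume "i \<noteq> j"
    then have "square K (\<beta> {}) (\<beta> {i}) (\<beta> {i, j}) (\<beta> {j})"
      using cube_chart_square[OF c, of "{}" i j] that unfolding I_def by simp
    then show False using no_corner'[OF ab] that unfolding I_def X_def by blast
  qed
  have step: "(X T \<noteq> X (insert j T)) \<longleftrightarrow> j \<in> I" if "finite T" "T \<subseteq> {..<n}" "j < n" "j \<notin> T" for T j
    using that
  proof (induction T rule: finite_induct)
    case (insert k T)
    have T: "T \<subseteq> {..<n}" "k < n" "j \<notin> T" "k \<noteq> j" using insert.prems by auto
    have sq: "square K (\<beta> T) (\<beta> (insert j T)) (\<beta> (insert j (insert k T))) (\<beta> (insert k T))"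
      using cube_chart_square[OF c T(1) insert.prems(2) T(2)] T insert.hyps(2) by simp
    have "(X T \<noteq> X (insert j T)) = (X (insert k T) \<noteq> X (insert j (insert k T)))"
      using crossing_opposite[OF ab sq] crossing_opposite[OF ab sq_sym(6)[OF sq_sym(1)[OF sq]]] unfolding X_def by blast
    then show ?case using insert.IH[OF T(1) insert.prems(2) T(3)] by simp
  qed (auto simp: I_def)
  have X: "X T \<longleftrightarrow> (X {} \<longleftrightarrow> T \<inter> I = {})" if "finite T" "T \<subseteq> {..<n}" for T
    using that
  proof (induction T rule: finite_induct)
    case (insert j T)
    have T: "T \<subseteq> {..<n}" "j < n" using insert.prems by auto
    have IH: "X T \<longleftrightarrow> (X {} \<longleftrightarrow> T \<inter> I = {})" using insert.IH[OF T(1)] .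
    have st: "(X T \<noteq> X (insert j T)) \<longleftrightarrow> j \<in> I" using step[OF insert.hyps(1) T insert.hyps(2)] .
    show ?case
    proof (cases "j \<in> I")
      case True
      then have "T \<inter> I = {}" using one insert.hyps(2) by blast
      then show ?thesis using IH st True by auto
    next
      case False
      then have "insert j T \<inter> I = T \<inter> I" by auto
      then show ?thesis using IH st False by simp
    qed
  qed simp
  have X': "X T \<longleftrightarrow> (X {} \<longleftrightarrow> T \<inter> I = {})" if "T \<subseteq> {..<n}" for T
    using X[OF finite_subset[OF that finite_lessThan] that] .
  show ?thesis
  proof (cases "I = {}")
    case True
    then have "X T = X {}" if "T \<subseteq> {..<n}" for T using X'[OF that] by simp
    then show ?thesis unfolding X_def by (cases "\<beta> {} \<in> side a b") simp_all
  next
    case False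
    then obtain i where i: "i \<in> I" by blast
    then have I: "I = {i}" "i < n" using one unfolding I_def by auto
    then have Xi: "X T \<longleftrightarrow> (X {} \<longleftrightarrow> i \<notin> T)" if "T \<subseteq> {..<n}" for T using X'[OF that] by simp
    show ?thesis
    proof (cases "X {}")
      case True
      then have "X T \<longleftrightarrow> i \<notin> T" if "T \<subseteq> {..<n}" for T using Xi[OF that] by simp
      then have "\<forall>T. T \<subseteq> {..<n} \<longrightarrow> (\<beta> T \<in> side a b \<longleftrightarrow> i \<notin> T)" unfolding X_def by simp
      then show ?thesis using I(2) by blast
    next
      case False
      then have "X T \<longleftrightarrow> i \<in> T" if "T \<subseteq> {..<n}" for T using Xi[OF that] by simp
      then have "\<forall>T. T \<subseteq> {..<n} \<longrightarrow> (\<beta> T \<in> side a b \<longleftrightarrow> i \<in> T)" unfolding X_def by simp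
      then show ?thesis using I(2) by blast
    qed
  qed
qed

end

section \<open>The mass of a point on a side, and the hyperplane as a level set\<close>

lemma sum_weight_with:
  assumes i: "i < n"
  shows "(\<Sum>T\<in>{T \<in> Pow {..<n}. i \<in> T}. weight n t T) = t i"
    "(\<Sum>T\<in>{T \<in> Pow {..<n}. i \<notin> T}. weight n t T) = 1 - t i"
proof -
  \<comment> \<open>With coordinate \<open>i\<close> raised to \<open>1\<close> the sets without
    \<open>i\<close> lose their weight, and the weights of the sets with \<open>i\<close> become a
    full distribution, of which the original ones are \<open>t i\<close> times as large.\<close>
  let ?t = "t(i := 1)"
  have 0: "weight n ?t T = 0" if "i \<notin> T" for T
  proof -
    have "(\<Prod>j\<in>{..<n} - T. 1 - ?t j) = 0" using i that by (intro prod_zero) auto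
    then show ?thesis unfolding weight_def by simp
  qed
  have 1: "weight n t T = t i * weight n ?t T" if T: "T \<in> Pow {..<n}" "i \<in> T" for T
  proof -
    have fin: "finite T" using T finite_subset by blast
    have "(\<Prod>j\<in>T. t j) = t i * (\<Prod>j\<in>T. ?t j)"
      using prod.remove[OF fin T(2), of t] prod.remove[OF fin T(2), of ?t] by simp
    moreover have "(\<Prod>j\<in>{..<n} - T. 1 - t j) = (\<Prod>j\<in>{..<n} - T. 1 - ?t j)"
      using T(2) by (intro prod.cong) auto
    ultimately show ?thesis unfolding weight_def by simp
  qed
  have "(\<Sum>T\<in>{T \<in> Pow {..<n}. i \<in> T}. weight n t T) = t i * (\<Sum>T\<in>{T \<in> Pow {..<n}. i \<in> T}. weight n ?t T)"
    unfolding sum_distrib_left using 1 by (intro sum.cong) auto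
  also have "(\<Sum>T\<in>{T \<in> Pow {..<n}. i \<in> T}. weight n ?t T) = (\<Sum>T\<in>Pow {..<n}. weight n ?t T)"
    using 0 by (intro sum.mono_neutral_left) auto
  finally show *: "(\<Sum>T\<in>{T \<in> Pow {..<n}. i \<in> T}. weight n t T) = t i" using sum_weight[of n ?t] by simp
  have "(\<Sum>T\<in>Pow {..<n}. weight n t T) = (\<Sum>T\<in>{T \<in> Pow {..<n}. i \<in> T} \<union> {T \<in> Pow {..<n}. i \<notin> T}. weight n t T)"
    by (intro sum.cong) auto
  also have "\<dots> = (\<Sum>T\<in>{T \<in> Pow {..<n}. i \<in> T}. weight n t T) + (\<Sum>T\<in>{T \<in> Pow {..<n}. i \<notin> T}. weight n t T)"
    by (intro sum.union_disjoint) auto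
  finally show "(\<Sum>T\<in>{T \<in> Pow {..<n}. i \<notin> T}. weight n t T) = 1 - t i"
    using * sum_weight[of n t] by simp
qed

text \<open>The sum is restricted to the support since a side may be infinite, and
  \<open>sum\<close> over an infinite set is \<open>0\<close>; points of the realization have finite
  support.\<close>

definition mass :: "'v set \<Rightarrow> ('v \<Rightarrow> real) \<Rightarrow> real" where
  "mass W f = (\<Sum>v\<in>{v \<in> W. f v \<noteq> 0}. f v)"

lemma mass_eq_sum: "finite Q \<Longrightarrow> \<forall>v. v \<notin> Q \<longrightarrow> f v = 0 \<Longrightarrow> mass W f = sum f (Q \<inter> W)"
  unfolding mass_def by (rule sum.mono_neutral_left) auto

lemma mass_cube_point:
  assumes c: "cube_chart K Q n \<beta>"
  shows "mass W (cube_point n \<beta> t) = (\<Sum>T\<in>{T \<in> Pow {..<n}. \<beta> T \<in> W}. weight n t T)"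
proof -
  have "mass W (cube_point n \<beta> t) = sum (cube_point n \<beta> t) (Q \<inter> W)"
    using mass_eq_sum[OF cube_chart_finite[OF c]] cube_point_outside[OF c] by blast
  also have "\<dots> = (\<Sum>T\<in>{T \<in> Pow {..<n}. \<beta> T \<in> Q \<inter> W}. weight n t T)"
    by (rule sum_cube_point[OF c]) simp
  also have "{T \<in> Pow {..<n}. \<beta> T \<in> Q \<inter> W} = {T \<in> Pow {..<n}. \<beta> T \<in> W}"
    using cube_chart_in[OF c] by blast
  finally show ?thesis .
qed

lemma mass_compl:
  assumes f: "f \<in> realization K" and W: "W \<subseteq> vertices K"
  shows "mass W f + mass (vertices K - W) f = 1"
proof -
  obtain Q where Q: "Q \<in> K" "finite Q" "\<forall>v. v \<notin> Q \<longrightarrow> f v = 0" "\<forall>v. 0 \<le> f v" "sum f Q = 1"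
    using f by (rule realization_support)
  have "Q = (Q \<inter> W) \<union> (Q \<inter> (vertices K - W))" using Q(1) by (auto simp: vertices_def)
  then have "sum f Q = sum f (Q \<inter> W) + sum f (Q \<inter> (vertices K - W))"
    using Q(2) sum.union_disjoint[of "Q \<inter> W" "Q \<inter> (vertices K - W)" f] by (simp add: Int_Un_distrib[symmetric] disjoint_iff)
  then show ?thesis using mass_eq_sum[OF Q(2,3)] Q(5) by simp
qed

lemma mass_lower:
  assumes f: "f \<in> realization K" and F: "finite F" "F \<subseteq> W"
  shows "sum f F \<le> mass W f"
proof -
  obtain Q where Q: "Q \<in> K" "finite Q" "\<forall>v. v \<notin> Q \<longrightarrow> f v = 0" "\<forall>v. 0 \<le> f v" "sum f Q = 1"
    using f by (rule realization_support)
  have "sum f F = sum f (Q \<inter> F)" using Q(3) F(1) by (intro sum.mono_neutral_right) auto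
  also have "\<dots> \<le> sum f (Q \<inter> W)" using Q(2,4) F(2) by (intro sum_mono2) auto
  finally show ?thesis using mass_eq_sum[OF Q(2,3)] by simp
qed

context CAT0_complex
begin

lemma chart_mass:
  assumes ab: "adjacent K a b" and c: "cube_chart K Q n \<beta>"
  obtains (inside) "\<forall>T. T \<subseteq> {..<n} \<longrightarrow> \<beta> T \<in> side a b" "\<forall>t. mass (side a b) (cube_point n \<beta> t) = 1"
  | (outside) "\<forall>T. T \<subseteq> {..<n} \<longrightarrow> \<beta> T \<notin> side a b" "\<forall>t. mass (side a b) (cube_point n \<beta> t) = 0"
  | (upper) i where "i < n" "\<forall>T. T \<subseteq> {..<n} \<longrightarrow> (\<beta> T \<in> side a b \<longleftrightarrow> i \<in> T)"
      "\<forall>t. mass (side a b) (cube_point n \<beta> t) = t i"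
  | (lower) i where "i < n" "\<forall>T. T \<subseteq> {..<n} \<longrightarrow> (\<beta> T \<in> side a b \<longleftrightarrow> i \<notin> T)"
      "\<forall>t. mass (side a b) (cube_point n \<beta> t) = 1 - t i"
proof -
  consider (1) "\<forall>T. T \<subseteq> {..<n} \<longrightarrow> \<beta> T \<in> side a b" | (2) "\<forall>T. T \<subseteq> {..<n} \<longrightarrow> \<beta> T \<notin> side a b"
    | (3) i where "i < n" "\<forall>T. T \<subseteq> {..<n} \<longrightarrow> (\<beta> T \<in> side a b \<longleftrightarrow> i \<in> T)"
    | (4) i where "i < n" "\<forall>T. T \<subseteq> {..<n} \<longrightarrow> (\<beta> T \<in> side a b \<longleftrightarrow> i \<notin> T)"
    using chart_side[OF ab c] by blast
  then show ?thesis
  proof cases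
    case 1
    then have E: "{T \<in> Pow {..<n}. \<beta> T \<in> side a b} = Pow {..<n}" by auto
    have "\<forall>t. mass (side a b) (cube_point n \<beta> t) = 1" unfolding mass_cube_point[OF c] E sum_weight by simp
    with 1 show ?thesis by (rule inside)
  next
    case 2
    then have E: "{T \<in> Pow {..<n}. \<beta> T \<in> side a b} = {}" by auto
    have "\<forall>t. mass (side a b) (cube_point n \<beta> t) = 0" unfolding mass_cube_point[OF c] E by simp
    with 2 show ?thesis by (rule outside)
  next
    case (3 i)
    then have E: "{T \<in> Pow {..<n}. \<beta> T \<in> side a b} = {T \<in> Pow {..<n}. i \<in> T}" by auto
    have "\<forall>t. mass (side a b) (cube_point n \<beta> t) = t i"
      unfolding mass_cube_point[OF c] E sum_weight_with(1)[OF 3(1)] by simp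
    with 3 show ?thesis by (rule upper)
  next
    case (4 i)
    then have E: "{T \<in> Pow {..<n}. \<beta> T \<in> side a b} = {T \<in> Pow {..<n}. i \<notin> T}" by auto
    have "\<forall>t. mass (side a b) (cube_point n \<beta> t) = 1 - t i"
      unfolding mass_cube_point[OF c] E sum_weight_with(2)[OF 4(1)] by simp
    with 4 show ?thesis by (rule lower)
  qed
qed

text \<open>In a chart the mass on a side is \<open>1\<close>, \<open>0\<close>, \<open>t i\<close>
  or \<open>1 - t i\<close>, so it is \<open>1 / 2\<close> exactly on the midcube of the crossing
  direction. That direction crosses at every corner, in particular at the origin, where the
  definition of \<open>hyperplane\<close> tests parallelism.\<close>

lemma hyperplane_mass:
  assumes ab: "adjacent K a b"
  shows "hyperplane K {a, b} = {f \<in> realization K. mass (side a b) f = 1 / 2}"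
proof (intro equalityI subsetI)
  fix f assume "f \<in> hyperplane K {a, b}"
  then have "\<exists>n \<beta> t. f = cube_point n \<beta> t \<and> (\<exists>Q\<in>K. cube_chart K Q n \<beta>) \<and> (\<forall>i<n. 0 \<le> t i \<and> t i \<le> 1) \<and>
        (\<exists>i<n. t i = 1/2 \<and> parallel_edges K {a, b} {\<beta> {}, \<beta> {i}})"
    unfolding hyperplane_def mem_Collect_eq .
  then obtain n \<beta> t Q i where f: "f = cube_point n \<beta> t" "Q \<in> K" and c: "cube_chart K Q n \<beta>"
    and t: "\<forall>i<n. 0 \<le> t i \<and> t i \<le> 1"
    and i: "i < n" "t i = 1/2" "parallel_edges K {a, b} {\<beta> {}, \<beta> {i}}" by blast
  have e: "adjacent K (\<beta> {}) (\<beta> {i})" using cube_chart_edge[OF c, of "{}" i] i(1) by simp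
  have cross: "(\<beta> {} \<in> side a b) \<noteq> (\<beta> {i} \<in> side a b)" using parallel_edges_iff[OF ab e] i(3) by simp
  have sub: "{} \<subseteq> {..<n}" "{i} \<subseteq> {..<n}" using i(1) by simp_all
  from ab c have "mass (side a b) f = 1 / 2"
  proof (cases rule: chart_mass)
    case inside
    then show ?thesis using cross sub by blast
  next
    case outside
    then show ?thesis using cross sub by blast
  next
    case (upper j)
    have "\<beta> {} \<in> side a b \<longleftrightarrow> j \<in> {}" "\<beta> {i} \<in> side a b \<longleftrightarrow> j \<in> {i}" using upper(2) sub by blast+
    then have "j = i" using cross by auto
    then show ?thesis using upper(3) i(2) f by simp
  next
    case (lower j)
    have "\<beta> {} \<in> side a b \<longleftrightarrow> j \<notin> {}" "\<beta> {i} \<in> side a b \<longleftrightarrow> j \<notin> {i}" using lower(2) sub by blast+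
    then have "j = i" using cross by auto
    then show ?thesis using lower(3) i(2) f by simp
  qed
  then show "f \<in> {f \<in> realization K. mass (side a b) f = 1 / 2}" using realizationI[OF f(2) c t] f(1) by simp
next
  fix f assume "f \<in> {f \<in> realization K. mass (side a b) f = 1 / 2}"
  then have fK: "f \<in> realization K" and m: "mass (side a b) f = 1 / 2" by simp_all
  obtain Q n \<beta> t where *: "Q \<in> K" "cube_chart K Q n \<beta>" "\<forall>i<n. 0 \<le> t i \<and> t i \<le> 1" "f = cube_point n \<beta> t"
    using fK by (rule realizationE)
  have "\<exists>i<n. t i = 1 / 2 \<and> (\<beta> {} \<in> side a b) \<noteq> (\<beta> {i} \<in> side a b)"
    using ab *(2)
  proof (cases rule: chart_mass)
    case (upper j)
    have "\<beta> {} \<in> side a b \<longleftrightarrow> j \<in> {}" "\<beta> {j} \<in> side a b \<longleftrightarrow> j \<in> {j}" using upper(1,2) by blast+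
    moreover have "t j = 1 / 2" using upper(3) m *(4) by simp
    ultimately show ?thesis using upper(1) by blast
  next
    case (lower j)
    have "\<beta> {} \<in> side a b \<longleftrightarrow> j \<notin> {}" "\<beta> {j} \<in> side a b \<longleftrightarrow> j \<notin> {j}" using lower(1,2) by blast+
    moreover have "1 - t j = 1 / 2" using lower(3) m *(4) by simp
    then have "t j = 1 / 2" by simp
    ultimately show ?thesis using lower(1) by blast
  qed (use m *(4) in simp_all)
  then obtain i where i: "i < n" "t i = 1 / 2" "(\<beta> {} \<in> side a b) \<noteq> (\<beta> {i} \<in> side a b)" by blast
  have e: "adjacent K (\<beta> {}) (\<beta> {i})" using cube_chart_edge[OF *(2), of "{}" i] i(1) by simp
  have p: "parallel_edges K {a, b} {\<beta> {}, \<beta> {i}}" using parallel_edges_iff[OF ab e] i(3) by simp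
  show "f \<in> hyperplane K {a, b}"
    unfolding hyperplane_def mem_Collect_eq
  proof (intro exI conjI)
    show "f = cube_point n \<beta> t" by fact
    show "\<exists>Q\<in>K. cube_chart K Q n \<beta>" using *(1,2) by blast
    show "\<forall>i<n. 0 \<le> t i \<and> t i \<le> 1" by fact
    show "i < n" "t i = 1 / 2" "parallel_edges K {a, b} {\<beta> {}, \<beta> {i}}" by fact+
  qed
qed

section \<open>The two components of the complement of a hyperplane\<close>

definition heavy :: "'v \<Rightarrow> 'v \<Rightarrow> ('v \<Rightarrow> real) set" where
  "heavy a b = {f \<in> realization K. 1 / 2 < mass (side a b) f}"

lemma side_subset: "side a b \<subseteq> vertices K"
  unfolding side_def by blast

lemma mass_swap:
  assumes "adjacent K a b" "f \<in> realization K"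
  shows "mass (side b a) f = 1 - mass (side a b) f"
  using mass_compl[OF assms(2) side_subset[of a b]] compl_side[OF assms(1)] by simp

lemma complement_hyperplane:
  assumes "adjacent K a b"
  shows "realization K - hyperplane K {a, b} = heavy a b \<union> heavy b a" "heavy a b \<inter> heavy b a = {}"
  unfolding hyperplane_mass[OF assms] heavy_def using mass_swap[OF assms] by auto

text \<open>On the realization the mass is a supremum of finite sums of coordinates, hence lower
  semicontinuous for pointwise convergence, which suffices for a strict lower bound. The finite sum
  attached to \<open>f\<close> runs over the support of \<open>f\<close> on the side.\<close>

lemma heavy_open: "\<exists>U. open U \<and> heavy a b = U \<inter> realization K"
proof -
  define F where "F f = {v \<in> side a b. f v \<noteq> 0}" for f :: "'v \<Rightarrow> real"
  define U where "U = (\<Union>f\<in>heavy a b. {g :: 'v \<Rightarrow> real. 1 / 2 < sum g (F f)})"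
  have "open {g :: 'v \<Rightarrow> real. 1 / 2 < sum g (F f)}" for f
    by (intro open_Collect_less continuous_on_const continuous_on_sum continuous_on_product_coordinates)
  then have "open U" unfolding U_def by (intro open_UN ballI)
  moreover have "heavy a b = U \<inter> realization K"
  proof (intro equalityI subsetI)
    fix f assume f: "f \<in> heavy a b"
    then have "1 / 2 < sum f (F f)" unfolding heavy_def mass_def F_def by simp
    then show "f \<in> U \<inter> realization K" using f unfolding U_def heavy_def by blast
  next
    fix g assume "g \<in> U \<inter> realization K"
    then obtain f where f: "f \<in> heavy a b" "1 / 2 < sum g (F f)" "g \<in> realization K" unfolding U_def by blast
    have fK: "f \<in> realization K" using f(1) unfolding heavy_def by simp
    obtain Q where Q: "Q \<in> K" "finite Q" "\<forall>v. v \<notin> Q \<longrightarrow> f v = 0" "\<forall>v. 0 \<le> f v" "sum f Q = 1"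
      using fK by (rule realization_support)
    have "F f \<subseteq> Q" using Q(3) unfolding F_def by blast
    then have "finite (F f)" using Q(2) finite_subset by blast
    moreover have "F f \<subseteq> side a b" unfolding F_def by blast
    ultimately have "sum g (F f) \<le> mass (side a b) g" by (rule mass_lower[OF f(3)])
    then show "g \<in> heavy a b" using f(2,3) unfolding heavy_def by simp
  qed
  ultimately show ?thesis by blast
qed

lemma mass_supported:
  assumes "f \<in> realization K" "\<And>v. f v \<noteq> 0 \<Longrightarrow> v \<in> W"
  shows "mass W f = 1"
proof -
  obtain Q where Q: "Q \<in> K" "finite Q" "\<forall>v. v \<notin> Q \<longrightarrow> f v = 0" "\<forall>v. 0 \<le> f v" "sum f Q = 1"
    using assms(1) by (rule realization_support)
  have "mass W f = sum f (Q \<inter> W)" using mass_eq_sum[OF Q(2,3)] .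
  also have "\<dots> = sum f Q" using Q(2) assms(2) by (intro sum.mono_neutral_left) auto
  finally show ?thesis using Q(5) by simp
qed

lemma vertex_heavy: "v \<in> side a b \<Longrightarrow> indicat_real {v} \<in> heavy a b"
proof -
  assume v: "v \<in> side a b"
  have r: "indicat_real {v} \<in> realization K"
    using vertex_in_realization[OF cubical, of v] v side_subset[of a b] by blast
  have "mass (side a b) (indicat_real {v}) = 1"
    by (rule mass_supported[OF r]) (use v in \<open>auto simp: indicator_def split: if_splits\<close>)
  then show ?thesis using r unfolding heavy_def by simp
qed

lemma continuous_cube_point:
  assumes "\<And>i. continuous_on S (\<lambda>s. t s i)"
  shows "continuous_on S (\<lambda>s. cube_point n \<beta> (t s))"
proof (rule continuous_on_coordinatewise_then_product)
  fix v
  have "continuous_on S (\<lambda>s. (if \<beta> T = v then (\<Prod>i\<in>T. t s i) * (\<Prod>i\<in>{..<n} - T. 1 - t s i) else 0))" for T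
    by (cases "\<beta> T = v") (auto intro!: continuous_intros assms)
  then show "continuous_on S (\<lambda>s. cube_point n \<beta> (t s) v)"
    unfolding cube_point_def by (intro continuous_on_sum)
qed

lemma cube_point_corner:
  assumes c: "cube_chart K Q n \<beta>" and T: "T \<subseteq> {..<n}"
  shows "cube_point n \<beta> (indicat_real T) = indicat_real {\<beta> T}"
proof
  fix v
  have w: "weight n (indicat_real T) S = (if S = T then 1 else 0)" if S: "S \<subseteq> {..<n}" for S
  proof (cases "S = T")
    case True
    then show ?thesis unfolding weight_def by (simp add: indicator_def)
  next
    case False
    then consider i where "i \<in> S" "i \<notin> T" | i where "i \<in> T" "i \<notin> S" by blast
    then have "weight n (indicat_real T) S = 0"
    proof cases
      case (1 i)
      have "finite S" using S finite_subset by blast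
      then have "(\<Prod>i\<in>S. indicat_real T i) = 0" using 1 by (intro prod_zero bexI[of _ i]) auto
      then show ?thesis unfolding weight_def by simp
    next
      case (2 i)
      then have "(\<Prod>i\<in>{..<n} - S. 1 - indicat_real T i) = 0" using T by (intro prod_zero bexI[of _ i]) auto
      then show ?thesis unfolding weight_def by simp
    qed
    then show ?thesis using False by simp
  qed
  show "cube_point n \<beta> (indicat_real T) v = indicat_real {\<beta> T} v"
  proof (cases "v \<in> Q")
    case True
    then obtain S where S: "S \<subseteq> {..<n}" "v = \<beta> S" by (rule cube_chart_surj[OF c])
    then show ?thesis using cube_point_at[OF c S(1)] w[OF S(1)] cube_chart_inj[OF c S(1) T]
      by (simp add: indicator_def)
  next
    case False
    moreover have "\<beta> T \<in> Q" using cube_chart_in[OF c T] .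
    ultimately show ?thesis using cube_point_outside[OF c False] by (auto simp: indicator_def)
  qed
qed

text \<open>Move straight, in chart coordinates, to a corner on the side. The mass depends on a
  single coordinate at most, and the target corner, \<open>{i}\<close> or \<open>{}\<close>, is
  chosen so that this coordinate only moves further away from \<open>1 / 2\<close>.\<close>

lemma connected_component_heavy_vertex:
  assumes ab: "adjacent K a b" and f: "f \<in> heavy a b"
  shows "\<exists>v\<in>side a b. connected_component (heavy a b) f (indicat_real {v})"
proof -
  have fK: "f \<in> realization K" and m: "1 / 2 < mass (side a b) f" using f unfolding heavy_def by simp_all
  obtain Q n \<beta> t where *: "Q \<in> K" "cube_chart K Q n \<beta>" "\<forall>i<n. 0 \<le> t i \<and> t i \<le> 1" "f = cube_point n \<beta> t"
    using fK by (rule realizationE)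
  define u where "u T s i = (1 - s) * t i + s * indicat_real T i" for T and s :: real and i
  have main: ?thesis if T: "T \<subseteq> {..<n}" "\<beta> T \<in> side a b"
    and heavy: "\<And>s. 0 \<le> s \<Longrightarrow> s \<le> 1 \<Longrightarrow> 1 / 2 < mass (side a b) (cube_point n \<beta> (u T s))" for T
  proof -
    let ?g = "\<lambda>s. cube_point n \<beta> (u T s)"
    have "continuous_on {0..1} ?g"
      by (rule continuous_cube_point) (unfold u_def, intro continuous_intros)
    then have "connected (?g ` {0..1})" by (rule connected_continuous_image) (rule connected_Icc)
    moreover have "?g ` {0..1} \<subseteq> heavy a b"
    proof
      fix g assume "g \<in> ?g ` {0..1}"
      then obtain s where s: "0 \<le> s" "s \<le> 1" "g = ?g s" by auto
      have "\<forall>i<n. 0 \<le> u T s i \<and> u T s i \<le> 1"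
      proof (intro allI impI)
        fix i assume "i < n"
        then have "0 \<le> t i" "t i \<le> 1" using *(3) by simp_all
        then show "0 \<le> u T s i \<and> u T s i \<le> 1"
          unfolding u_def using s(1,2) convex_bound_le[of "t i" 1 "indicat_real T i" "1 - s" s]
          by (simp add: indicator_def)
      qed
      then have "?g s \<in> realization K" by (rule realizationI[OF *(1,2)])
      then show "g \<in> heavy a b" unfolding heavy_def using heavy[OF s(1,2)] s(3) by simp
    qed
    moreover have "u T 0 = t" "u T 1 = indicat_real T" unfolding u_def by auto
    then have E: "f = ?g 0" "indicat_real {\<beta> T} = ?g 1" using *(4) cube_point_corner[OF *(2) T(1)] by simp_all
    have "f \<in> ?g ` {0..1}" using E(1) by (rule image_eqI) simp
    moreover have "indicat_real {\<beta> T} \<in> ?g ` {0..1}" using E(2) by (rule image_eqI) simp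
    ultimately have "connected_component (heavy a b) f (indicat_real {\<beta> T})"
      unfolding connected_component_def by blast
    then show ?thesis using T(2) by blast
  qed
  from ab *(2) show ?thesis
  proof (cases rule: chart_mass)
    case inside
    then show ?thesis using main[of "{}"] by simp
  next
    case outside
    then show ?thesis using m *(4) by simp
  next
    case (upper i)
    have ti: "1 / 2 < t i" "t i \<le> 1" using upper(1,3) m *(3,4) by simp_all
    show ?thesis
    proof (rule main[of "{i}"])
      show "{i} \<subseteq> {..<n}" using upper(1) by simp
      then show "\<beta> {i} \<in> side a b" using upper(2) by blast
      fix s :: real assume s: "0 \<le> s" "s \<le> 1"
      have "u {i} s i = t i + s * (1 - t i)" unfolding u_def by (simp add: algebra_simps)
      moreover have "0 \<le> s * (1 - t i)" using s ti by simp
      ultimately show "1 / 2 < mass (side a b) (cube_point n \<beta> (u {i} s))" using upper(3) ti by simp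
    qed
  next
    case (lower i)
    have ti: "t i < 1 / 2" "0 \<le> t i" using lower(1,3) m *(3,4) by auto
    show ?thesis
    proof (rule main[of "{}"])
      show "{} \<subseteq> {..<n}" by simp
      then show "\<beta> {} \<in> side a b" using lower(2) by blast
      fix s :: real assume s: "0 \<le> s" "s \<le> 1"
      have "u {} s i \<le> t i" unfolding u_def using s ti by (simp add: mult_left_le_one_le)
      then show "1 / 2 < mass (side a b) (cube_point n \<beta> (u {} s))" using lower(3) ti by simp
    qed
  qed
qed

lemma connected_component_heavy_edge:
  assumes xy: "adjacent K x y" "x \<in> side a b" "y \<in> side a b"
  shows "connected_component (heavy a b) (indicat_real {x}) (indicat_real {y})"
proof -
  have "continuous_on {0..1} (edge_point x y)"
    unfolding edge_point_def by (intro continuous_intros)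
  then have "connected (edge_point x y ` {0..1})" by (rule connected_continuous_image) (rule connected_Icc)
  moreover have "edge_point x y ` {0..1} \<subseteq> heavy a b"
  proof
    fix g assume "g \<in> edge_point x y ` {0..1}"
    then obtain s where s: "0 \<le> s" "s \<le> 1" "g = edge_point x y s" by auto
    have r: "g \<in> realization K" unfolding s(3) by (rule edge_point_in_realization[OF cubical xy(1) s(1,2)])
    have "mass (side a b) g = 1"
    proof (rule mass_supported[OF r])
      fix v assume "g v \<noteq> 0"
      then have "v = x \<or> v = y" unfolding s(3) edge_point_def by (auto simp: indicator_def split: if_splits)
      then show "v \<in> side a b" using xy by blast
    qed
    then show "g \<in> heavy a b" using r unfolding heavy_def by simp
  qed
  moreover have "indicat_real {x} \<in> edge_point x y ` {0..1}" "indicat_real {y} \<in> edge_point x y ` {0..1}"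
    unfolding edge_point_0[of x y, symmetric] edge_point_1[of x y, symmetric] by (intro imageI; simp)+
  ultimately show ?thesis unfolding connected_component_def by blast
qed

lemma connected_heavy:
  assumes ab: "adjacent K a b"
  shows "connected (heavy a b)"
proof -
  have v: "connected_component (heavy a b) (indicat_real {v}) (indicat_real {a})" if "v \<in> side a b" for v
    using side_connected[OF ab that]
  proof (induction rule: converse_rtranclp_induct)
    case base
    show ?case using vertex_heavy[of a a b] side_ends[OF ab] by simp
  next
    case (step x y)
    then have "connected_component (heavy a b) (indicat_real {x}) (indicat_real {y})"
      using connected_component_heavy_edge by blast
    then show ?case using step.IH by (rule connected_component_trans)
  qed
  have f: "connected_component (heavy a b) f (indicat_real {a})" if "f \<in> heavy a b" for f
  proof -
    have "\<exists>w\<in>side a b. connected_component (heavy a b) f (indicat_real {w})"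
      by (rule connected_component_heavy_vertex[OF ab that])
    then obtain w where w: "w \<in> side a b" "connected_component (heavy a b) f (indicat_real {w})" by blast
    show ?thesis by (rule connected_component_trans[OF w(2) v[OF w(1)]])
  qed
  show ?thesis
    unfolding connected_iff_connected_component
  proof (intro ballI)
    fix g h assume "g \<in> heavy a b" "h \<in> heavy a b"
    then show "connected_component (heavy a b) g h"
      by (intro connected_component_trans[OF f connected_component_sym[OF f]])
  qed
qed

text \<open>The two heavy sets are disjoint, connected and relatively open, and they cover the
  complement.\<close>

lemma components_hyperplane:
  assumes ab: "adjacent K a b"
  shows "components (realization K - hyperplane K {a, b}) = {heavy a b, heavy b a}"
proof -
  let ?S = "heavy a b \<union> heavy b a"
  have ba: "adjacent K b a" using ab by (rule adjacent_sym)
  have cc: "connected_component_set ?S f = heavy x y"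
    if xy: "(x, y) = (a, b) \<or> (x, y) = (b, a)" and f: "f \<in> heavy x y" for x y f
  proof
    have xy': "adjacent K x y" "?S = heavy x y \<union> heavy y x" using xy ab ba by auto
    show "heavy x y \<subseteq> connected_component_set ?S f"
      using connected_component_maximal[OF f connected_heavy[OF xy'(1)]] xy'(2) by blast
    show "connected_component_set ?S f \<subseteq> heavy x y"
    proof
      fix g assume "g \<in> connected_component_set ?S f"
      then obtain C where C: "connected C" "C \<subseteq> ?S" "f \<in> C" "g \<in> C" unfolding connected_component_def by blast
      obtain U where U: "open U" "heavy x y = U \<inter> realization K" using heavy_open by blast
      obtain U' where U': "open U'" "heavy y x = U' \<inter> realization K" using heavy_open by blast
      have dis: "heavy x y \<inter> heavy y x = {}" using complement_hyperplane(2)[OF xy'(1)] .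
      have CK: "C \<subseteq> realization K" using C(2) unfolding heavy_def by blast
      have "C \<subseteq> U \<union> U'" "U \<inter> U' \<inter> C = {}" using C(2) CK xy'(2) U(2) U'(2) dis by blast+
      then have "U \<inter> C = {} \<or> U' \<inter> C = {}" using connectedD[OF C(1) U(1) U'(1)] by blast
      moreover have "f \<in> U \<inter> C" using C(3) f U(2) by blast
      ultimately have "g \<notin> heavy y x" using C(4) U'(2) by blast
      then show "g \<in> heavy x y" using C(2,4) xy'(2) by blast
    qed
  qed
  have ne: "heavy a b \<noteq> {}" "heavy b a \<noteq> {}"
    using vertex_heavy[of a a b] vertex_heavy[of b b a] side_ends[OF ab] side_ends[OF ba] by blast+
  show ?thesis
    unfolding complement_hyperplane(1)[OF ab] components_def
  proof (intro equalityI subsetI)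
    fix C assume "C \<in> connected_component_set ?S ` ?S"
    then obtain f where "f \<in> ?S" "C = connected_component_set ?S f" by blast
    then show "C \<in> {heavy a b, heavy b a}" using cc[of a b f] cc[of b a f] by auto
  next
    fix C assume C: "C \<in> {heavy a b, heavy b a}"
    obtain f g where fg: "f \<in> heavy a b" "g \<in> heavy b a" using ne by blast
    have "heavy a b = connected_component_set ?S f" "heavy b a = connected_component_set ?S g"
      using cc[of a b f] cc[of b a g] fg by simp_all
    then have "heavy a b \<in> connected_component_set ?S ` ?S" "heavy b a \<in> connected_component_set ?S ` ?S"
      using fg by (auto intro: image_eqI simp del: mem_Collect_eq)
    then show "C \<in> connected_component_set ?S ` ?S" using C by blast
  qed
qed

text \<open>Taking the closure adds no vertex: points close to \<open>v\<close> have coordinate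
  above \<open>1 / 2\<close> at \<open>v\<close>, so they are heavy on the side that contains
  \<open>v\<close>.\<close>

lemma vertices_closure_heavy:
  assumes ab: "adjacent K a b"
  shows "{v \<in> vertices K. indicat_real {v} \<in> closure (heavy a b)} = side a b"
proof (intro equalityI subsetI)
  fix v assume "v \<in> side a b"
  then show "v \<in> {v \<in> vertices K. indicat_real {v} \<in> closure (heavy a b)}"
    using vertex_heavy[of v a b] closure_subset side_subset by blast
next
  fix v assume "v \<in> {v \<in> vertices K. indicat_real {v} \<in> closure (heavy a b)}"
  then have v: "v \<in> vertices K" "indicat_real {v} \<in> closure (heavy a b)" by simp_all
  let ?U = "{f :: 'v \<Rightarrow> real. 1 / 2 < f v}"
  have "open ?U" by (intro open_Collect_less continuous_on_const continuous_on_product_coordinates)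
  moreover have "indicat_real {v} \<in> ?U" by simp
  ultimately have "?U \<inter> heavy a b \<noteq> {}" using v(2) closure_iff_nhds_not_empty by blast
  then obtain f where f: "f \<in> heavy a b" "1 / 2 < f v" by blast
  have fK: "f \<in> realization K" using f(1) unfolding heavy_def by simp
  show "v \<in> side a b"
  proof (rule ccontr)
    assume "v \<notin> side a b"
    then have "{v} \<subseteq> side b a" using v(1) compl_side[OF ab] by blast
    then have "sum f {v} \<le> mass (side b a) f" using mass_lower[OF fK, of "{v}"] by simp
    then show False using f mass_swap[OF ab fK] unfolding heavy_def by simp
  qed
qed

theorem half_spaces_eq: "half_spaces K = {side a b |a b. adjacent K a b}"
proof (intro equalityI subsetI)
  fix H assume "H \<in> half_spaces K"
  then obtain e C where e: "H = {v \<in> vertices K. indicat_real {v} \<in> closure C}" "e \<in> edges K"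
      "C \<in> components (realization K - hyperplane K e)"
    unfolding half_spaces_def by blast
  have "card e = 2" using e(2) by (simp add: edges_def)
  then obtain a b where ab: "e = {a, b}" by (auto simp: card_2_iff)
  then have a: "adjacent K a b" "adjacent K b a" using e(2) by (simp_all add: adjacent_def insert_commute)
  have "C = heavy a b \<or> C = heavy b a" using e(3) components_hyperplane[OF a(1)] ab by simp
  then have "H = side a b \<or> H = side b a"
    using vertices_closure_heavy[OF a(1)] vertices_closure_heavy[OF a(2)] e(1) by auto
  then show "H \<in> {side a b |a b. adjacent K a b}" using a by blast
next
  fix H assume "H \<in> {side a b |a b. adjacent K a b}"
  then obtain a b where ab: "H = side a b" "adjacent K a b" by blast
  have "heavy a b \<in> components (realization K - hyperplane K {a, b})"
    using components_hyperplane[OF ab(2)] by simp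
  moreover have "{a, b} \<in> edges K" using ab(2) by (simp add: adjacent_def)
  moreover have "H = {v \<in> vertices K. indicat_real {v} \<in> closure (heavy a b)}"
    using vertices_closure_heavy[OF ab(2)] ab(1) by simp
  ultimately show "H \<in> half_spaces K" unfolding half_spaces_def by blast
qed

section \<open>Half-spaces as sides, and finiteness of intervals\<close>

lemma half_space_subset: "H \<in> half_spaces K \<Longrightarrow> H \<subseteq> vertices K"
  using side_subset unfolding half_spaces_eq by blast

lemma half_spaceE:
  assumes "H \<in> half_spaces K"
  obtains a b where "H = side a b" "adjacent K a b"
  using assms unfolding half_spaces_eq by blast

lemma side_half_space: "adjacent K a b \<Longrightarrow> side a b \<in> half_spaces K"
  unfolding half_spaces_eq by blast

lemma compl_half_space_in:
  assumes "H \<in> half_spaces K"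
  shows "compl_half_space K H \<in> half_spaces K"
proof -
  obtain a b where ab: "H = side a b" "adjacent K a b" using assms by (rule half_spaceE)
  have "compl_half_space K H = side b a" unfolding compl_half_space_def ab(1) by (rule compl_side[OF ab(2)])
  then show ?thesis using side_half_space[OF adjacent_sym[OF ab(2)]] by simp
qed

text \<open>A walk from \<open>x\<close> to \<open>y\<close> has to enter each half-space in the
  interval along some edge, and this edge determines the half-space.\<close>

lemma finite_half_space_interval:
  assumes "x \<in> vertices K" "y \<in> vertices K"
  shows "finite (half_space_interval K x y)"
proof -
  have "((adjacent K) ^^ gdist x y) x y" using gdist_walk[OF assms] .
  then obtain f where f: "f 0 = x" "f (gdist x y) = y" "\<And>i. i < gdist x y \<Longrightarrow> adjacent K (f i) (f (Suc i))"
    unfolding relpowp_fun_conv by auto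
  have "half_space_interval K x y \<subseteq> (\<lambda>i. side (f (Suc i)) (f i)) ` {..<gdist x y}"
  proof
    fix H assume "H \<in> half_space_interval K x y"
    then have H: "H \<in> half_spaces K" "y \<in> H" "x \<notin> H"
      unfolding half_space_interval_def compl_half_space_def by auto
    obtain a b where ab: "H = side a b" "adjacent K a b" using H(1) by (rule half_spaceE)
    have cross: "\<exists>i<n. f i \<notin> H \<and> f (Suc i) \<in> H" if "f n \<in> H" for n
      using that
    proof (induction n)
      case (Suc n)
      then show ?case by (cases "f n \<in> H") (auto intro: less_SucI)
    qed (use H(3) f(1) in simp)
    have "f (gdist x y) \<in> H" using H(2) f(2) by simp
    from cross[OF this] obtain i where i: "i < gdist x y" "f i \<notin> H" "f (Suc i) \<in> H" by blast
    have "H = side (f (Suc i)) (f i)"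
      using side_eq_of_crossing[OF ab(2) adjacent_sym[OF f(3)[OF i(1)]]] i(2,3) ab(1) by simp
    then show "H \<in> (\<lambda>i. side (f (Suc i)) (f i)) ` {..<gdist x y}" using i(1) by blast
  qed
  then show ?thesis by (rule finite_subset) simp
qed

end

section \<open>Segments and the action\<close>

lemma tightly_nested_iff:
  "H' \<subset> H \<Longrightarrow> tightly_nested K H H' \<longleftrightarrow> \<not> (\<exists>H''\<in>half_spaces K. H' \<subset> H'' \<and> H'' \<subset> H)"
  unfolding tightly_nested_def by blast

text \<open>The ordered form of a segment with tightness unfolded; it restores the order that the
  set of members only encodes.\<close>

definition descending :: "'v set set \<Rightarrow> 'v set list \<Rightarrow> bool" where
  "descending K Hs \<longleftrightarrow> Hs \<noteq> [] \<and> set Hs \<subseteq> half_spaces K \<and> (\<forall>i. Suc i < length Hs \<longrightarrow>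
     Hs ! Suc i \<subset> Hs ! i \<and> \<not> (\<exists>H\<in>half_spaces K. Hs ! Suc i \<subset> H \<and> H \<subset> Hs ! i))"

lemma segment_iff: "segment K \<delta> \<longleftrightarrow> (\<exists>Hs. descending K Hs \<and> set Hs = \<delta>)"
proof
  assume "segment K \<delta>"
  then obtain Hs where Hs: "Hs \<noteq> []" "set Hs = \<delta>" "set Hs \<subseteq> half_spaces K"
    "\<forall>i. Suc i < length Hs \<longrightarrow> Hs ! Suc i \<subset> Hs ! i \<and> tightly_nested K (Hs ! i) (Hs ! Suc i)"
    unfolding segment_def by (elim exE conjE)
  have "descending K Hs"
    unfolding descending_def
  proof (intro conjI allI impI)
    fix i assume i: "Suc i < length Hs"
    have t: "Hs ! Suc i \<subset> Hs ! i" "tightly_nested K (Hs ! i) (Hs ! Suc i)" using Hs(4) i by simp_all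
    show "Hs ! Suc i \<subset> Hs ! i" by (rule t)
    show "\<not> (\<exists>H\<in>half_spaces K. Hs ! Suc i \<subset> H \<and> H \<subset> Hs ! i)" using t(2) unfolding tightly_nested_iff[OF t(1)] .
  qed (use Hs in simp_all)
  then show "\<exists>Hs. descending K Hs \<and> set Hs = \<delta>" using Hs(2) by blast
next
  assume "\<exists>Hs. descending K Hs \<and> set Hs = \<delta>"
  then obtain Hs where Hs: "descending K Hs" "set Hs = \<delta>" by blast
  show "segment K \<delta>"
    unfolding segment_def
  proof (intro exI[of _ Hs] conjI allI impI)
    fix i assume i: "Suc i < length Hs"
    show s: "Hs ! Suc i \<subset> Hs ! i" using Hs(1) i unfolding descending_def by simp
    show "tightly_nested K (Hs ! i) (Hs ! Suc i)"
      unfolding tightly_nested_iff[OF s] using Hs(1) i unfolding descending_def by simp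
  qed (use Hs in \<open>simp_all add: descending_def\<close>)
qed

lemma descending_nth:
  assumes "descending K Hs" "i < j" "j < length Hs"
  shows "Hs ! j \<subset> Hs ! i"
  using assms(2,3)
proof (induction j)
  case (Suc j)
  have s: "Hs ! Suc j \<subset> Hs ! j" using assms(1) Suc.prems(2) unfolding descending_def by simp
  show ?case
  proof (cases "i = j")
    case False
    then have "Hs ! j \<subset> Hs ! i" using Suc by simp
    then show ?thesis using s by blast
  qed (use s in simp)
qed simp

lemma segment_half_spaces: "segment K \<delta> \<Longrightarrow> \<delta> \<subseteq> half_spaces K"
  unfolding segment_iff descending_def by blast

lemma segment_top:
  assumes "segment K \<delta>"
  shows "\<Union>\<delta> \<in> \<delta>"
proof -
  obtain Hs where Hs: "descending K Hs" "set Hs = \<delta>" using assms unfolding segment_iff by blast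
  have ne: "Hs \<noteq> []" using Hs(1) unfolding descending_def by simp
  have "H \<subseteq> Hs ! 0" if H: "H \<in> \<delta>" for H
  proof -
    obtain i where i: "i < length Hs" "H = Hs ! i" using H unfolding Hs(2)[symmetric] in_set_conv_nth by blast
    then show ?thesis using psubset_imp_subset[OF descending_nth[OF Hs(1), of 0 i]] by (cases "i = 0") simp_all
  qed
  moreover have "Hs ! 0 \<in> \<delta>" using ne Hs(2) by force
  ultimately have "\<Union>\<delta> = Hs ! 0" by blast
  then show ?thesis using \<open>Hs ! 0 \<in> \<delta>\<close> by simp
qed

text \<open>A discrete intermediate value argument: between \<open>A\<close> and \<open>B\<close>
  there are consecutive members where \<open>P\<close> stops to hold, and consecutive members are
  tight.\<close>

lemma segment_split:
  assumes "segment K \<delta>" "A \<in> \<delta>" "B \<in> \<delta>" "B \<subset> A" "P A" "\<not> P B"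
  obtains H H' where "H \<in> \<delta>" "H' \<in> \<delta>" "P H" "\<not> P H'" "H' \<subset> H"
    "\<not> (\<exists>E\<in>half_spaces K. H' \<subset> E \<and> E \<subset> H)"
proof -
  obtain Hs where Hs: "descending K Hs" "set Hs = \<delta>" using assms(1) unfolding segment_iff by blast
  obtain i j where ij: "i < length Hs" "A = Hs ! i" "j < length Hs" "B = Hs ! j"
    using assms(2,3) unfolding Hs(2)[symmetric] in_set_conv_nth by blast
  have "i < j"
  proof (rule ccontr)
    assume "\<not> i < j"
    then have "A \<subseteq> B" using psubset_imp_subset[OF descending_nth[OF Hs(1), of j i]] ij by (cases "i = j") simp_all
    then show False using assms(4) by blast
  qed
  have "\<exists>k<j. P (Hs ! k) \<and> \<not> P (Hs ! Suc k)"
  proof (rule ccontr)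
    assume no: "\<not> ?thesis"
    have "P (Hs ! k)" if "i \<le> k" "k \<le> j" for k
      using that
    proof (induction k rule: dec_induct)
      case (step k)
      then have "k < j" "P (Hs ! k)" by simp_all
      then show ?case using no by blast
    qed (use ij assms(5) in simp)
    then show False using \<open>i < j\<close> assms(6) ij(4) by simp
  qed
  then obtain k where k: "k < j" "P (Hs ! k)" "\<not> P (Hs ! Suc k)" by blast
  have "Suc k < length Hs" using k(1) ij(3) by simp
  then have "Hs ! Suc k \<subset> Hs ! k" "\<not> (\<exists>E\<in>half_spaces K. Hs ! Suc k \<subset> E \<and> E \<subset> Hs ! k)"
    "Hs ! k \<in> \<delta>" "Hs ! Suc k \<in> \<delta>"
    using Hs unfolding descending_def by auto
  then show ?thesis using that k(2,3) by blast
qed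

text \<open>Tightness survives because a half-space between two images is pulled back by the
  strictly monotone inverse \<open>f'\<close>.\<close>

lemma segment_image:
  assumes seg: "segment K \<delta>"
    and f: "\<And>H. H \<in> half_spaces K \<Longrightarrow> f H \<in> half_spaces K \<and> f' H \<in> half_spaces K \<and> f' (f H) = H \<and> f (f' H) = H"
    and mono: "\<And>H H'. H \<in> half_spaces K \<Longrightarrow> H' \<in> half_spaces K \<Longrightarrow> H \<subset> H' \<Longrightarrow> f H \<subset> f H' \<and> f' H \<subset> f' H'"
  shows "segment K (f ` \<delta>)"
proof -
  obtain Hs where Hs: "descending K Hs" "set Hs = \<delta>" using seg unfolding segment_iff by blast
  have "descending K (map f Hs)"
    unfolding descending_def
  proof (intro conjI allI impI)
    show "map f Hs \<noteq> []" using Hs(1) unfolding descending_def by simp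
    show "set (map f Hs) \<subseteq> half_spaces K" using Hs(1) f unfolding descending_def by auto
    fix i assume i: "Suc i < length (map f Hs)"
    let ?A = "Hs ! i" and ?B = "Hs ! Suc i"
    have AB: "?A \<in> half_spaces K" "?B \<in> half_spaces K" "?B \<subset> ?A"
      "\<not> (\<exists>E\<in>half_spaces K. ?B \<subset> E \<and> E \<subset> ?A)"
      using Hs(1) i unfolding descending_def by auto
    have n: "map f Hs ! i = f ?A" "map f Hs ! Suc i = f ?B" using i by simp_all
    show "map f Hs ! Suc i \<subset> map f Hs ! i" unfolding n using mono[OF AB(2,1,3)] by simp
    show "\<not> (\<exists>E\<in>half_spaces K. map f Hs ! Suc i \<subset> E \<and> E \<subset> map f Hs ! i)"
      unfolding n
    proof
      assume "\<exists>E\<in>half_spaces K. f ?B \<subset> E \<and> E \<subset> f ?A"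
      then obtain E where E: "E \<in> half_spaces K" "f ?B \<subset> E" "E \<subset> f ?A" by blast
      have fAB: "f ?A \<in> half_spaces K" "f ?B \<in> half_spaces K" using f[OF AB(1)] f[OF AB(2)] by simp_all
      have "f' (f ?B) \<subset> f' E" "f' E \<subset> f' (f ?A)" using mono[OF fAB(2) E(1,2)] mono[OF E(1) fAB(1) E(3)] by simp_all
      then have "?B \<subset> f' E" "f' E \<subset> ?A" using f[OF AB(1)] f[OF AB(2)] by simp_all
      then show False using AB(4) f[OF E(1)] by blast
    qed
  qed
  then show ?thesis unfolding segment_iff using Hs(2) by (intro exI[of _ "map f Hs"]) simp
qed

context CAT0_complex
begin

abbreviation "compl \<equiv> compl_half_space K"

lemma compl_compl: "H \<in> half_spaces K \<Longrightarrow> compl (compl H) = H"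
  using half_space_subset unfolding compl_half_space_def by blast

lemma compl_strict:
  "H \<in> half_spaces K \<Longrightarrow> H' \<in> half_spaces K \<Longrightarrow> H \<subset> H' \<Longrightarrow> compl H' \<subset> compl H"
  using half_space_subset[of H] half_space_subset[of H'] unfolding compl_half_space_def by blast

lemma segment_inverse:
  assumes "segment K \<delta>"
  shows "segment K (inverse_segment K \<delta>)"
proof -
  obtain Hs where Hs: "descending K Hs" "set Hs = \<delta>" using assms unfolding segment_iff by blast
  let ?L = "rev (map compl Hs)"
  have "descending K ?L"
    unfolding descending_def
  proof (intro conjI allI impI)
    show "?L \<noteq> []" using Hs(1) unfolding descending_def by simp
    show "set ?L \<subseteq> half_spaces K" using Hs(1) compl_half_space_in unfolding descending_def by auto
    fix i assume i: "Suc i < length ?L"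
    define j where "j = length Hs - Suc (Suc i)"
    have j: "Suc j < length Hs" "length Hs - Suc i = Suc j" "length Hs - Suc (Suc i) = j"
      using i unfolding j_def by auto
    let ?A = "Hs ! j" and ?B = "Hs ! Suc j"
    have AB: "?A \<in> half_spaces K" "?B \<in> half_spaces K" "?B \<subset> ?A"
      "\<not> (\<exists>E\<in>half_spaces K. ?B \<subset> E \<and> E \<subset> ?A)"
      using Hs(1) j(1) unfolding descending_def by auto
    have n: "?L ! i = compl ?B" "?L ! Suc i = compl ?A"
      using i j by (simp_all add: rev_nth)
    show "?L ! Suc i \<subset> ?L ! i" unfolding n using compl_strict[OF AB(2,1,3)] .
    show "\<not> (\<exists>E\<in>half_spaces K. ?L ! Suc i \<subset> E \<and> E \<subset> ?L ! i)"
      unfolding n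
    proof
      assume "\<exists>E\<in>half_spaces K. compl ?A \<subset> E \<and> E \<subset> compl ?B"
      then obtain E where E: "E \<in> half_spaces K" "compl ?A \<subset> E" "E \<subset> compl ?B" by blast
      have "compl E \<subset> compl (compl ?A)" "compl (compl ?B) \<subset> compl E"
        using compl_strict[OF compl_half_space_in[OF AB(1)] E(1,2)]
          compl_strict[OF E(1) compl_half_space_in[OF AB(2)] E(3)] .
      then show False using AB(4) compl_half_space_in[OF E(1)] compl_compl[OF AB(1)] compl_compl[OF AB(2)] by auto
    qed
  qed
  then show ?thesis unfolding segment_iff inverse_segment_def using Hs(2) by (intro exI[of _ ?L]) simp
qed

text \<open>The vertices \<open>y\<close> and \<open>x\<close> witness two of the four
  intersections, so one of the other two is empty, and each of these means an inclusion.\<close>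

lemma nested_if_not_transverse:
  assumes "\<not> transverse K H H'" "x \<in> vertices K" "x \<notin> H" "x \<notin> H'" "y \<in> H" "y \<in> H'"
    "H \<in> half_spaces K" "H' \<in> half_spaces K"
  shows "H \<subseteq> H' \<or> H' \<subseteq> H"
proof -
  have "H \<inter> H' \<noteq> {}" "compl H \<inter> compl H' \<noteq> {}"
    using assms(2-6) unfolding compl_half_space_def by blast+
  then have "H \<inter> compl H' = {} \<or> compl H \<inter> H' = {}" using assms(1) unfolding transverse_def by blast
  then show ?thesis
    using half_space_subset[OF assms(7)] half_space_subset[OF assms(8)] unfolding compl_half_space_def by blast
qed

text \<open>This is what tightness is for: a half-space comparable with all members, below some and
  above others, would lie strictly between two consecutive ones.\<close>

lemma segment_one_sided:
  assumes seg: "segment K \<delta>" and E: "E \<in> half_spaces K" and cmp: "\<And>H. H \<in> \<delta> \<Longrightarrow> E \<subset> H \<or> H \<subset> E"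
  shows "(\<forall>H\<in>\<delta>. E \<subset> H) \<or> (\<forall>H\<in>\<delta>. H \<subset> E)"
proof (rule ccontr)
  assume "\<not> ?thesis"
  then obtain A B where AB: "A \<in> \<delta>" "E \<subset> A" "B \<in> \<delta>" "\<not> E \<subset> B" using cmp by blast
  have "B \<subset> A" using cmp[OF AB(3)] AB(2,4) by blast
  then obtain P Q where PQ: "P \<in> \<delta>" "Q \<in> \<delta>" "E \<subset> P" "\<not> E \<subset> Q" "Q \<subset> P"
      "\<not> (\<exists>F\<in>half_spaces K. Q \<subset> F \<and> F \<subset> P)"
    by (rule segment_split[OF seg AB(1,3) _ AB(2,4)])
  then show False using cmp[OF PQ(2)] E by blast
qed

lemma not_transverse_if_subset: "H \<subseteq> H' \<Longrightarrow> \<not> transverse K H H'"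
  unfolding transverse_def compl_half_space_def by blast

lemma transverse_sym: "transverse K H H' \<longleftrightarrow> transverse K H' H"
  unfolding transverse_def by (simp add: Int_commute conj_ac)

lemma overlap_sym: "overlap K \<delta> \<epsilon> \<longleftrightarrow> overlap K \<epsilon> \<delta>"
  unfolding overlap_def using transverse_sym by blast

lemma transverse_compl:
  assumes "H \<in> half_spaces K" "H' \<in> half_spaces K"
  shows "transverse K (compl H) (compl H') \<longleftrightarrow> transverse K H H'"
  unfolding transverse_def compl_compl[OF assms(1)] compl_compl[OF assms(2)] by blast

end

section \<open>The induced action on half-spaces\<close>

locale CAT0_action = CAT0_complex K
  for K :: "'v set set" +
  fixes G :: "('g, 'b) monoid_scheme" and \<alpha> :: "'g \<Rightarrow> 'v \<Rightarrow> 'v"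
  assumes non_transverse: "non_transverse_action G K \<alpha>"
begin

lemma cubical_action: "cubical_action G K \<alpha>"
  using non_transverse unfolding non_transverse_action_def by blast

sublocale group_action G "vertices K" \<alpha>
  using cubical_action unfolding cubical_action_def by blast

lemma group_G: "group G"
  using group_hom group_hom.axioms(1) by blast

sublocale group G
  by (rule group_G)

lemma act_vertex: "g \<in> carrier G \<Longrightarrow> v \<in> vertices K \<Longrightarrow> \<alpha> g v \<in> vertices K"
  using surj_prop by blast

lemma act_inv:
  assumes "g \<in> carrier G" "v \<in> vertices K"
  shows "\<alpha> (inv\<^bsub>G\<^esub> g) (\<alpha> g v) = v"
  using orbit_sym_aux[OF assms refl] .

lemma act_inv':
  assumes "g \<in> carrier G" "v \<in> vertices K"
  shows "\<alpha> g (\<alpha> (inv\<^bsub>G\<^esub> g) v) = v"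
  using act_inv[of "inv\<^bsub>G\<^esub> g" v] assms by simp

lemma act_inv_image:
  assumes "g \<in> carrier G" "S \<subseteq> vertices K"
  shows "\<alpha> (inv\<^bsub>G\<^esub> g) ` \<alpha> g ` S = S" "\<alpha> g ` \<alpha> (inv\<^bsub>G\<^esub> g) ` S = S"
proof -
  have "\<alpha> (inv\<^bsub>G\<^esub> g) (\<alpha> g v) = v" "\<alpha> g (\<alpha> (inv\<^bsub>G\<^esub> g) v) = v" if "v \<in> S" for v
    using act_inv[OF assms(1)] act_inv'[OF assms(1)] that assms(2) by blast+
  then show "\<alpha> (inv\<^bsub>G\<^esub> g) ` \<alpha> g ` S = S" "\<alpha> g ` \<alpha> (inv\<^bsub>G\<^esub> g) ` S = S"
    by (simp_all add: image_image)
qed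

lemma act_inj: "g \<in> carrier G \<Longrightarrow> u \<in> vertices K \<Longrightarrow> v \<in> vertices K \<Longrightarrow> \<alpha> g u = \<alpha> g v \<longleftrightarrow> u = v"
  using inj_on_eq_iff[OF inj_prop] by simp

lemma act_adjacent:
  assumes g: "g \<in> carrier G" and uv: "adjacent K u v"
  shows "adjacent K (\<alpha> g u) (\<alpha> g v)"
proof -
  have V: "u \<in> vertices K" "v \<in> vertices K" "u \<noteq> v" using adjacent_vertices[OF uv] adjacent_neq[OF uv] by simp_all
  have "{u, v} \<in> K" using uv by (simp add: adjacent_def edges_def)
  then have "\<alpha> g ` {u, v} \<in> K" using cubical_action g unfolding cubical_action_def by blast
  moreover have "\<alpha> g u \<noteq> \<alpha> g v" using act_inj[OF g V(1,2)] V(3) by simp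
  ultimately show ?thesis by (simp add: adjacent_def edges_def)
qed

lemma act_gdist:
  assumes g: "g \<in> carrier G" and uv: "u \<in> vertices K" "v \<in> vertices K"
  shows "gdist (\<alpha> g u) (\<alpha> g v) = gdist u v"
proof -
  have walk: "((adjacent K) ^^ n) (\<alpha> h x) (\<alpha> h y)" if "h \<in> carrier G" "((adjacent K) ^^ n) x y" for h n x y
    using that(2)
  proof (induction n arbitrary: y)
    case (Suc n)
    then obtain z where z: "((adjacent K) ^^ n) x z" "adjacent K z y" by auto
    show ?case by (rule relpowp_Suc_I[OF Suc.IH[OF z(1)] act_adjacent[OF that(1) z(2)]])
  qed simp
  have "((adjacent K) ^^ n) (\<alpha> g u) (\<alpha> g v) = ((adjacent K) ^^ n) u v" for n
    using walk[OF g] walk[OF inv_closed[OF g], of n "\<alpha> g u" "\<alpha> g v"] act_inv[OF g uv(1)] act_inv[OF g uv(2)] by auto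
  then show ?thesis unfolding gdist_def by simp
qed

lemma act_side:
  assumes g: "g \<in> carrier G" and ab: "adjacent K a b"
  shows "\<alpha> g ` side a b = side (\<alpha> g a) (\<alpha> g b)"
proof -
  have sub: "\<alpha> h ` side x y \<subseteq> side (\<alpha> h x) (\<alpha> h y)" if "h \<in> carrier G" "adjacent K x y" for h x y
    using act_gdist[OF that(1)] act_vertex[OF that(1)] adjacent_vertices[OF that(2)] unfolding side_def by auto
  have V: "a \<in> vertices K" "b \<in> vertices K" using adjacent_vertices[OF ab] by simp_all
  have "\<alpha> (inv\<^bsub>G\<^esub> g) ` side (\<alpha> g a) (\<alpha> g b) \<subseteq> side a b"
    using sub[OF inv_closed[OF g] act_adjacent[OF g ab]] act_inv[OF g V(1)] act_inv[OF g V(2)] by simp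
  then have "\<alpha> g ` \<alpha> (inv\<^bsub>G\<^esub> g) ` side (\<alpha> g a) (\<alpha> g b) \<subseteq> \<alpha> g ` side a b" by (rule image_mono)
  then have "side (\<alpha> g a) (\<alpha> g b) \<subseteq> \<alpha> g ` side a b"
    unfolding act_inv_image(2)[OF g side_subset] .
  then show ?thesis using sub[OF g ab] by blast
qed

lemma act_half_space:
  assumes "g \<in> carrier G" "H \<in> half_spaces K"
  shows "\<alpha> g ` H \<in> half_spaces K"
proof -
  obtain a b where ab: "H = side a b" "adjacent K a b" using assms(2) by (rule half_spaceE)
  show ?thesis using act_side[OF assms(1) ab(2)] side_half_space[OF act_adjacent[OF assms(1) ab(2)]] ab(1) by simp
qed

lemma act_compl:
  assumes "g \<in> carrier G" "S \<subseteq> vertices K"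
  shows "\<alpha> g ` (vertices K - S) = vertices K - \<alpha> g ` S"
  using inj_on_image_set_diff[OF inj_prop[OF assms(1)], of "vertices K" S] surj_prop[OF assms(1)] assms(2) by auto

lemma act_strict:
  assumes "g \<in> carrier G" "H' \<subseteq> vertices K" "H \<subset> H'"
  shows "\<alpha> g ` H \<subset> \<alpha> g ` H'"
  by (rule image_strict_mono[OF inj_on_subset[OF inj_prop[OF assms(1)] assms(2)] assms(3)])

lemma act_Int_empty:
  assumes "g \<in> carrier G" "S \<subseteq> vertices K" "S' \<subseteq> vertices K"
  shows "\<alpha> g ` S \<inter> \<alpha> g ` S' = {} \<longleftrightarrow> S \<inter> S' = {}"
  using inj_on_image_Int[OF inj_prop[OF assms(1)] assms(2,3)] by (metis image_is_empty)

lemma act_transverse: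
  assumes "g \<in> carrier G" "H \<in> half_spaces K" "H' \<in> half_spaces K"
  shows "transverse K (\<alpha> g ` H) (\<alpha> g ` H') \<longleftrightarrow> transverse K H H'"
proof -
  have V: "H \<subseteq> vertices K" "H' \<subseteq> vertices K" "vertices K - H \<subseteq> vertices K" "vertices K - H' \<subseteq> vertices K"
    using half_space_subset assms(2,3) by blast+
  show ?thesis
    unfolding transverse_def compl_half_space_def act_compl[OF assms(1) V(1), symmetric]
      act_compl[OF assms(1) V(2), symmetric]
    using act_Int_empty[OF assms(1)] V by simp
qed

text \<open>Translating by the inverse of \<open>g\<close> reduces two translates of
  \<open>H\<close> to \<open>H\<close> and one translate.\<close>

lemma orbit_not_transverse:
  assumes g: "g \<in> carrier G" "h \<in> carrier G" and H: "H \<in> half_spaces K"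
  shows "\<not> transverse K (\<alpha> g ` H) (\<alpha> h ` H)"
proof -
  have k: "inv\<^bsub>G\<^esub> g \<otimes>\<^bsub>G\<^esub> h \<in> carrier G" using g by simp
  have "\<alpha> g ` \<alpha> (inv\<^bsub>G\<^esub> g \<otimes>\<^bsub>G\<^esub> h) ` H = \<alpha> h ` H"
  proof -
    have "\<alpha> (inv\<^bsub>G\<^esub> g \<otimes>\<^bsub>G\<^esub> h) v = \<alpha> (inv\<^bsub>G\<^esub> g) (\<alpha> h v)" if "v \<in> H" for v
      using composition_rule[OF _ inv_closed[OF g(1)] g(2)] half_space_subset[OF H] that by blast
    then have "\<alpha> (inv\<^bsub>G\<^esub> g \<otimes>\<^bsub>G\<^esub> h) ` H = \<alpha> (inv\<^bsub>G\<^esub> g) ` \<alpha> h ` H" by (simp add: image_image)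
    then show ?thesis using act_inv_image(2)[OF g(1)] half_space_subset[OF act_half_space[OF g(2) H]] by simp
  qed
  moreover have "\<not> transverse K H (\<alpha> (inv\<^bsub>G\<^esub> g \<otimes>\<^bsub>G\<^esub> h) ` H)"
    using non_transverse k H unfolding non_transverse_action_def by blast
  ultimately show ?thesis using act_transverse[OF g(1) H act_half_space[OF k H]] by simp
qed

end

section \<open>Counting non-overlapping copies\<close>

context CAT0_action
begin

definition nonoverlapping_copies :: "'v set set \<Rightarrow> 'v set set \<Rightarrow> 'v set set set \<Rightarrow> bool" where
  "nonoverlapping_copies \<gamma> S \<C> \<longleftrightarrow> \<C> \<subseteq> copies G \<alpha> \<gamma> \<and> (\<forall>\<delta>\<in>\<C>. \<delta> \<subseteq> S) \<and>
     pairwise (\<lambda>\<delta> \<delta>'. \<not> overlap K \<delta> \<delta>') \<C>"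

text \<open>The count is taken in an arbitrary set of half-spaces, because the parts into which a
  third vertex divides an interval need not be intervals.\<close>

definition count_in :: "'v set set \<Rightarrow> 'v set set \<Rightarrow> nat" where
  "count_in \<gamma> S = Max {card \<C> |\<C>. nonoverlapping_copies \<gamma> S \<C>}"

text \<open>Singletons give intervals, and a pair on either side gives the part of an interval whose
  half-spaces contain, or miss, a third vertex. Taking complements exchanges the two
  arguments.\<close>

definition separating :: "'v set \<Rightarrow> 'v set \<Rightarrow> 'v set set" where
  "separating A B = {H \<in> half_spaces K. A \<inter> H = {} \<and> B \<subseteq> H}"

lemma interval_separating: "x \<in> vertices K \<Longrightarrow> half_space_interval K x y = separating {x} {y}"
  unfolding half_space_interval_def separating_def compl_half_space_def by auto

lemma copy_count_eq: "copy_count G K \<alpha> \<gamma> x y = count_in \<gamma> (half_space_interval K x y)"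
  unfolding copy_count_def count_in_def nonoverlapping_copies_def ..

lemma finite_cards:
  assumes "finite S"
  shows "finite {card \<C> |\<C>. nonoverlapping_copies \<gamma> S \<C>}"
proof -
  have "{card \<C> |\<C>. nonoverlapping_copies \<gamma> S \<C>} \<subseteq> card ` Pow (Pow S)"
    unfolding nonoverlapping_copies_def by auto
  then show ?thesis by (rule finite_subset) (simp add: assms)
qed

lemma card_le_count:
  assumes "finite S" "nonoverlapping_copies \<gamma> S \<C>"
  shows "card \<C> \<le> count_in \<gamma> S"
  unfolding count_in_def by (rule Max_ge[OF finite_cards[OF assms(1)]]) (use assms(2) in blast)

lemma count_attained:
  assumes "finite S"
  obtains \<C> where "nonoverlapping_copies \<gamma> S \<C>" "finite \<C>" "card \<C> = count_in \<gamma> S"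
proof -
  have "nonoverlapping_copies \<gamma> S {}" unfolding nonoverlapping_copies_def by simp
  then have "{card \<C> |\<C>. nonoverlapping_copies \<gamma> S \<C>} \<noteq> {}" by blast
  from Max_in[OF finite_cards[OF assms] this] obtain \<C> where C: "nonoverlapping_copies \<gamma> S \<C>" "card \<C> = count_in \<gamma> S"
    unfolding count_in_def by auto
  have "\<C> \<subseteq> Pow S" using C(1) unfolding nonoverlapping_copies_def by blast
  then have "finite \<C>" by (rule finite_subset) (simp add: assms)
  then show ?thesis using that C by blast
qed

lemma nonoverlapping_subset:
  assumes "nonoverlapping_copies \<gamma> S \<C>" "\<D> \<subseteq> \<C>" "\<And>\<delta>. \<delta> \<in> \<D> \<Longrightarrow> \<delta> \<subseteq> S'"
  shows "nonoverlapping_copies \<gamma> S' \<D>"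
  using assms unfolding nonoverlapping_copies_def by (meson pairwise_subset subset_trans)

text \<open>The common core of invariance under the group and of duality under complements. Both
  maps are bijective on half-spaces, so equality comes from applying the inequality in both
  directions.\<close>

lemma count_image_le:
  assumes S: "finite S" "S \<subseteq> half_spaces K"
    and f: "inj_on f (half_spaces K)"
    and copies: "\<And>\<delta>. \<delta> \<in> copies G \<alpha> \<gamma> \<Longrightarrow> \<delta> \<subseteq> S \<Longrightarrow> f ` \<delta> \<in> copies G \<alpha> \<gamma>'"
    and tr: "\<And>H H'. H \<in> half_spaces K \<Longrightarrow> H' \<in> half_spaces K \<Longrightarrow> transverse K (f H) (f H') \<Longrightarrow> transverse K H H'"
  shows "count_in \<gamma> S \<le> count_in \<gamma>' (f ` S)"
proof -
  obtain \<C> where C: "nonoverlapping_copies \<gamma> S \<C>" "finite \<C>" "card \<C> = count_in \<gamma> S"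
    using count_attained[OF S(1)] by blast
  have sub: "\<delta> \<subseteq> half_spaces K" if "\<delta> \<in> \<C>" for \<delta>
    using C(1) S(2) that unfolding nonoverlapping_copies_def by blast
  have inj: "inj_on ((`) f) \<C>"
    by (rule inj_on_subset[OF inj_on_image_Pow[OF f]]) (use sub in blast)
  have "nonoverlapping_copies \<gamma>' (f ` S) ((`) f ` \<C>)"
    unfolding nonoverlapping_copies_def
  proof (intro conjI ballI)
    show "(`) f ` \<C> \<subseteq> copies G \<alpha> \<gamma>'"
      using C(1) copies unfolding nonoverlapping_copies_def by blast
    show "\<delta> \<subseteq> f ` S" if "\<delta> \<in> (`) f ` \<C>" for \<delta>
      using C(1) that unfolding nonoverlapping_copies_def by blast
    show "pairwise (\<lambda>\<delta> \<delta>'. \<not> overlap K \<delta> \<delta>') ((`) f ` \<C>)"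
    proof (rule pairwiseI)
      fix x y assume "x \<in> (`) f ` \<C>" "y \<in> (`) f ` \<C>" "x \<noteq> y"
      then obtain \<delta> \<epsilon> where de: "x = f ` \<delta>" "y = f ` \<epsilon>" "\<delta> \<in> \<C>" "\<epsilon> \<in> \<C>" "\<delta> \<noteq> \<epsilon>" by blast
      have no: "\<not> overlap K \<delta> \<epsilon>" using C(1) de(3-5) unfolding nonoverlapping_copies_def pairwise_def by blast
      have "f ` \<delta> \<inter> f ` \<epsilon> = {}"
        using inj_on_image_Int[OF f sub[OF de(3)] sub[OF de(4)]] no unfolding overlap_def by simp
      moreover have "\<not> transverse K (f H) (f H')" if "H \<in> \<delta>" "H' \<in> \<epsilon>" for H H'
      proof
        assume "transverse K (f H) (f H')"
        then have "transverse K H H'" using tr sub[OF de(3)] sub[OF de(4)] that by blast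
        then show False using no that unfolding overlap_def by blast
      qed
      ultimately show "\<not> overlap K x y" unfolding overlap_def de(1,2) by blast
    qed
  qed
  then have "card ((`) f ` \<C>) \<le> count_in \<gamma>' (f ` S)" by (rule card_le_count[rotated]) (simp add: S(1))
  then show ?thesis using card_image[OF inj] C(3) by simp
qed

section \<open>Invariance of the counts under translation and complementation\<close>

lemma copyE:
  assumes "\<delta> \<in> copies G \<alpha> \<gamma>"
  obtains g where "g \<in> carrier G" "\<delta> = (`) (\<alpha> g) ` \<gamma>"
  using assms unfolding copies_def by blast

lemma act_image_comp:
  assumes "g \<in> carrier G" "h \<in> carrier G" "H \<subseteq> vertices K"
  shows "\<alpha> g ` \<alpha> h ` H = \<alpha> (g \<otimes>\<^bsub>G\<^esub> h) ` H"
proof -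
  have "\<alpha> (g \<otimes>\<^bsub>G\<^esub> h) v = \<alpha> g (\<alpha> h v)" if "v \<in> H" for v
    using composition_rule[OF _ assms(1,2)] assms(3) that by blast
  then show ?thesis by (simp add: image_image)
qed

lemma act_copy:
  assumes g: "g \<in> carrier G" and \<delta>: "\<delta> \<in> copies G \<alpha> \<gamma>" and \<gamma>: "\<gamma> \<subseteq> half_spaces K"
  shows "(`) (\<alpha> g) ` \<delta> \<in> copies G \<alpha> \<gamma>"
proof -
  obtain h where h: "h \<in> carrier G" "\<delta> = (`) (\<alpha> h) ` \<gamma>" using \<delta> by (rule copyE)
  have "\<alpha> g ` \<alpha> h ` H = \<alpha> (g \<otimes>\<^bsub>G\<^esub> h) ` H" if "H \<in> \<gamma>" for H
    using act_image_comp[OF g h(1)] half_space_subset \<gamma> that by blast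
  then have "(`) (\<alpha> g) ` \<delta> = (`) (\<alpha> (g \<otimes>\<^bsub>G\<^esub> h)) ` \<gamma>" unfolding h(2) by (simp add: image_image)
  then show ?thesis using g h(1) unfolding copies_def by blast
qed

lemma act_inj_half_spaces: "g \<in> carrier G \<Longrightarrow> inj_on ((`) (\<alpha> g)) (half_spaces K)"
  by (rule inj_on_subset[OF inj_on_image_Pow[OF inj_prop]]) (use half_space_subset in blast)+

lemma act_separating:
  assumes g: "g \<in> carrier G" and AB: "A \<subseteq> vertices K" "B \<subseteq> vertices K"
  shows "(`) (\<alpha> g) ` separating A B = separating (\<alpha> g ` A) (\<alpha> g ` B)"
proof -
  have sub: "(`) (\<alpha> h) ` separating X Y \<subseteq> separating (\<alpha> h ` X) (\<alpha> h ` Y)"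
    if h: "h \<in> carrier G" and XY: "X \<subseteq> vertices K" "Y \<subseteq> vertices K" for h X Y
  proof
    fix H' assume "H' \<in> (`) (\<alpha> h) ` separating X Y"
    then obtain H where H: "H' = \<alpha> h ` H" "H \<in> half_spaces K" "X \<inter> H = {}" "Y \<subseteq> H"
      unfolding separating_def by blast
    have "\<alpha> h ` X \<inter> \<alpha> h ` H = {}" using act_Int_empty[OF h XY(1) half_space_subset[OF H(2)]] H(3) by simp
    then show "H' \<in> separating (\<alpha> h ` X) (\<alpha> h ` Y)"
      unfolding separating_def using act_half_space[OF h H(2)] H(1,4) by blast
  qed
  show ?thesis
  proof
    show "separating (\<alpha> g ` A) (\<alpha> g ` B) \<subseteq> (`) (\<alpha> g) ` separating A B"
    proof
      fix H assume H: "H \<in> separating (\<alpha> g ` A) (\<alpha> g ` B)"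
      have V: "\<alpha> g ` A \<subseteq> vertices K" "\<alpha> g ` B \<subseteq> vertices K" using AB act_vertex[OF g] by blast+
      have "(`) (\<alpha> (inv\<^bsub>G\<^esub> g)) ` separating (\<alpha> g ` A) (\<alpha> g ` B) \<subseteq> separating A B"
        using sub[OF inv_closed[OF g] V] unfolding act_inv_image(1)[OF g AB(1)] act_inv_image(1)[OF g AB(2)] .
      then have "\<alpha> (inv\<^bsub>G\<^esub> g) ` H \<in> separating A B" using imageI[OF H] by (rule subsetD)
      moreover have "H \<subseteq> vertices K" using H half_space_subset unfolding separating_def by blast
      then have "H = \<alpha> g ` \<alpha> (inv\<^bsub>G\<^esub> g) ` H" using act_inv_image(2)[OF g] by simp
      ultimately show "H \<in> (`) (\<alpha> g) ` separating A B" by (rule image_eqI[rotated])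
    qed
  qed (rule sub[OF g AB])
qed

lemma finite_separating:
  assumes "x \<in> A" "y \<in> B" "x \<in> vertices K" "y \<in> vertices K"
  shows "finite (separating A B)"
proof -
  have "separating A B \<subseteq> half_space_interval K x y"
    using assms(1,2) unfolding interval_separating[OF assms(3)] unfolding separating_def by blast
  then show ?thesis using finite_half_space_interval[OF assms(3,4)] finite_subset by blast
qed

lemma separating_half_spaces: "separating A B \<subseteq> half_spaces K"
  unfolding separating_def by blast

lemma count_act:
  assumes g: "g \<in> carrier G" and \<gamma>: "\<gamma> \<subseteq> half_spaces K"
    and AB: "A \<subseteq> vertices K" "B \<subseteq> vertices K" "A \<noteq> {}" "B \<noteq> {}"
  shows "count_in \<gamma> (separating (\<alpha> g ` A) (\<alpha> g ` B)) = count_in \<gamma> (separating A B)"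
proof -
  have le: "count_in \<gamma> (separating X Y) \<le> count_in \<gamma> (separating (\<alpha> h ` X) (\<alpha> h ` Y))"
    if h: "h \<in> carrier G" and XY: "X \<subseteq> vertices K" "Y \<subseteq> vertices K" "X \<noteq> {}" "Y \<noteq> {}" for h X Y
  proof -
    obtain x y where "x \<in> X" "y \<in> Y" using XY(3,4) by blast
    then have fin: "finite (separating X Y)" using finite_separating XY(1,2) by blast
    show ?thesis
      unfolding act_separating[OF h XY(1,2), symmetric]
      by (rule count_image_le[OF fin separating_half_spaces act_inj_half_spaces[OF h] act_copy[OF h _ \<gamma>]])
        (simp_all add: act_transverse[OF h])
  qed
  have V: "\<alpha> g ` A \<subseteq> vertices K" "\<alpha> g ` B \<subseteq> vertices K" using AB act_vertex[OF g] by blast+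
  have "count_in \<gamma> (separating (\<alpha> g ` A) (\<alpha> g ` B)) \<le> count_in \<gamma> (separating A B)"
    using le[OF inv_closed[OF g] V] AB(3,4) act_inv_image(1)[OF g AB(1)] act_inv_image(1)[OF g AB(2)] by simp
  then show ?thesis using le[OF g AB] by simp
qed

lemma compl_separating:
  assumes "A \<subseteq> vertices K" "B \<subseteq> vertices K"
  shows "compl ` separating A B = separating B A"
proof -
  have sub: "compl H \<in> separating Y X"
    if "H \<in> separating X Y" "X \<subseteq> vertices K" for H X Y
    using that compl_half_space_in[of H] unfolding separating_def compl_half_space_def by blast
  show ?thesis
  proof
    show "separating B A \<subseteq> compl ` separating A B"
    proof
      fix H assume H: "H \<in> separating B A"
      then have "H = compl (compl H)" using compl_compl unfolding separating_def by simp
      then show "H \<in> compl ` separating A B" using sub[OF H assms(2)] by blast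
    qed
  qed (use sub assms(1) in blast)
qed

lemma compl_copy:
  assumes \<delta>: "\<delta> \<in> copies G \<alpha> \<gamma>" and \<gamma>: "\<gamma> \<subseteq> half_spaces K"
  shows "compl ` \<delta> \<in> copies G \<alpha> (inverse_segment K \<gamma>)"
proof -
  obtain g where g: "g \<in> carrier G" "\<delta> = (`) (\<alpha> g) ` \<gamma>" using \<delta> by (rule copyE)
  have "compl (\<alpha> g ` H) = \<alpha> g ` compl H" if "H \<in> \<gamma>" for H
    using act_compl[OF g(1), of H] half_space_subset[of H] \<gamma> that unfolding compl_half_space_def by auto
  then have "compl ` \<delta> = (`) (\<alpha> g) ` compl ` \<gamma>" unfolding g(2) by (simp add: image_image)
  then show ?thesis using g(1) unfolding copies_def inverse_segment_def by blast
qed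

lemma inverse_inverse: "\<gamma> \<subseteq> half_spaces K \<Longrightarrow> inverse_segment K (inverse_segment K \<gamma>) = \<gamma>"
  unfolding inverse_segment_def image_image using compl_compl by (simp add: subset_iff cong: image_cong_simp)

lemma inverse_half_spaces: "\<gamma> \<subseteq> half_spaces K \<Longrightarrow> inverse_segment K \<gamma> \<subseteq> half_spaces K"
  unfolding inverse_segment_def using compl_half_space_in by blast

text \<open>Complementation carries copies of \<open>\<gamma>\<close> to copies of its inverse and
  preserves transversality; this is the source of all cancellations among signed counts.\<close>

lemma count_inverse:
  assumes \<gamma>: "\<gamma> \<subseteq> half_spaces K" and AB: "A \<subseteq> vertices K" "B \<subseteq> vertices K" "A \<noteq> {}" "B \<noteq> {}"
  shows "count_in (inverse_segment K \<gamma>) (separating B A) = count_in \<gamma> (separating A B)"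
proof -
  have inj: "inj_on compl (half_spaces K)"
    by (rule inj_on_inverseI[of _ compl]) (rule compl_compl)
  have le: "count_in \<epsilon> (separating X Y) \<le> count_in (inverse_segment K \<epsilon>) (separating Y X)"
    if \<epsilon>: "\<epsilon> \<subseteq> half_spaces K" and XY: "X \<subseteq> vertices K" "Y \<subseteq> vertices K" "X \<noteq> {}" "Y \<noteq> {}" for \<epsilon> X Y
  proof -
    obtain x y where "x \<in> X" "y \<in> Y" using XY(3,4) by blast
    then have fin: "finite (separating X Y)" using finite_separating XY(1,2) by blast
    show ?thesis
      unfolding compl_separating[OF XY(1,2), symmetric]
      by (rule count_image_le[OF fin separating_half_spaces inj compl_copy[OF _ \<epsilon>]]) (simp_all add: transverse_compl)
  qed
  show ?thesis
    using le[OF \<gamma> AB] le[OF inverse_half_spaces[OF \<gamma>] AB(2,1,4,3)] inverse_inverse[OF \<gamma>] by simp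
qed

section \<open>Cutting a family of copies at a third vertex\<close>

lemma copy_segment:
  assumes "segment K \<gamma>" "\<delta> \<in> copies G \<alpha> \<gamma>"
  shows "segment K \<delta>"
proof -
  obtain g where g: "g \<in> carrier G" "\<delta> = (`) (\<alpha> g) ` \<gamma>" using assms(2) by (rule copyE)
  show ?thesis
    unfolding g(2)
  proof (rule segment_image[OF assms(1), where f' = "(`) (\<alpha> (inv\<^bsub>G\<^esub> g))"])
    fix H assume H: "H \<in> half_spaces K"
    show "\<alpha> g ` H \<in> half_spaces K \<and> \<alpha> (inv\<^bsub>G\<^esub> g) ` H \<in> half_spaces K \<and>
        \<alpha> (inv\<^bsub>G\<^esub> g) ` \<alpha> g ` H = H \<and> \<alpha> g ` \<alpha> (inv\<^bsub>G\<^esub> g) ` H = H"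
      using act_half_space[OF g(1) H] act_half_space[OF inv_closed[OF g(1)] H] act_inv_image[OF g(1) half_space_subset[OF H]]
      by simp
  next
    fix H H' assume "H \<in> half_spaces K" and H': "H' \<in> half_spaces K" and s: "H \<subset> H'"
    show "\<alpha> g ` H \<subset> \<alpha> g ` H' \<and> \<alpha> (inv\<^bsub>G\<^esub> g) ` H \<subset> \<alpha> (inv\<^bsub>G\<^esub> g) ` H'"
      using act_strict[OF g(1) half_space_subset[OF H'] s]
        act_strict[OF inv_closed[OF g(1)] half_space_subset[OF H'] s] by simp
  qed
qed

lemma copy_tops_not_transverse:
  assumes "segment K \<gamma>" "\<delta> \<in> copies G \<alpha> \<gamma>" "\<epsilon> \<in> copies G \<alpha> \<gamma>"
  shows "\<not> transverse K (\<Union>\<delta>) (\<Union>\<epsilon>)"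
proof -
  obtain g where g: "g \<in> carrier G" "\<delta> = (`) (\<alpha> g) ` \<gamma>" using assms(2) by (rule copyE)
  obtain h where h: "h \<in> carrier G" "\<epsilon> = (`) (\<alpha> h) ` \<gamma>" using assms(3) by (rule copyE)
  have "\<Union>\<delta> = \<alpha> g ` \<Union>\<gamma>" "\<Union>\<epsilon> = \<alpha> h ` \<Union>\<gamma>" unfolding g(2) h(2) by blast+
  moreover have "\<Union>\<gamma> \<in> half_spaces K" using segment_top[OF assms(1)] segment_half_spaces[OF assms(1)] by blast
  ultimately show ?thesis using orbit_not_transverse[OF g(1) h(1)] by simp
qed

lemma not_overlapping_one_sided:
  assumes V: "x \<in> vertices K" and seg: "segment K \<delta>" and sub: "\<delta> \<subseteq> separating {x} {y}" "\<epsilon> \<subseteq> separating {x} {y}"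
    and no: "\<not> overlap K \<delta> \<epsilon>" and E: "E \<in> \<epsilon>"
  shows "(\<forall>H\<in>\<delta>. E \<subset> H) \<or> (\<forall>H\<in>\<delta>. H \<subset> E)"
proof (rule segment_one_sided[OF seg])
  have ES: "E \<in> separating {x} {y}" using sub(2) E by blast
  then show "E \<in> half_spaces K" unfolding separating_def by simp
  fix H assume H: "H \<in> \<delta>"
  have HS: "H \<in> separating {x} {y}" using sub(1) H by blast
  have "\<not> transverse K H E" "H \<noteq> E" using no H E unfolding overlap_def by blast+
  then show "E \<subset> H \<or> H \<subset> E"
    using nested_if_not_transverse[OF _ V, of H E y] HS ES unfolding separating_def by auto
qed

text \<open>Pairwise non-overlapping copies contained in \<open>[x, y]\<close> form a chain. Cutting the chain at \<open>z\<close>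
  splits at most one copy.\<close>

lemma count_split_upper:
  assumes seg: "segment K \<gamma>" and V: "x \<in> vertices K" "y \<in> vertices K"
  shows "count_in \<gamma> (separating {x} {y}) \<le>
    count_in \<gamma> (separating {x} {y, z}) + count_in \<gamma> (separating {x, z} {y}) + 1"
proof -
  let ?S = "separating {x} {y}" and ?A = "separating {x} {y, z}" and ?B = "separating {x, z} {y}"
  have fin: "finite ?S" "finite ?A" "finite ?B"
    by (rule finite_separating[OF _ _ V]; simp)+
  obtain \<C> where C: "nonoverlapping_copies \<gamma> ?S \<C>" "finite \<C>" "card \<C> = count_in \<gamma> ?S"
    using count_attained[OF fin(1)] by blast
  define CA where "CA = {\<delta> \<in> \<C>. \<delta> \<subseteq> ?A}"
  define CB where "CB = {\<delta> \<in> \<C>. \<delta> \<subseteq> ?B}"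
  define CM where "CM = \<C> - CA - CB"
  have subS: "\<delta> \<subseteq> ?S" if "\<delta> \<in> \<C>" for \<delta> using C(1) that unfolding nonoverlapping_copies_def by simp
  have segC: "segment K \<delta>" if "\<delta> \<in> \<C>" for \<delta>
    by (rule copy_segment[OF seg]) (use C(1) that in \<open>auto simp: nonoverlapping_copies_def\<close>)
  have split: "(\<exists>H\<in>\<delta>. z \<in> H) \<and> (\<exists>H\<in>\<delta>. z \<notin> H)" if \<delta>: "\<delta> \<in> CM" for \<delta>
  proof -
    have d: "\<delta> \<in> \<C>" "\<not> \<delta> \<subseteq> ?A" "\<not> \<delta> \<subseteq> ?B" using \<delta> unfolding CM_def CA_def CB_def by simp_all
    have "\<delta> \<subseteq> ?A" if "\<forall>H\<in>\<delta>. z \<in> H"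
      using subS[OF d(1)] that unfolding separating_def by auto
    moreover have "\<delta> \<subseteq> ?B" if "\<forall>H\<in>\<delta>. z \<notin> H"
      using subS[OF d(1)] that unfolding separating_def by auto
    ultimately show ?thesis using d(2,3) by blast
  qed
  \<comment> \<open>\<open>E\<close> contains \<open>z\<close> and so cannot lie strictly inside the
    member of \<open>\<delta>\<close> that misses \<open>z\<close>; being on one side of all of
    \<open>\<delta>\<close>, it lies above. For two split copies this holds in both directions,
    which is absurd.\<close>
  have above: "H \<subset> E"
    if de: "\<delta> \<in> CM" "\<epsilon> \<in> CM" "\<delta> \<noteq> \<epsilon>" and H: "H \<in> \<delta>" and E: "E \<in> \<epsilon>" "z \<in> E" for \<delta> \<epsilon> H E
  proof -
    have dC: "\<delta> \<in> \<C>" "\<epsilon> \<in> \<C>" using de unfolding CM_def by blast+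
    then have no: "\<not> overlap K \<delta> \<epsilon>"
      using C(1) de(3) unfolding nonoverlapping_copies_def pairwise_def by blast
    obtain H' where "H' \<in> \<delta>" "z \<notin> H'" using split[OF de(1)] by blast
    then have "\<not> (\<forall>H\<in>\<delta>. E \<subset> H)" using E(2) by blast
    then show ?thesis
      using not_overlapping_one_sided[OF V(1) segC[OF dC(1)] subS[OF dC(1)] subS[OF dC(2)] no E(1)] H by blast
  qed
  have "\<delta> = \<epsilon>" if de: "\<delta> \<in> CM" "\<epsilon> \<in> CM" for \<delta> \<epsilon>
  proof (rule ccontr)
    assume ne: "\<delta> \<noteq> \<epsilon>"
    obtain H E where HE: "H \<in> \<delta>" "z \<in> H" "E \<in> \<epsilon>" "z \<in> E" using split[OF de(1)] split[OF de(2)] by blast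
    show False using above[OF de ne HE(1,3,4)] above[OF de(2,1) ne[symmetric] HE(3,1,2)] by blast
  qed
  then have "card CM \<le> 1" unfolding One_nat_def using C(2) by (subst card_le_Suc0_iff_eq) (auto simp: CM_def)
  moreover have "card CA \<le> count_in \<gamma> ?A"
  proof (rule card_le_count[OF fin(2) nonoverlapping_subset[OF C(1)]])
    show "CA \<subseteq> \<C>" unfolding CA_def by blast
    show "\<delta> \<subseteq> ?A" if "\<delta> \<in> CA" for \<delta> using that unfolding CA_def by simp
  qed
  moreover have "card CB \<le> count_in \<gamma> ?B"
  proof (rule card_le_count[OF fin(3) nonoverlapping_subset[OF C(1)]])
    show "CB \<subseteq> \<C>" unfolding CB_def by blast
    show "\<delta> \<subseteq> ?B" if "\<delta> \<in> CB" for \<delta> using that unfolding CB_def by simp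
  qed
  moreover have "card \<C> \<le> card CA + card CB + card CM"
  proof -
    have "CA \<subseteq> \<C>" "CB \<subseteq> \<C>" unfolding CA_def CB_def by simp_all
    then have "\<C> = CA \<union> CB \<union> CM" unfolding CM_def by blast
    then have "card \<C> = card (CA \<union> CB \<union> CM)" by (rule arg_cong)
    also have "\<dots> \<le> card (CA \<union> CB) + card CM" by (rule card_Un_le)
    also have "\<dots> \<le> card CA + card CB + card CM" by (intro add_right_mono card_Un_le)
    finally show ?thesis .
  qed
  ultimately show ?thesis using C(3) by linarith
qed

text \<open>Conversely, the tops of all copies lie in one orbit and are therefore nested. Dropping the lowest
  copy \<open>\<rho>\<close> above \<open>z\<close> leaves copies which all contain the top of \<open>\<rho>\<close>, and that contains every copy below \<open>z\<close>.\<close>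

lemma count_split_lower:
  assumes seg: "segment K \<gamma>" and V: "x \<in> vertices K" "y \<in> vertices K"
  shows "count_in \<gamma> (separating {x} {y, z}) + count_in \<gamma> (separating {x, z} {y}) \<le>
    count_in \<gamma> (separating {x} {y}) + 1"
proof -
  let ?S = "separating {x} {y}" and ?A = "separating {x} {y, z}" and ?B = "separating {x, z} {y}"
  have fin: "finite ?S" "finite ?A" "finite ?B"
    by (rule finite_separating[OF _ _ V]; simp)+
  have AS: "?A \<subseteq> ?S" "?B \<subseteq> ?S" unfolding separating_def by auto
  obtain C1 where C1: "nonoverlapping_copies \<gamma> ?A C1" "finite C1" "card C1 = count_in \<gamma> ?A"
    using count_attained[OF fin(2)] by blast
  obtain C2 where C2: "nonoverlapping_copies \<gamma> ?B C2" "finite C2" "card C2 = count_in \<gamma> ?B"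
    using count_attained[OF fin(3)] by blast
  have sub1: "\<delta> \<subseteq> ?A" and cop1: "\<delta> \<in> copies G \<alpha> \<gamma>" if "\<delta> \<in> C1" for \<delta>
    using C1(1) that unfolding nonoverlapping_copies_def by blast+
  have sub2: "\<delta> \<subseteq> ?B" and cop2: "\<delta> \<in> copies G \<alpha> \<gamma>" if "\<delta> \<in> C2" for \<delta>
    using C2(1) that unfolding nonoverlapping_copies_def by blast+
  have no1: "\<not> overlap K \<delta> \<epsilon>" if "\<delta> \<in> C1" "\<epsilon> \<in> C1" "\<delta> \<noteq> \<epsilon>" for \<delta> \<epsilon>
    using C1(1) that unfolding nonoverlapping_copies_def pairwise_def by blast
  have no2: "\<not> overlap K \<delta> \<epsilon>" if "\<delta> \<in> C2" "\<epsilon> \<in> C2" "\<delta> \<noteq> \<epsilon>" for \<delta> \<epsilon>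
    using C2(1) that unfolding nonoverlapping_copies_def pairwise_def by blast
  have top: "\<Union>\<delta> \<in> \<delta>" "segment K \<delta>" if "\<delta> \<in> copies G \<alpha> \<gamma>" for \<delta>
    using segment_top copy_segment[OF seg that] by blast+
  show ?thesis
  proof (cases "C1 = {}")
    case True
    have "nonoverlapping_copies \<gamma> ?S C2" by (rule nonoverlapping_subset[OF C2(1)]) (use sub2 AS in blast)+
    then have "card C2 \<le> count_in \<gamma> ?S" by (rule card_le_count[OF fin(1)])
    moreover have "count_in \<gamma> ?A = 0" using True C1(3) by simp
    ultimately show ?thesis using C2(3) by linarith
  next
    case False
    have "finite (Union ` C1)" "Union ` C1 \<noteq> {}" using C1(2) False by simp_all
    \<comment> \<open>A minimal element among the finitely many tops serves as the lowest copy,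
      without a prior proof that the copies form a chain.\<close>
    then obtain m where m: "m \<in> Union ` C1" "\<forall>b\<in>Union ` C1. b \<subseteq> m \<longrightarrow> m = b"
      using finite_has_minimal by metis
    then obtain \<rho> where \<rho>: "\<rho> \<in> C1" "m = \<Union>\<rho>" by blast
    have mr: "m \<in> \<rho>" using top(1)[OF cop1[OF \<rho>(1)]] \<rho>(2) by simp
    have mS: "m \<in> ?S" "z \<in> m" using subsetD[OF sub1[OF \<rho>(1)] mr] AS(1) unfolding separating_def by auto
    have above: "m \<subset> H" if \<delta>: "\<delta> \<in> C1" "\<delta> \<noteq> \<rho>" and H: "H \<in> \<delta>" for \<delta> H
    proof -
      have "\<not> \<Union>\<delta> \<subset> m" using m(2) \<delta>(1) by blast
      then have "\<not> (\<forall>H\<in>\<delta>. H \<subset> m)" using top(1)[OF cop1[OF \<delta>(1)]] by blast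
      then show ?thesis
        using not_overlapping_one_sided[OF V(1) top(2)[OF cop1[OF \<delta>(1)]] order_trans[OF sub1[OF \<delta>(1)] AS(1)]
            order_trans[OF sub1[OF \<rho>(1)] AS(1)] no1[OF \<delta>(1) \<rho>(1) \<delta>(2)] mr] H by blast
    qed
    \<comment> \<open>The two tops are nested, and \<open>z\<close> lies in \<open>m\<close> but not
      in the top of \<open>\<epsilon>\<close>, so only one of the inclusions is possible.\<close>
    have below: "H' \<subset> m" if \<epsilon>: "\<epsilon> \<in> C2" and H': "H' \<in> \<epsilon>" for \<epsilon> H'
    proof -
      have tB: "\<Union>\<epsilon> \<in> ?B" using subsetD[OF sub2[OF \<epsilon>] top(1)[OF cop2[OF \<epsilon>]]] .
      then have "z \<notin> \<Union>\<epsilon>" unfolding separating_def by auto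
      moreover have "m \<subseteq> \<Union>\<epsilon> \<or> \<Union>\<epsilon> \<subseteq> m"
        using nested_if_not_transverse[OF copy_tops_not_transverse[OF seg cop1[OF \<rho>(1)] cop2[OF \<epsilon>]] V(1), of y]
          mS(1) tB unfolding \<rho>(2) separating_def by auto
      ultimately show ?thesis using mS(2) H' by blast
    qed
    have mixed: "\<not> overlap K \<delta> \<epsilon>" if d: "\<delta> \<in> C1 - {\<rho>}" and e: "\<epsilon> \<in> C2" for \<delta> \<epsilon>
    proof -
      have s: "H' \<subset> H" if "H \<in> \<delta>" "H' \<in> \<epsilon>" for H H'
        using above[of \<delta> H] below[OF e that(2)] d that(1) by blast
      have "\<delta> \<inter> \<epsilon> = {}" using s by blast
      moreover have "\<not> transverse K H H'" if "H \<in> \<delta>" "H' \<in> \<epsilon>" for H H'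
        using not_transverse_if_subset[OF psubset_imp_subset[OF s[OF that]]] transverse_sym by blast
      ultimately show ?thesis unfolding overlap_def by blast
    qed
    have "nonoverlapping_copies \<gamma> ?S ((C1 - {\<rho>}) \<union> C2)"
      unfolding nonoverlapping_copies_def
    proof (intro conjI ballI)
      show "(C1 - {\<rho>}) \<union> C2 \<subseteq> copies G \<alpha> \<gamma>" using cop1 cop2 by blast
      show "\<delta> \<subseteq> ?S" if "\<delta> \<in> (C1 - {\<rho>}) \<union> C2" for \<delta> using that sub1 sub2 AS by blast
      show "pairwise (\<lambda>\<delta> \<delta>'. \<not> overlap K \<delta> \<delta>') ((C1 - {\<rho>}) \<union> C2)"
      proof (rule pairwiseI)
        fix \<delta> \<epsilon> assume de: "\<delta> \<in> (C1 - {\<rho>}) \<union> C2" "\<epsilon> \<in> (C1 - {\<rho>}) \<union> C2" "\<delta> \<noteq> \<epsilon>"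
        then consider "\<delta> \<in> C1" "\<epsilon> \<in> C1" | "\<delta> \<in> C2" "\<epsilon> \<in> C2" | "\<delta> \<in> C1 - {\<rho>}" "\<epsilon> \<in> C2"
          | "\<delta> \<in> C2" "\<epsilon> \<in> C1 - {\<rho>}" by blast
        then show "\<not> overlap K \<delta> \<epsilon>"
        proof cases
          case 1
          then show ?thesis using no1 de(3) by blast
        next
          case 2
          then show ?thesis using no2 de(3) by blast
        next
          case 3
          then show ?thesis by (rule mixed)
        next
          case 4
          then show ?thesis using mixed[of \<epsilon> \<delta>] overlap_sym by blast
        qed
      qed
    qed
    then have "card ((C1 - {\<rho>}) \<union> C2) \<le> count_in \<gamma> ?S" by (rule card_le_count[OF fin(1)])
    moreover have "(C1 - {\<rho>}) \<inter> C2 = {}"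
    proof (rule ccontr)
      assume "(C1 - {\<rho>}) \<inter> C2 \<noteq> {}"
      then obtain \<delta> where d: "\<delta> \<in> C1" "\<delta> \<in> C2" by blast
      then have "\<Union>\<delta> \<in> ?A" "\<Union>\<delta> \<in> ?B" using sub1[OF d(1)] sub2[OF d(2)] top(1)[OF cop1[OF d(1)]] by blast+
      then show False unfolding separating_def by blast
    qed
    then have "card ((C1 - {\<rho>}) \<union> C2) = card (C1 - {\<rho>}) + card C2"
      using C1(2) C2(2) by (intro card_Un_disjoint) simp_all
    moreover have "card (C1 - {\<rho>}) + 1 = card C1" using card_Suc_Diff1[OF C1(2) \<rho>(1)] by simp
    ultimately show ?thesis using C1(3) C2(3) by linarith
  qed
qed

end

section \<open>Homogenization\<close>

locale antisymmetric_quasimorphism = group G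
  for G :: "('g, 'b) monoid_scheme" (structure) +
  fixes \<psi> :: "'g \<Rightarrow> real" and D :: real
  assumes quasi: "g \<in> carrier G \<Longrightarrow> h \<in> carrier G \<Longrightarrow> \<bar>\<psi> (g \<otimes> h) - \<psi> g - \<psi> h\<bar> \<le> D"
    and antisym: "g \<in> carrier G \<Longrightarrow> \<psi> (inv g) = - \<psi> g"
begin

lemma D_nonneg: "0 \<le> D"
  using quasi[OF one_closed one_closed] by linarith

lemma one: "\<psi> \<one> = 0"
  using antisym[OF one_closed] by simp

lemma power_bound:
  assumes g: "g \<in> carrier G"
  shows "\<bar>\<psi> (g [^] n) - real n * \<psi> g\<bar> \<le> real n * D"
proof (induction n)
  case (Suc n)
  have "\<bar>\<psi> (g [^] n \<otimes> g) - \<psi> (g [^] n) - \<psi> g\<bar> \<le> D" using quasi g by simp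
  moreover have "g [^] Suc n = g [^] n \<otimes> g" by simp
  ultimately show ?case using Suc by (simp add: algebra_simps)
qed (simp add: one)

lemma power_mult_bound:
  assumes g: "g \<in> carrier G" and mn: "0 < m" "0 < n"
  shows "\<bar>\<psi> (g [^] (m * n)) / real (m * n) - \<psi> (g [^] n) / real n\<bar> \<le> D / real n"
proof -
  have "\<bar>\<psi> (g [^] (m * n)) - real m * \<psi> (g [^] n)\<bar> \<le> real m * D"
    using power_bound[of "g [^] n" m] g by (simp add: nat_pow_pow mult.commute)
  then have "\<bar>\<psi> (g [^] (m * n)) - real m * \<psi> (g [^] n)\<bar> / real (m * n) \<le> real m * D / real (m * n)"
    by (rule divide_right_mono) simp
  then have "\<bar>(\<psi> (g [^] (m * n)) - real m * \<psi> (g [^] n)) / real (m * n)\<bar> \<le> real m * D / real (m * n)"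
    by (simp only: abs_divide abs_of_nat)
  moreover have "(\<psi> (g [^] (m * n)) - real m * \<psi> (g [^] n)) / real (m * n)
      = \<psi> (g [^] (m * n)) / real (m * n) - \<psi> (g [^] n) / real n"
    using mn by (simp add: diff_divide_distrib)
  moreover have "real m * D / real (m * n) = D / real n" using mn by simp
  ultimately show ?thesis by (simp only:)
qed

text \<open>The terms for \<open>m\<close> and \<open>n\<close> are compared through the term for
  \<open>m * n\<close>, which makes the sequence Cauchy. Convergence is needed first, since
  \<open>lim\<close> denotes an unspecified value for a divergent sequence.\<close>

lemma homogenization_limit:
  assumes g: "g \<in> carrier G"
  shows "(\<lambda>n. \<psi> (g [^] (n::nat)) / real n) \<longlonglongrightarrow> homogenization G \<psi> g"
proof -
  let ?a = "\<lambda>n. \<psi> (g [^] (n::nat)) / real n"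
  have diff: "\<bar>?a m - ?a n\<bar> \<le> D / real m + D / real n" if "0 < m" "0 < n" for m n
    using power_mult_bound[OF g that] power_mult_bound[OF g that(2,1)]
    unfolding mult.commute[of n m] by linarith
  have "Cauchy ?a"
  proof (rule metric_CauchyI)
    fix e :: real assume e: "0 < e"
    obtain N :: nat where N: "2 * D / e < real N" using reals_Archimedean2 by blast
    have "0 \<le> 2 * D / e" using D_nonneg e by simp
    then have N0: "0 < real N" using N by linarith
    have b: "D / real k < e / 2" if "N \<le> k" for k
    proof -
      have "2 * D / e < real k" using N that by simp
      moreover have "0 < real k" using N0 that by simp
      ultimately show ?thesis using e by (simp add: field_simps)
    qed
    have "dist (?a m) (?a n) < e" if mn: "N \<le> m" "N \<le> n" for m n
    proof -
      have "0 < m" "0 < n" using N0 mn by simp_all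
      then show ?thesis using diff[of m n] b[OF mn(1)] b[OF mn(2)] unfolding dist_real_def by linarith
    qed
    then show "\<exists>M. \<forall>m\<ge>M. \<forall>n\<ge>M. dist (?a m) (?a n) < e" by blast
  qed
  then have "convergent ?a" by (rule real_Cauchy_convergent)
  then show ?thesis unfolding homogenization_def by (simp add: convergent_LIMSEQ_iff)
qed

lemma homogenization_close:
  assumes B: "\<And>g. g \<in> carrier G \<Longrightarrow> \<bar>\<psi> g - \<phi> g\<bar> \<le> B" and g: "g \<in> carrier G"
  shows "homogenization G \<phi> g = homogenization G \<psi> g"
proof -
  have "(\<lambda>n. (\<phi> (g [^] (n::nat)) - \<psi> (g [^] n)) / real n) \<longlonglongrightarrow> 0"
  proof (rule Lim_null_comparison)
    show "\<forall>\<^sub>F n in sequentially. norm ((\<phi> (g [^] (n::nat)) - \<psi> (g [^] n)) / real n) \<le> B / real n"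
    proof (rule always_eventually, rule allI)
      fix n :: nat
      have "\<bar>\<phi> (g [^] n) - \<psi> (g [^] n)\<bar> \<le> B" using B[of "g [^] n"] g by (simp add: abs_minus_commute)
      then show "norm ((\<phi> (g [^] n) - \<psi> (g [^] n)) / real n) \<le> B / real n"
        by (simp add: divide_right_mono)
    qed
    show "(\<lambda>n. B / real n) \<longlonglongrightarrow> 0" by (rule lim_const_over_n)
  qed
  from tendsto_add[OF this homogenization_limit[OF g]]
  have "(\<lambda>n. \<phi> (g [^] (n::nat)) / real n) \<longlonglongrightarrow> homogenization G \<psi> g"
    by (simp add: diff_divide_distrib)
  then show ?thesis unfolding homogenization_def[of G \<phi>] by (rule limI)
qed

text \<open>Three multiplications cost \<open>3 * D\<close>, and the four values cancel in pairs by
  antisymmetry. A fourth multiplication gives the \<open>4 * D\<close> of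
  \<open>block_interchange\<close>.\<close>

lemma commutator_bound:
  assumes "u \<in> carrier G" "v \<in> carrier G"
  shows "\<bar>\<psi> (u \<otimes> v \<otimes> inv u \<otimes> inv v)\<bar> \<le> 3 * D"
proof -
  have "\<bar>\<psi> (u \<otimes> v) - \<psi> u - \<psi> v\<bar> \<le> D"
    "\<bar>\<psi> (u \<otimes> v \<otimes> inv u) - \<psi> (u \<otimes> v) - \<psi> (inv u)\<bar> \<le> D"
    "\<bar>\<psi> (u \<otimes> v \<otimes> inv u \<otimes> inv v) - \<psi> (u \<otimes> v \<otimes> inv u) - \<psi> (inv v)\<bar> \<le> D"
    using assms by (auto intro!: quasi)
  then show ?thesis using antisym[OF assms(1)] antisym[OF assms(2)] by linarith
qed

text \<open>Interchanging two blocks of a word multiplies it by a single commutator.\<close>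

lemma block_interchange:
  assumes c: "s \<in> carrier G" "p \<in> carrier G" "q \<in> carrier G" "r \<in> carrier G" "t \<in> carrier G"
  shows "\<bar>\<psi> (s \<otimes> p \<otimes> q \<otimes> r \<otimes> t) - \<psi> (s \<otimes> r \<otimes> q \<otimes> p \<otimes> t)\<bar> \<le> 4 * D"
proof -
  \<comment> \<open>With these \<open>u\<close> and \<open>v\<close> the commutator equals
    \<open>s p q r p^-1 q^-1 r^-1 s^-1\<close>; multiplied by \<open>s r q p t\<close> it leaves
    \<open>s p q r t\<close>.\<close>
  define u where "u = s \<otimes> p \<otimes> q \<otimes> inv s"
  define v where "v = s \<otimes> r \<otimes> inv p \<otimes> inv s"
  let ?c = "u \<otimes> v \<otimes> inv u \<otimes> inv v" and ?w = "s \<otimes> r \<otimes> q \<otimes> p \<otimes> t"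
  have uv: "u \<in> carrier G" "v \<in> carrier G" using c unfolding u_def v_def by simp_all
  have canc: "inv x \<otimes> (x \<otimes> y) = y" "x \<otimes> (inv x \<otimes> y) = y" if "x \<in> carrier G" "y \<in> carrier G" for x y
    using that by (simp_all flip: m_assoc)
  have "?c \<otimes> ?w = s \<otimes> p \<otimes> q \<otimes> r \<otimes> t"
    unfolding u_def v_def using c by (simp add: inv_mult_group m_assoc canc)
  moreover have "\<bar>\<psi> (?c \<otimes> ?w) - \<psi> ?c - \<psi> ?w\<bar> \<le> D" using uv c by (intro quasi) simp_all
  ultimately show ?thesis using commutator_bound[OF uv] by simp
qed

lemma pow_shift:
  assumes ab: "a \<in> carrier G" "b \<in> carrier G"
  shows "b \<otimes> (a \<otimes> b) [^] (k::nat) = (b \<otimes> a) [^] k \<otimes> b"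
proof (induction k)
  case (Suc k)
  have "b \<otimes> (a \<otimes> b) [^] Suc k = b \<otimes> (a \<otimes> b) [^] k \<otimes> (a \<otimes> b)" using ab by (simp add: m_assoc)
  also have "\<dots> = (b \<otimes> a) [^] k \<otimes> b \<otimes> (a \<otimes> b)" using Suc by simp
  also have "\<dots> = (b \<otimes> a) [^] Suc k \<otimes> b" using ab by (simp add: m_assoc)
  finally show ?case .
qed (use ab in simp)

lemma pow_Suc_split:
  assumes ab: "a \<in> carrier G" "b \<in> carrier G"
  shows "(b \<otimes> a) [^] Suc k = b \<otimes> (a \<otimes> b) [^] (k::nat) \<otimes> a"
  unfolding pow_shift[OF ab] using ab by (simp add: m_assoc)

text \<open>Since \<open>(b a)^(k+2) = b (a b)^(k+1) a\<close>, interchanging the outer letters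
  yields \<open>a (a b)^(k+1) b = a^2 (b a)^k b^2\<close>. A single interchange thus sorts two
  letters at either end, which is why half as many interchanges as letters are enough.\<close>

lemma sort_step:
  assumes ab: "a \<in> carrier G" "b \<in> carrier G"
  shows "\<bar>\<psi> (a [^] (i::nat) \<otimes> (b \<otimes> a) [^] Suc (Suc k) \<otimes> b [^] i) -
    \<psi> (a [^] Suc (Suc i) \<otimes> (b \<otimes> a) [^] (k::nat) \<otimes> b [^] Suc (Suc i))\<bar> \<le> 4 * D"
proof -
  have "a [^] i \<otimes> (b \<otimes> a) [^] Suc (Suc k) \<otimes> b [^] i = a [^] i \<otimes> b \<otimes> (a \<otimes> b) [^] Suc k \<otimes> a \<otimes> b [^] i"
    unfolding pow_Suc_split[OF ab, of "Suc k"] using ab by (simp add: m_assoc del: nat_pow_Suc)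
  moreover have "a [^] Suc (Suc i) \<otimes> (b \<otimes> a) [^] k \<otimes> b [^] Suc (Suc i)
      = a [^] i \<otimes> a \<otimes> (a \<otimes> b) [^] Suc k \<otimes> b \<otimes> b [^] i"
    unfolding pow_Suc_split[OF ab(2,1), of k] nat_pow_Suc2[OF ab(2)] using ab
    by (simp add: m_assoc nat_pow_Suc2[OF ab(2)])
  ultimately show ?thesis
    using block_interchange[of "a [^] i" b "(a \<otimes> b) [^] Suc k" a "b [^] i"] ab by (simp del: nat_pow_Suc)
qed

lemma sort_bound:
  assumes ab: "a \<in> carrier G" "b \<in> carrier G"
  shows "\<bar>\<psi> (a [^] (i::nat) \<otimes> (b \<otimes> a) [^] (2 * m) \<otimes> b [^] i) - \<psi> (a [^] (i + 2 * m) \<otimes> b [^] (i + 2 * m))\<bar>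
    \<le> real m * (4 * D)"
proof (induction m arbitrary: i)
  case (Suc m)
  have "\<bar>\<psi> (a [^] i \<otimes> (b \<otimes> a) [^] (2 * Suc m) \<otimes> b [^] i) -
    \<psi> (a [^] Suc (Suc i) \<otimes> (b \<otimes> a) [^] (2 * m) \<otimes> b [^] Suc (Suc i))\<bar> \<le> 4 * D"
    using sort_step[OF ab, of i "2 * m"] by (simp del: nat_pow_Suc)
  moreover have "\<bar>\<psi> (a [^] Suc (Suc i) \<otimes> (b \<otimes> a) [^] (2 * m) \<otimes> b [^] Suc (Suc i)) -
    \<psi> (a [^] (i + 2 * Suc m) \<otimes> b [^] (i + 2 * Suc m))\<bar> \<le> real m * (4 * D)"
    using Suc[of "Suc (Suc i)"] by (simp del: nat_pow_Suc)
  moreover have "real (Suc m) * (4 * D) = real m * (4 * D) + 4 * D" by (simp add: algebra_simps)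
  ultimately show ?case by linarith
qed (use ab in simp)

lemma homogenization_defect:
  assumes ab: "a \<in> carrier G" "b \<in> carrier G"
  shows "\<bar>homogenization G \<psi> (a \<otimes> b) - homogenization G \<psi> a - homogenization G \<psi> b\<bar> \<le> 2 * D"
proof -
  \<comment> \<open>Odd exponents suffice, as the limit is known to exist. They fit because
    \<open>(a b)^(2m+1) = a (b a)^(2m) b\<close> has an even middle block, from which
    \<open>sort_step\<close> removes two factors at a time.\<close>
  let ?n = "\<lambda>m::nat. 2 * m + 1"
  let ?f = "\<lambda>g m. \<psi> (g [^] ?n m) / real (?n m)"
  have lim: "?f g \<longlonglongrightarrow> homogenization G \<psi> g" if "g \<in> carrier G" for g
    using LIMSEQ_subseq_LIMSEQ[OF homogenization_limit[OF that], of ?n]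
    by (simp add: comp_def strict_mono_def)
  have "(\<lambda>m. \<bar>?f (a \<otimes> b) m - ?f a m - ?f b m\<bar>) \<longlonglongrightarrow>
      \<bar>homogenization G \<psi> (a \<otimes> b) - homogenization G \<psi> a - homogenization G \<psi> b\<bar>"
    by (intro tendsto_rabs tendsto_diff lim) (use ab in simp_all)
  moreover have "\<bar>?f (a \<otimes> b) m - ?f a m - ?f b m\<bar> \<le> 2 * D" for m
  proof -
    have "(a \<otimes> b) [^] ?n m = a [^] (1::nat) \<otimes> (b \<otimes> a) [^] (2 * m) \<otimes> b [^] (1::nat)"
      using pow_Suc_split[OF ab(2,1), of "2 * m"] ab by (simp del: nat_pow_Suc)
    then have "\<bar>\<psi> ((a \<otimes> b) [^] ?n m) - \<psi> (a [^] ?n m \<otimes> b [^] ?n m)\<bar> \<le> real m * (4 * D)"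
      using sort_bound[OF ab, of 1 m] by (simp del: nat_pow_Suc add: add.commute)
    moreover have "\<bar>\<psi> (a [^] ?n m \<otimes> b [^] ?n m) - \<psi> (a [^] ?n m) - \<psi> (b [^] ?n m)\<bar> \<le> D"
      using ab by (intro quasi) simp_all
    ultimately have "\<bar>\<psi> ((a \<otimes> b) [^] ?n m) - \<psi> (a [^] ?n m) - \<psi> (b [^] ?n m)\<bar> \<le> real m * (4 * D) + D"
      by linarith
    \<comment> \<open>The total cost is \<open>(4 * m + 1) * D\<close> for the exponent
      \<open>2 * m + 1\<close>, a ratio of at most \<open>2 * D\<close>.\<close>
    also have "\<dots> \<le> 2 * D * real (?n m)" using D_nonneg by (simp add: algebra_simps)
    finally have "\<bar>(\<psi> ((a \<otimes> b) [^] ?n m) - \<psi> (a [^] ?n m) - \<psi> (b [^] ?n m)) / real (?n m)\<bar> \<le> 2 * D"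
      unfolding abs_divide by (simp add: divide_le_eq)
    then show ?thesis by (simp add: diff_divide_distrib)
  qed
  ultimately show ?thesis by (intro LIMSEQ_le_const2) blast+
qed

end

section \<open>Signed counts around a triangle\<close>

context CAT0_action
begin

definition signed_count_in :: "'v set set \<Rightarrow> 'v set set \<Rightarrow> real" where
  "signed_count_in \<gamma> S = real (count_in \<gamma> S) - real (count_in (inverse_segment K \<gamma>) S)"

lemma signed_count_eq:
  "x \<in> vertices K \<Longrightarrow> signed_count G K \<alpha> \<gamma> x y = signed_count_in \<gamma> (separating {x} {y})"
  unfolding signed_count_def signed_count_in_def copy_count_eq by (simp add: interval_separating)

lemma signed_count_in_swap:
  assumes \<gamma>: "\<gamma> \<subseteq> half_spaces K" and AB: "A \<subseteq> vertices K" "B \<subseteq> vertices K" "A \<noteq> {}" "B \<noteq> {}"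
  shows "signed_count_in \<gamma> (separating B A) = - signed_count_in \<gamma> (separating A B)"
  using count_inverse[OF \<gamma> AB] count_inverse[OF \<gamma> AB(2,1,4,3)] unfolding signed_count_in_def by simp

lemma signed_count_in_split:
  assumes seg: "segment K \<gamma>" and V: "x \<in> vertices K" "y \<in> vertices K"
  shows "\<bar>signed_count_in \<gamma> (separating {x} {y}) - signed_count_in \<gamma> (separating {x} {y, z}) -
    signed_count_in \<gamma> (separating {x, z} {y})\<bar> \<le> 2"
proof -
  have b: "\<bar>real (count_in \<epsilon> (separating {x} {y})) - real (count_in \<epsilon> (separating {x} {y, z})) -
    real (count_in \<epsilon> (separating {x, z} {y}))\<bar> \<le> 1" if "segment K \<epsilon>" for \<epsilon>
    using count_split_upper[OF that V, of z] count_split_lower[OF that V, of z] by linarith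
  show ?thesis
    using b[OF seg] b[OF segment_inverse[OF seg]] unfolding signed_count_in_def by linarith
qed

text \<open>Each of the three sides of a triangle is split by the opposite vertex; the six parts cancel in pairs.\<close>

lemma signed_count_triangle:
  assumes seg: "segment K \<gamma>" and V: "x \<in> vertices K" "y \<in> vertices K" "z \<in> vertices K"
  shows "\<bar>signed_count G K \<alpha> \<gamma> x y + signed_count G K \<alpha> \<gamma> y z + signed_count G K \<alpha> \<gamma> z x\<bar> \<le> 6"
proof -
  have \<gamma>: "\<gamma> \<subseteq> half_spaces K" by (rule segment_half_spaces[OF seg])
  have "signed_count_in \<gamma> (separating {z, y} {x}) = - signed_count_in \<gamma> (separating {x} {y, z})"
    "signed_count_in \<gamma> (separating {y} {z, x}) = - signed_count_in \<gamma> (separating {x, z} {y})"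
    "signed_count_in \<gamma> (separating {z} {x, y}) = - signed_count_in \<gamma> (separating {y, x} {z})"
    using signed_count_in_swap[OF \<gamma>, of "{x}" "{y, z}"] signed_count_in_swap[OF \<gamma>, of "{x, z}" "{y}"]
      signed_count_in_swap[OF \<gamma>, of "{y, x}" "{z}"] V by (simp_all add: insert_commute)
  then show ?thesis
    using signed_count_in_split[OF seg V(1,2), of z] signed_count_in_split[OF seg V(2,3), of x]
      signed_count_in_split[OF seg V(3,1), of y]
    unfolding signed_count_eq[OF V(1)] signed_count_eq[OF V(2)] signed_count_eq[OF V(3)] by linarith
qed

lemma signed_count_swap:
  assumes "segment K \<gamma>" "x \<in> vertices K" "y \<in> vertices K"
  shows "signed_count G K \<alpha> \<gamma> y x = - signed_count G K \<alpha> \<gamma> x y"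
  using signed_count_in_swap[OF segment_half_spaces[OF assms(1)], of "{x}" "{y}"] assms(2,3)
  by (simp add: signed_count_eq)

lemma signed_count_act:
  assumes "segment K \<gamma>" "g \<in> carrier G" "x \<in> vertices K" "y \<in> vertices K"
  shows "signed_count G K \<alpha> \<gamma> (\<alpha> g x) (\<alpha> g y) = signed_count G K \<alpha> \<gamma> x y"
proof -
  have \<gamma>: "\<gamma> \<subseteq> half_spaces K" by (rule segment_half_spaces[OF assms(1)])
  show ?thesis
    using count_act[OF assms(2) \<gamma>, of "{x}" "{y}"]
      count_act[OF assms(2) inverse_half_spaces[OF \<gamma>], of "{x}" "{y}"] assms(3,4) act_vertex[OF assms(2,3)]
    by (simp add: signed_count_eq signed_count_in_def)
qed

end

text \<open>\<open>K\<close> is itself a convex subcomplex containing the minimal complex, so it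
  takes part in the intersection that defines the hull. Vertices of the hull are therefore vertices
  of \<open>K\<close>.\<close>

lemma min_hull_subset: "min_hull K a \<subseteq> K"
proof -
  have "convex_subcomplex K K"
    unfolding convex_subcomplex_def subcomplex_def comb_geodesic_def edge_path_def edges_def by auto
  moreover have "min_complex K a \<subseteq> K" unfolding min_complex_def full_subcomplex_def by blast
  ultimately show ?thesis unfolding min_hull_def convex_hull_complex_def by blast
qed

theorem lemma4p5:
  fixes G :: "('g, 'b) monoid_scheme"
    and X :: "'v set set"
    and \<alpha> :: "'g \<Rightarrow> 'v \<Rightarrow> 'v"
    and \<gamma> :: "'v set set"
    and x0 :: 'v
    and xg :: "'g \<Rightarrow> 'v"
    and \<psi> \<phi> :: "'g \<Rightarrow> real"
  assumes "CAT0_cube_complex X"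
    and "non_transverse_action G X \<alpha>"
    and "segment X \<gamma>"
    and "x0 \<in> vertices X"
    and "\<And>g. g \<in> carrier G \<Longrightarrow> xg g \<in> vertices (min_hull X (\<alpha> g))"
    and "\<And>g. g \<in> carrier G \<Longrightarrow> \<psi> g = signed_count G X \<alpha> \<gamma> x0 (\<alpha> g x0)"
    and "\<And>g. g \<in> carrier G \<Longrightarrow> \<phi> g = signed_count G X \<alpha> \<gamma> (xg g) (\<alpha> g (xg g))"
  shows "(\<exists>B. \<forall>g\<in>carrier G. \<bar>\<psi> g - \<phi> g\<bar> \<le> B)
       \<and> quasimorphism G \<phi>
       \<and> (\<forall>g\<in>carrier G. homogenization G \<phi> g = homogenization G \<psi> g)
       \<and> quasimorphism G (homogenization G \<phi>)
       \<and> defect G (homogenization G \<phi>) \<le> 12"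
proof -
  interpret CAT0_action X G \<alpha> using assms(1,2) by unfold_locales
  let ?\<omega> = "signed_count G X \<alpha> \<gamma>"
  note tri = signed_count_triangle[OF assms(3)] and swap = signed_count_swap[OF assms(3)]
    and act = signed_count_act[OF assms(3)]
  note x0 = assms(4)
  have xgV: "xg g \<in> vertices X" if "g \<in> carrier G" for g
    using assms(5)[OF that] min_hull_subset[of X "\<alpha> g"] unfolding vertices_def by blast
  interpret antisymmetric_quasimorphism G \<psi> 6
  proof
    fix g h assume gh: "g \<in> carrier G" "h \<in> carrier G"
    have V: "\<alpha> g x0 \<in> vertices X" "\<alpha> h x0 \<in> vertices X" using act_vertex gh x0 by blast+
    have V': "\<alpha> g (\<alpha> h x0) \<in> vertices X" using act_vertex[OF gh(1) V(2)] .
    have c: "\<alpha> (g \<otimes>\<^bsub>G\<^esub> h) x0 = \<alpha> g (\<alpha> h x0)" using composition_rule[OF x0 gh] .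
    \<comment> \<open>The triangle of \<open>x0\<close>, \<open>g x0\<close> and
      \<open>g h x0\<close>; its middle side is the translate by \<open>g\<close> of the pair that
      defines \<open>\<psi> h\<close>.\<close>
    have "\<bar>?\<omega> x0 (\<alpha> g x0) + ?\<omega> (\<alpha> g x0) (\<alpha> g (\<alpha> h x0)) + ?\<omega> (\<alpha> g (\<alpha> h x0)) x0\<bar> \<le> 6"
      by (rule tri[OF x0 V(1) V'])
    then show "\<bar>\<psi> (g \<otimes>\<^bsub>G\<^esub> h) - \<psi> g - \<psi> h\<bar> \<le> 6"
      using act[OF gh(1) x0 V(2)] swap[OF x0 V'] assms(6)[OF gh(1)] assms(6)[OF gh(2)]
        assms(6)[OF m_closed[OF gh]] c by simp
  next
    fix g assume g: "g \<in> carrier G"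
    have V: "\<alpha> g x0 \<in> vertices X" using act_vertex g x0 by blast
    have "?\<omega> x0 (\<alpha> (inv\<^bsub>G\<^esub> g) x0) = ?\<omega> (\<alpha> g x0) (\<alpha> g (\<alpha> (inv\<^bsub>G\<^esub> g) x0))"
      using act[OF g x0 act_vertex[OF inv_closed[OF g] x0]] by simp
    also have "\<dots> = - ?\<omega> x0 (\<alpha> g x0)" using act_inv'[OF g x0] swap[OF x0 V] by simp
    finally show "\<psi> (inv\<^bsub>G\<^esub> g) = - \<psi> g" using assms(6)[OF g] assms(6)[OF inv_closed[OF g]] by simp
  qed
  \<comment> \<open>The quadrilateral \<open>x0\<close>, \<open>xg g\<close>,
    \<open>g (xg g)\<close>, \<open>g x0\<close> is cut into two triangles by the diagonal from
    \<open>xg g\<close> to \<open>g x0\<close>. The side from \<open>x0\<close> to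
    \<open>xg g\<close> and its translate cancel, and each triangle costs \<open>6\<close>.\<close>
  have close: "\<bar>\<psi> g - \<phi> g\<bar> \<le> 12" if g: "g \<in> carrier G" for g
  proof -
    let ?x = "xg g"
    have x: "?x \<in> vertices X" using xgV[OF g] .
    have V: "\<alpha> g x0 \<in> vertices X" "\<alpha> g ?x \<in> vertices X" using act_vertex[OF g] x0 x by blast+
    have "\<bar>?\<omega> x0 ?x + ?\<omega> ?x (\<alpha> g x0) + ?\<omega> (\<alpha> g x0) x0\<bar> \<le> 6" by (rule tri[OF x0 x V(1)])
    moreover have "\<bar>?\<omega> ?x (\<alpha> g ?x) + ?\<omega> (\<alpha> g ?x) (\<alpha> g x0) + ?\<omega> (\<alpha> g x0) ?x\<bar> \<le> 6" by (rule tri[OF x V(2,1)])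
    moreover have "?\<omega> (\<alpha> g ?x) (\<alpha> g x0) = - ?\<omega> x0 ?x" using act[OF g x x0] swap[OF x0 x] by simp
    moreover have "?\<omega> (\<alpha> g x0) x0 = - ?\<omega> x0 (\<alpha> g x0)" "?\<omega> (\<alpha> g x0) ?x = - ?\<omega> ?x (\<alpha> g x0)"
      using swap[OF x0 V(1)] swap[OF x V(1)] .
    ultimately show ?thesis using assms(6)[OF g] assms(7)[OF g] by linarith
  qed
  have hom: "homogenization G \<phi> g = homogenization G \<psi> g" if "g \<in> carrier G" for g
    using homogenization_close[OF close that] .
  \<comment> \<open>\<open>42 = 6 + 3 * 12\<close>: the defect of \<open>\<psi>\<close> and three
    replacements of \<open>\<psi>\<close> by \<open>\<phi>\<close>. The \<open>12\<close> for the
    homogenization is \<open>2 * 6\<close>, obtained from \<open>\<psi>\<close>, whose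
    homogenization is the same.\<close>
  have "defect_bound G \<phi> 42"
    unfolding defect_bound_def
  proof (intro conjI ballI)
    fix g h assume gh: "g \<in> carrier G" "h \<in> carrier G"
    show "\<bar>\<phi> (g \<otimes>\<^bsub>G\<^esub> h) - \<phi> g - \<phi> h\<bar> \<le> 42"
      using quasi[OF gh] close[OF gh(1)] close[OF gh(2)] close[OF m_closed[OF gh]] by linarith
  qed simp
  then have "quasimorphism G \<phi>" unfolding quasimorphism_def by blast
  moreover have bound: "defect_bound G (homogenization G \<phi>) 12"
    unfolding defect_bound_def using homogenization_defect hom by simp
  then have "quasimorphism G (homogenization G \<phi>)" unfolding quasimorphism_def by blast
  moreover have "defect G (homogenization G \<phi>) \<le> 12"
    unfolding defect_def
  proof (rule cInf_lower)
    show "bdd_below {D. defect_bound G (homogenization G \<phi>) D}"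
      by (rule bdd_belowI[of _ 0]) (simp add: defect_bound_def)
  qed (use bound in simp)
  ultimately show ?thesis using close hom by blast
qed

end
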